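(* Let $A$ be the irrational rotation algebra of finite Fourier series, and let $\Delta$ and $\epsilon$ be the $(A\otimes A,A)$-bimodule and the right $A$-module defined in the context. Then $\Delta$ (as coproduct) and $\epsilon$ (as counit) define a sesquiunital sesquialgebra structure on $A$ over $\mathbb{C}$.
   Context: All tensor products without subscript are over $\mathbb{C}$. Fix $\lambda\in\mathbb{R}$ with $\lambda/2\pi$ irrational. The algebra $A$: the unital associative $\mathbb{C}$-algebra with basis $\{a_{n,l} : n,l\in\mathbb{Z}\}$ and product $a_{n_1,l_1}a_{n_2,l_2}=e^{i\lambda n_1 l_2}a_{n_1+n_2,\,l_1+l_2}$; its unit is $a_{0,0}$. The $(A\otimes A,A)$-bimodule $\Delta$ has $\mathbb{C}$-basis $\{d_{n_1,n_2,l}: n_1,n_2,l\in\mathbb{Z}\}$ with right action $$d_{n_1,n_2,l}\cdot a_{m,j}=e^{i\lambda m(l-j)}\,d_{n_1+m,\,n_2+m,\,l-j}$$ and left action $$(a_{m_1,j_1}\otimes a_{m_2,j_2})\cdot d_{n_1,n_2,l}=e^{-i\lambda[(n_1+m_1)j_1+(n_2+m_2)j_2]}\,d_{n_1+m_1,\,n_2+m_2,\,l-j_1-j_2}.$$ The right $A$-module $\epsilon$ has $\mathbb{C}$-basis $\{e_l: l\in\mathbb{Z}\}$ with $e_l\cdot a_{m,j}=e^{i\lambda m(l-j)}e_{l-j}$. Definition. A sesquiunital sesquialgebra over a commutative ring $k$ is a unital $k$-algebra $A$ with an $(A\otimes A,A)$-bimodule $\Delta$ (coproduct) and a $(k,A)$-bimodule,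 i.e. right $A$-module, $\epsilon$ (counit), tensor products being over $k$, such that: (coassociativity) the $(A\otimes A\otimes A,A)$-bimodules $(A\otimes\Delta)\otimes_{A\otimes A}\Delta$ and $(\Delta\otimes A)\otimes_{A\otimes A}\Delta$ are isomorphic; (counit) the bimodules $(\epsilon\otimes A)\otimes_{A\otimes A}\Delta$ and $(A\otimes\epsilon)\otimes_{A\otimes A}\Delta$, which are $(k\otimes A,A)$- and $(A\otimes k,A)$-bimodules respectively and hence $(A,A)$-bimodules, are both isomorphic to $A$. Here $A\otimes \Delta$ and $\Delta\otimes A$ are $(A\otimes A\otimes A,A\otimes A)$-bimodules, with $A$ regarded as an $(A,A)$-bimodule over itself. *)

theory Defs
  imports
    "HOL-Algebra.Module"
    "HOL-Algebra.Free_Abelian_Groups"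
    "HOL-Algebra.Algebraic_Closure_Type"
begin

section \<open>Algebras and bimodules over a commutative ring\<close>

text \<open>The library locale \<open>algebra\<close> demands commutativity, hence the following variant.\<close>

locale assoc_algebra = module k A + A: ring A for k (structure) and A (structure) +
  assumes smult_mult_left:
      "\<lbrakk>c \<in> carrier k; x \<in> carrier A; y \<in> carrier A\<rbrakk> \<Longrightarrow>
        (c \<odot>\<^bsub>A\<^esub> x) \<otimes>\<^bsub>A\<^esub> y = c \<odot>\<^bsub>A\<^esub> (x \<otimes>\<^bsub>A\<^esub> y)"
    and smult_mult_right:
      "\<lbrakk>c \<in> carrier k; x \<in> carrier A; y \<in> carrier A\<rbrakk> \<Longrightarrow>
        x \<otimes>\<^bsub>A\<^esub> (c \<odot>\<^bsub>A\<^esub> y) = c \<odot>\<^bsub>A\<^esub> (x \<otimes>\<^bsub>A\<^esub> y)"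

text \<open>As usual for \<open>module\<close> records, the fields \<open>mult\<close> and \<open>one\<close>
  inherited from \<open>ring\<close> carry no meaning for a bimodule.\<close>

record ('k, 'b, 'm, 'a) bimod = "('k, 'm) module" +
  lact :: "'b \<Rightarrow> 'm \<Rightarrow> 'm" (infixr \<open>\<triangleright>\<index>\<close> 70)
  ract :: "'m \<Rightarrow> 'a \<Rightarrow> 'm" (infixl \<open>\<triangleleft>\<index>\<close> 70)

text \<open>\<open>(B, A)\<close>-bimodules over \<open>k\<close>: both actions are \<open>k\<close>-bilinear, so that the two actions
  of \<open>k\<close> obtained through \<open>B\<close> and through \<open>A\<close> agree.\<close>

locale bimodule =
  B: assoc_algebra k B + A: assoc_algebra k A + M: module k M
  for k :: "('k, 'r) ring_scheme" and B :: "('k, 'b, 's) module_scheme"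
    and A :: "('k, 'a, 't) module_scheme" and M :: "('k, 'b, 'm, 'a, 'u) bimod_scheme" +
  assumes lact_closed:
      "\<lbrakk>b \<in> carrier B; x \<in> carrier M\<rbrakk> \<Longrightarrow> b \<triangleright>\<^bsub>M\<^esub> x \<in> carrier M"
    and lact_add_left:
      "\<lbrakk>b \<in> carrier B; b' \<in> carrier B; x \<in> carrier M\<rbrakk> \<Longrightarrow>
        (b \<oplus>\<^bsub>B\<^esub> b') \<triangleright>\<^bsub>M\<^esub> x = (b \<triangleright>\<^bsub>M\<^esub> x) \<oplus>\<^bsub>M\<^esub> (b' \<triangleright>\<^bsub>M\<^esub> x)"
    and lact_add_right:
      "\<lbrakk>b \<in> carrier B; x \<in> carrier M; y \<in> carrier M\<rbrakk> \<Longrightarrow>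
        b \<triangleright>\<^bsub>M\<^esub> (x \<oplus>\<^bsub>M\<^esub> y) = (b \<triangleright>\<^bsub>M\<^esub> x) \<oplus>\<^bsub>M\<^esub> (b \<triangleright>\<^bsub>M\<^esub> y)"
    and lact_smult_left:
      "\<lbrakk>c \<in> carrier k; b \<in> carrier B; x \<in> carrier M\<rbrakk> \<Longrightarrow>
        (c \<odot>\<^bsub>B\<^esub> b) \<triangleright>\<^bsub>M\<^esub> x = c \<odot>\<^bsub>M\<^esub> (b \<triangleright>\<^bsub>M\<^esub> x)"
    and lact_smult_right:
      "\<lbrakk>c \<in> carrier k; b \<in> carrier B; x \<in> carrier M\<rbrakk> \<Longrightarrow>
        b \<triangleright>\<^bsub>M\<^esub> (c \<odot>\<^bsub>M\<^esub> x) = c \<odot>\<^bsub>M\<^esub> (b \<triangleright>\<^bsub>M\<^esub> x)"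
    and lact_mult:
      "\<lbrakk>b \<in> carrier B; b' \<in> carrier B; x \<in> carrier M\<rbrakk> \<Longrightarrow>
        (b \<otimes>\<^bsub>B\<^esub> b') \<triangleright>\<^bsub>M\<^esub> x = b \<triangleright>\<^bsub>M\<^esub> (b' \<triangleright>\<^bsub>M\<^esub> x)"
    and lact_one:
      "x \<in> carrier M \<Longrightarrow> \<one>\<^bsub>B\<^esub> \<triangleright>\<^bsub>M\<^esub> x = x"
    and ract_closed:
      "\<lbrakk>x \<in> carrier M; a \<in> carrier A\<rbrakk> \<Longrightarrow> x \<triangleleft>\<^bsub>M\<^esub> a \<in> carrier M"
    and ract_add_left:
      "\<lbrakk>x \<in> carrier M; y \<in> carrier M; a \<in> carrier A\<rbrakk> \<Longrightarrow>
        (x \<oplus>\<^bsub>M\<^esub> y) \<triangleleft>\<^bsub>M\<^esub> a = (x \<triangleleft>\<^bsub>M\<^esub> a) \<oplus>\<^bsub>M\<^esub> (y \<triangleleft>\<^bsub>M\<^esub> a)"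
    and ract_add_right:
      "\<lbrakk>x \<in> carrier M; a \<in> carrier A; a' \<in> carrier A\<rbrakk> \<Longrightarrow>
        x \<triangleleft>\<^bsub>M\<^esub> (a \<oplus>\<^bsub>A\<^esub> a') = (x \<triangleleft>\<^bsub>M\<^esub> a) \<oplus>\<^bsub>M\<^esub> (x \<triangleleft>\<^bsub>M\<^esub> a')"
    and ract_smult_left:
      "\<lbrakk>c \<in> carrier k; x \<in> carrier M; a \<in> carrier A\<rbrakk> \<Longrightarrow>
        (c \<odot>\<^bsub>M\<^esub> x) \<triangleleft>\<^bsub>M\<^esub> a = c \<odot>\<^bsub>M\<^esub> (x \<triangleleft>\<^bsub>M\<^esub> a)"
    and ract_smult_right:
      "\<lbrakk>c \<in> carrier k; x \<in> carrier M; a \<in> carrier A\<rbrakk> \<Longrightarrow>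
        x \<triangleleft>\<^bsub>M\<^esub> (c \<odot>\<^bsub>A\<^esub> a) = c \<odot>\<^bsub>M\<^esub> (x \<triangleleft>\<^bsub>M\<^esub> a)"
    and ract_mult:
      "\<lbrakk>x \<in> carrier M; a \<in> carrier A; a' \<in> carrier A\<rbrakk> \<Longrightarrow>
        x \<triangleleft>\<^bsub>M\<^esub> (a \<otimes>\<^bsub>A\<^esub> a') = (x \<triangleleft>\<^bsub>M\<^esub> a) \<triangleleft>\<^bsub>M\<^esub> a'"
    and ract_one:
      "x \<in> carrier M \<Longrightarrow> x \<triangleleft>\<^bsub>M\<^esub> \<one>\<^bsub>A\<^esub> = x"
    and lact_ract:
      "\<lbrakk>b \<in> carrier B; x \<in> carrier M; a \<in> carrier A\<rbrakk> \<Longrightarrow>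
        (b \<triangleright>\<^bsub>M\<^esub> x) \<triangleleft>\<^bsub>M\<^esub> a = b \<triangleright>\<^bsub>M\<^esub> (x \<triangleleft>\<^bsub>M\<^esub> a)"

definition bimodule_isomorphic ::
  "('k, 'r) ring_scheme \<Rightarrow> ('k, 'b, 's) module_scheme \<Rightarrow> ('k, 'a, 't) module_scheme \<Rightarrow>
    ('k, 'b, 'm, 'a) bimod \<Rightarrow> ('k, 'b, 'n, 'a) bimod \<Rightarrow> bool"
  where "bimodule_isomorphic k B A M N \<longleftrightarrow>
    (\<exists>f \<in> iso (add_monoid M) (add_monoid N).
      (\<forall>c \<in> carrier k. \<forall>x \<in> carrier M. f (c \<odot>\<^bsub>M\<^esub> x) = c \<odot>\<^bsub>N\<^esub> f x) \<and>
      (\<forall>b \<in> carrier B. \<forall>x \<in> carrier M. f (b \<triangleright>\<^bsub>M\<^esub> x) = b \<triangleright>\<^bsub>N\<^esub> f x) \<and>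
      (\<forall>x \<in> carrier M. \<forall>a \<in> carrier A. f (x \<triangleleft>\<^bsub>M\<^esub> a) = f x \<triangleleft>\<^bsub>N\<^esub> a))"

definition base_algebra :: "'k ring \<Rightarrow> ('k, 'k) module"
  where "base_algebra k =
    \<lparr>carrier = carrier k, monoid.mult = monoid.mult k, one = one k, ring.zero = ring.zero k,
     add = add k, module.smult = monoid.mult k\<rparr>"

definition regular_bimodule :: "('k, 'a) module \<Rightarrow> ('k, 'a, 'a, 'a) bimod"
  where "regular_bimodule A =
    \<lparr>carrier = carrier A, monoid.mult = monoid.mult A, one = one A, ring.zero = ring.zero A,
     add = add A, module.smult = module.smult A, lact = monoid.mult A, ract = monoid.mult A\<rparr>"

definition restrict_left ::
  "('c \<Rightarrow> 'b) \<Rightarrow> ('k, 'b, 'm, 'a) bimod \<Rightarrow> ('k, 'c, 'm, 'a) bimod"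
  where "restrict_left \<phi> M =
    \<lparr>carrier = carrier M, monoid.mult = monoid.mult M, one = one M, ring.zero = ring.zero M,
     add = add M, module.smult = module.smult M, lact = (\<lambda>b x. \<phi> b \<triangleright>\<^bsub>M\<^esub> x), ract = ract M\<rparr>"


section \<open>Tensor products\<close>

text \<open>The tensor product of a right module \<open>M\<close> and a left module \<open>N\<close> over a ring with carrier
  \<open>R\<close> and actions \<open>\<rho>\<close> and \<open>\<sigma>\<close> is the quotient of the free abelian group on \<open>M \<times> N\<close> by
  the subgroup generated by the biadditivity and balancing relations. Its elements are cosets
  of that subgroup.\<close>

definition tensor_relations ::
  "'r set \<Rightarrow> ('m \<Rightarrow> 'r \<Rightarrow> 'm) \<Rightarrow> ('r \<Rightarrow> 'n \<Rightarrow> 'n) \<Rightarrow>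
    ('m, 's) ring_scheme \<Rightarrow> ('n, 't) ring_scheme \<Rightarrow> ('m \<times> 'n \<Rightarrow>\<^sub>0 int) set"
  where "tensor_relations R \<rho> \<sigma> M N =
    generate (free_Abelian_group (carrier M \<times> carrier N))
     ({frag_of (x \<oplus>\<^bsub>M\<^esub> x', y) - frag_of (x, y) - frag_of (x', y) | x x' y.
         x \<in> carrier M \<and> x' \<in> carrier M \<and> y \<in> carrier N} \<union>
      {frag_of (x, y \<oplus>\<^bsub>N\<^esub> y') - frag_of (x, y) - frag_of (x, y') | x y y'.
         x \<in> carrier M \<and> y \<in> carrier N \<and> y' \<in> carrier N} \<union>
      {frag_of (\<rho> x r, y) - frag_of (x, \<sigma> r y) | x r y.
         x \<in> carrier M \<and> r \<in> R \<and> y \<in> carrier N})"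

definition tensor_group ::
  "('m, 's) ring_scheme \<Rightarrow> ('n, 't) ring_scheme \<Rightarrow> ('m \<times> 'n \<Rightarrow>\<^sub>0 int) set \<Rightarrow>
    ('m \<times> 'n \<Rightarrow>\<^sub>0 int) set ring"
  where "tensor_group M N H =
    (let Q = free_Abelian_group (carrier M \<times> carrier N) Mod H
     in \<lparr>carrier = carrier Q, monoid.mult = undefined, one = undefined,
         ring.zero = one Q, add = monoid.mult Q\<rparr>)"

definition pure_tensor ::
  "('m, 's) ring_scheme \<Rightarrow> ('n, 't) ring_scheme \<Rightarrow> ('m \<times> 'n \<Rightarrow>\<^sub>0 int) set \<Rightarrow>
    'm \<Rightarrow> 'n \<Rightarrow> ('m \<times> 'n \<Rightarrow>\<^sub>0 int) set"
  where "pure_tensor M N H x y =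
    H #>\<^bsub>free_Abelian_group (carrier M \<times> carrier N)\<^esub> frag_of (x, y)"

text \<open>The additive map out of a tensor product determined by \<open>x \<otimes> y \<mapsto> \<beta> x y\<close>. It is well
  defined when \<open>\<beta>\<close> is biadditive and balanced, the sum being the same for all members of a
  coset.\<close>

definition tensor_lift ::
  "('t, 's) ring_scheme \<Rightarrow> ('m \<Rightarrow> 'n \<Rightarrow> 't) \<Rightarrow> ('m \<times> 'n \<Rightarrow>\<^sub>0 int) set \<Rightarrow> 't"
  where "tensor_lift T \<beta> u =
    the_elem
      ((\<lambda>f. \<Oplus>\<^bsub>T\<^esub>p \<in> Poly_Mapping.keys f. [Poly_Mapping.lookup f p] \<cdot>\<^bsub>T\<^esub> \<beta> (fst p) (snd p)) ` u)"

definition scalar_relations ::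
  "('k, 'r) ring_scheme \<Rightarrow> ('k, 'm, 's) module_scheme \<Rightarrow> ('k, 'n, 't) module_scheme \<Rightarrow>
    ('m \<times> 'n \<Rightarrow>\<^sub>0 int) set"
  where "scalar_relations k M N =
    tensor_relations (carrier k) (\<lambda>x c. c \<odot>\<^bsub>M\<^esub> x) (\<lambda>c y. c \<odot>\<^bsub>N\<^esub> y) M N"

definition alg_pure ::
  "'k ring \<Rightarrow> ('k, 'a) module \<Rightarrow> ('k, 'b) module \<Rightarrow> 'a \<Rightarrow> 'b \<Rightarrow> ('a \<times> 'b \<Rightarrow>\<^sub>0 int) set"
  where "alg_pure k A B = pure_tensor A B (scalar_relations k A B)"

definition alg_tensor ::
  "'k ring \<Rightarrow> ('k, 'a) module \<Rightarrow> ('k, 'b) module \<Rightarrow> ('k, ('a \<times> 'b \<Rightarrow>\<^sub>0 int) set) module"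
  where "alg_tensor k A B =
    (let T = tensor_group A B (scalar_relations k A B); t = alg_pure k A B
     in \<lparr>carrier = carrier T,
         monoid.mult = (\<lambda>u v. tensor_lift T (\<lambda>a b.
            tensor_lift T (\<lambda>a' b'. t (a \<otimes>\<^bsub>A\<^esub> a') (b \<otimes>\<^bsub>B\<^esub> b')) v) u),
         one = t \<one>\<^bsub>A\<^esub> \<one>\<^bsub>B\<^esub>,
         ring.zero = ring.zero T,
         add = add T,
         module.smult = (\<lambda>c. tensor_lift T (\<lambda>a b. t (c \<odot>\<^bsub>A\<^esub> a) b))\<rparr>)"

definition alg_assoc ::
  "'k ring \<Rightarrow> ('k, 'a) module \<Rightarrow> ('k, 'b) module \<Rightarrow> ('k, 'c) module \<Rightarrow>
    (('a \<times> 'b \<Rightarrow>\<^sub>0 int) set \<times> 'c \<Rightarrow>\<^sub>0 int) set \<Rightarrow> ('a \<times> ('b \<times> 'c \<Rightarrow>\<^sub>0 int) set \<Rightarrow>\<^sub>0 int) set"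
  where "alg_assoc k A B C =
    (let T = alg_tensor k A (alg_tensor k B C)
     in tensor_lift T (\<lambda>u c. tensor_lift T (\<lambda>a b.
          alg_pure k A (alg_tensor k B C) a (alg_pure k B C b c)) u))"

text \<open>The tensor product over \<open>k\<close> of a \<open>(B, A)\<close>- and a \<open>(B', A')\<close>-bimodule, as a
  \<open>(B \<otimes> B', A \<otimes> A')\<close>-bimodule.\<close>

definition bimod_tensor ::
  "'k ring \<Rightarrow> ('k, 'b, 'm, 'a) bimod \<Rightarrow> ('k, 'b', 'n, 'a') bimod \<Rightarrow>
    ('k, ('b \<times> 'b' \<Rightarrow>\<^sub>0 int) set, ('m \<times> 'n \<Rightarrow>\<^sub>0 int) set, ('a \<times> 'a' \<Rightarrow>\<^sub>0 int) set) bimod"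
  where "bimod_tensor k M N =
    (let H = scalar_relations k M N; T = tensor_group M N H; t = pure_tensor M N H
     in \<lparr>carrier = carrier T, monoid.mult = undefined, one = undefined,
         ring.zero = ring.zero T, add = add T,
         module.smult = (\<lambda>c. tensor_lift T (\<lambda>x y. t (c \<odot>\<^bsub>M\<^esub> x) y)),
         lact = (\<lambda>u w. tensor_lift T (\<lambda>b b'.
            tensor_lift T (\<lambda>x y. t (b \<triangleright>\<^bsub>M\<^esub> x) (b' \<triangleright>\<^bsub>N\<^esub> y)) w) u),
         ract = (\<lambda>w v. tensor_lift T (\<lambda>a a'.
            tensor_lift T (\<lambda>x y. t (x \<triangleleft>\<^bsub>M\<^esub> a) (y \<triangleleft>\<^bsub>N\<^esub> a')) w) v)\<rparr>)"

text \<open>The tensor product over \<open>R\<close> of a \<open>(B, R)\<close>- and an \<open>(R, A)\<close>-bimodule, as a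
  \<open>(B, A)\<close>-bimodule.\<close>

definition bimod_compose ::
  "('k, 'r) module \<Rightarrow> ('k, 'b, 'm, 'r) bimod \<Rightarrow> ('k, 'r, 'n, 'a) bimod \<Rightarrow>
    ('k, 'b, ('m \<times> 'n \<Rightarrow>\<^sub>0 int) set, 'a) bimod"
  where "bimod_compose R M N =
    (let H = tensor_relations (carrier R) (ract M) (lact N) M N;
         T = tensor_group M N H; t = pure_tensor M N H
     in \<lparr>carrier = carrier T, monoid.mult = undefined, one = undefined,
         ring.zero = ring.zero T, add = add T,
         module.smult = (\<lambda>c. tensor_lift T (\<lambda>x y. t (c \<odot>\<^bsub>M\<^esub> x) y)),
         lact = (\<lambda>b. tensor_lift T (\<lambda>x y. t (b \<triangleright>\<^bsub>M\<^esub> x) y)),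
         ract = (\<lambda>w a. tensor_lift T (\<lambda>x y. t x (y \<triangleleft>\<^bsub>N\<^esub> a)) w)\<rparr>)"


section \<open>Sesquiunital sesquialgebras\<close>

text \<open>\<open>A \<otimes> (A \<otimes> A)\<close> and \<open>(A \<otimes> A) \<otimes> A\<close> are identified through \<open>alg_assoc\<close>, and
  \<open>k \<otimes> A\<close> and \<open>A \<otimes> k\<close> with \<open>A\<close> through \<open>a \<mapsto> 1 \<otimes> a\<close> and \<open>a \<mapsto> a \<otimes> 1\<close>. A right
  \<open>A\<close>-module is a \<open>(k, A)\<close>-bimodule.\<close>

locale sesquiunital_sesquialgebra =
  A: assoc_algebra k A +
  coproduct: bimodule k "alg_tensor k A A" A \<Delta> +
  counit: bimodule k "base_algebra k" A \<epsilon>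
  for k :: "'k ring" and A :: "('k, 'a) module"
    and \<Delta> :: "('k, ('a \<times> 'a \<Rightarrow>\<^sub>0 int) set, 'd, 'a) bimod"
    and \<epsilon> :: "('k, 'k, 'e, 'a) bimod" +
  assumes coassociativity:
      "bimodule_isomorphic k (alg_tensor k (alg_tensor k A A) A) A
        (restrict_left (alg_assoc k A A A)
          (bimod_compose (alg_tensor k A A) (bimod_tensor k (regular_bimodule A) \<Delta>) \<Delta>))
        (bimod_compose (alg_tensor k A A) (bimod_tensor k \<Delta> (regular_bimodule A)) \<Delta>)"
    and counit_left:
      "bimodule_isomorphic k A A
        (restrict_left (\<lambda>a. alg_pure k (base_algebra k) A \<one>\<^bsub>k\<^esub> a)
          (bimod_compose (alg_tensor k A A) (bimod_tensor k \<epsilon> (regular_bimodule A)) \<Delta>))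
        (regular_bimodule A)"
    and counit_right:
      "bimodule_isomorphic k A A
        (restrict_left (\<lambda>a. alg_pure k A (base_algebra k) a \<one>\<^bsub>k\<^esub>)
          (bimod_compose (alg_tensor k A A) (bimod_tensor k (regular_bimodule A) \<epsilon>) \<Delta>))
        (regular_bimodule A)"


section \<open>The irrational rotation algebra and its bimodules\<close>

text \<open>The complex vector space with basis \<open>'p\<close> is the type \<open>'p \<Rightarrow>\<^sub>0 complex\<close> of finitely
  supported functions, the basis vectors being \<open>Poly_Mapping.single p 1\<close>.\<close>

definition scale :: "complex \<Rightarrow> ('p \<Rightarrow>\<^sub>0 complex) \<Rightarrow> ('p \<Rightarrow>\<^sub>0 complex)"
  where "scale c = Poly_Mapping.map ((*) c)"

definition lin_ext :: "('p \<Rightarrow> 'q \<Rightarrow>\<^sub>0 complex) \<Rightarrow> ('p \<Rightarrow>\<^sub>0 complex) \<Rightarrow> ('q \<Rightarrow>\<^sub>0 complex)"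
  where "lin_ext f x = (\<Sum>p \<in> Poly_Mapping.keys x. scale (Poly_Mapping.lookup x p) (f p))"

lemma lin_ext_basis [simp]: "lin_ext f (Poly_Mapping.single p 1) = f p"
  by (simp add: lin_ext_def scale_def poly_mapping_eqI map.rep_eq when_def)

definition free_space :: "(complex, 'p \<Rightarrow>\<^sub>0 complex) module"
  where "free_space =
    \<lparr>carrier = UNIV, monoid.mult = undefined, one = undefined, ring.zero = 0, add = (+),
     module.smult = scale\<rparr>"

abbreviation complex_ring :: "complex ring"
  where "complex_ring \<equiv> ring_of_type_algebra"

definition rotation_algebra :: "real \<Rightarrow> (complex, int \<times> int \<Rightarrow>\<^sub>0 complex) module"
  where "rotation_algebra \<theta> =
    \<lparr>carrier = UNIV,
     monoid.mult = (\<lambda>x y. lin_ext (\<lambda>(n\<^sub>1, l\<^sub>1). lin_ext (\<lambda>(n\<^sub>2, l\<^sub>2).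
        Poly_Mapping.single (n\<^sub>1 + n\<^sub>2, l\<^sub>1 + l\<^sub>2) (cis (\<theta> * of_int (n\<^sub>1 * l\<^sub>2)))) y) x),
     one = Poly_Mapping.single (0, 0) 1,
     ring.zero = 0,
     add = (+),
     module.smult = scale\<rparr>"

definition rotation_coproduct ::
  "real \<Rightarrow> (complex, ((int \<times> int \<Rightarrow>\<^sub>0 complex) \<times> (int \<times> int \<Rightarrow>\<^sub>0 complex) \<Rightarrow>\<^sub>0 int) set,
    int \<times> int \<times> int \<Rightarrow>\<^sub>0 complex, int \<times> int \<Rightarrow>\<^sub>0 complex) bimod"
  where "rotation_coproduct \<theta> =
    \<lparr>carrier = UNIV, monoid.mult = undefined, one = undefined, ring.zero = 0, add = (+),
     module.smult = scale,
     lact = (\<lambda>u d. tensor_lift free_space (\<lambda>x y.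
        lin_ext (\<lambda>(m\<^sub>1, j\<^sub>1). lin_ext (\<lambda>(m\<^sub>2, j\<^sub>2). lin_ext (\<lambda>(n\<^sub>1, n\<^sub>2, l).
          Poly_Mapping.single (n\<^sub>1 + m\<^sub>1, n\<^sub>2 + m\<^sub>2, l - j\<^sub>1 - j\<^sub>2)
            (cis (- \<theta> * of_int ((n\<^sub>1 + m\<^sub>1) * j\<^sub>1 + (n\<^sub>2 + m\<^sub>2) * j\<^sub>2)))) d) y) x) u),
     ract = (\<lambda>d x. lin_ext (\<lambda>(n\<^sub>1, n\<^sub>2, l). lin_ext (\<lambda>(m, j).
        Poly_Mapping.single (n\<^sub>1 + m, n\<^sub>2 + m, l - j) (cis (\<theta> * of_int (m * (l - j))))) x) d)\<rparr>"

definition rotation_counit ::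
  "real \<Rightarrow> (complex, complex, int \<Rightarrow>\<^sub>0 complex, int \<times> int \<Rightarrow>\<^sub>0 complex) bimod"
  where "rotation_counit \<theta> =
    \<lparr>carrier = UNIV, monoid.mult = undefined, one = undefined, ring.zero = 0, add = (+),
     module.smult = scale,
     lact = scale,
     ract = (\<lambda>e x. lin_ext (\<lambda>l. lin_ext (\<lambda>(m, j).
        Poly_Mapping.single (l - j) (cis (\<theta> * of_int (m * (l - j))))) x) e)\<rparr>"

end

theory Submission
  imports Defs
begin

text \<open>Everything is monomial: \<open>A\<close>, \<open>\<Delta>\<close> and \<open>\<epsilon>\<close> have bases that all actions permute up to
  phases. As a right \<open>A\<close>-module, \<open>\<Delta>\<close> is free on the vectors \<open>d(n, 0, 0)\<close>, and \<open>\<epsilon>\<close> is generated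
  by \<open>e(0)\<close>. Moving elements of \<open>A \<otimes> A\<close> across the tensor sign therefore brings every pure tensor
  of basis vectors to a phase times a normal form, and the normal forms are linearly independent
  because the map sending a pure tensor to its normal form is balanced.

  Both sides of coassociativity get a basis \<open>b(v\<^sub>1, v\<^sub>2, v\<^sub>3, l)\<close> on which \<open>a(m\<^sub>1, j\<^sub>1) \<otimes> a(m\<^sub>2, j\<^sub>2) \<otimes>
  a(m\<^sub>3, j\<^sub>3)\<close> acts with phase \<open>- \<Sum>\<^sub>i (v\<^sub>i + m\<^sub>i) j\<^sub>i\<close> as the shift to \<open>b(v + m, l - j\<^sub>1 - j\<^sub>2 - j\<^sub>3)\<close>,
  and \<open>a(m, j)\<close> acts from the right with phase \<open>m (l - j)\<close> as the shift to
  \<open>b(v + (m, m, m), l - j)\<close>. Both counit composites get a basis \<open>b(n, l)\<close> that corresponds to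
  \<open>a(n, - l)\<close> with phase \<open>- n l\<close>. Matching these bases gives the isomorphisms.\<close>

text \<open>Products and actions on a tensor product are instances of \<open>tensor_lift\<close>,
  that is \<open>the_elem\<close> of the image of a coset, so nothing about them can be computed
  before biadditivity and balancedness are known. This is why the universal property carries the
  development: once it holds, identities of additive maps reduce to pure tensors. Independence in a
  quotient by generated relations is hard to see directly, so a basis is a spanning family with a
  linear coordinate map into \<open>free_space\<close>; on a tensor product such a map is again a
  \<open>tensor_lift\<close>. The constants come from one move. Since
  \<open>d(n1 - n2, 0, 0)\<close> times \<open>a(n2, - l)\<close> is \<open>d(n1, n2, l)\<close> up
  to the exponent \<open>n2 l\<close>, the element \<open>a(n2, - l)\<close> is what crosses the
  tensor sign, and only \<open>n1 - n2\<close> stays behind. The phase of a normal form is the phase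
  of the left action divided by that of the right action. For \<open>\<epsilon>\<close> nothing
  stays behind: up to phase, \<open>a(m, - l)\<close> carries \<open>e(0)\<close> to
  \<open>e(l)\<close> for every \<open>m\<close>, and the free \<open>m\<close> is spent on clearing
  one index of the other factor.\<close>

abbreviation add_hom :: "('a, 's) ring_scheme \<Rightarrow> ('b, 't) ring_scheme \<Rightarrow> ('a \<Rightarrow> 'b) set"
  where "add_hom M N \<equiv> hom (add_monoid M) (add_monoid N)"

lemma add_homI:
  assumes "\<And>x. x \<in> carrier M \<Longrightarrow> f x \<in> carrier N"
    and "\<And>x y. \<lbrakk>x \<in> carrier M; y \<in> carrier M\<rbrakk> \<Longrightarrow> f (x \<oplus>\<^bsub>M\<^esub> y) = f x \<oplus>\<^bsub>N\<^esub> f y"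
  shows "f \<in> add_hom M N"
  using assms by (auto simp: hom_def)

lemma add_hom_closed: "\<lbrakk>f \<in> add_hom M N; x \<in> carrier M\<rbrakk> \<Longrightarrow> f x \<in> carrier N"
  by (auto simp: hom_def)

lemma add_hom_add:
  "\<lbrakk>f \<in> add_hom M N; x \<in> carrier M; y \<in> carrier M\<rbrakk> \<Longrightarrow> f (x \<oplus>\<^bsub>M\<^esub> y) = f x \<oplus>\<^bsub>N\<^esub> f y"
  by (auto simp: hom_def)

lemma add_hom_compose: "\<lbrakk>f \<in> add_hom M N; g \<in> add_hom N P\<rbrakk> \<Longrightarrow> (\<lambda>x. g (f x)) \<in> add_hom M P"
  by (simp add: hom_def Pi_iff)

lemma add_hom_zero:
  assumes "f \<in> add_hom M N" "abelian_group M" "abelian_group N"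
  shows "f \<zero>\<^bsub>M\<^esub> = \<zero>\<^bsub>N\<^esub>"
  using hom_one[OF assms(1)] assms(2,3) by (simp add: abelian_group.a_group)

lemma add_hom_neg:
  assumes "f \<in> add_hom M N" "abelian_group M" "abelian_group N" "x \<in> carrier M"
  shows "f (\<ominus>\<^bsub>M\<^esub> x) = \<ominus>\<^bsub>N\<^esub> f x"
proof -
  interpret group_hom "add_monoid M" "add_monoid N" f
    using assms by (simp add: group_hom_def group_hom_axioms_def abelian_group.a_group)
  show ?thesis using hom_inv[of x] assms(4) by (simp add: a_inv_def)
qed

lemma abelian_group_cong:
  assumes "abelian_group M" "carrier N = carrier M" "add N = add M" "\<zero>\<^bsub>N\<^esub> = \<zero>\<^bsub>M\<^esub>"
  shows "abelian_group N"
proof -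
  interpret M: abelian_group M by fact
  show ?thesis
    by (rule abelian_groupI)
      (simp_all add: assms M.a_ac bexI[where x = "\<ominus>\<^bsub>M\<^esub> x" for x] M.l_neg)
qed

section \<open>Evaluation of formal integer combinations in an abelian group\<close>

context abelian_group
begin

text \<open>The sum runs over the support of \<open>f\<close>, which changes under addition.
  Extending it by zero terms to the union of both supports makes additivity a termwise
  matter.\<close>

lemma frag_sum_hom:
  assumes b: "\<And>p. p \<in> S \<Longrightarrow> b p \<in> carrier G"
  shows "(\<lambda>f. \<Oplus>p \<in> Poly_Mapping.keys f. [Poly_Mapping.lookup f p] \<cdot> b p)
           \<in> hom (free_Abelian_group S) (add_monoid G)" (is "?F \<in> _")
proof (rule homI)
  fix f :: "'c \<Rightarrow>\<^sub>0 int"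
  assume "f \<in> carrier (free_Abelian_group S)"
  then show "?F f \<in> carrier (add_monoid G)"
    using b by (auto intro!: finsum_closed add.int_pow_closed)
next
  have ext: "?F f = (\<Oplus>p \<in> K. [Poly_Mapping.lookup f p] \<cdot> b p)"
    if "finite K" "Poly_Mapping.keys f \<subseteq> K" "K \<subseteq> S" for K and f :: "'c \<Rightarrow>\<^sub>0 int"
    by (rule add.finprod_mono_neutral_cong_left)
      (use that b in \<open>auto simp: in_keys_iff add_pow_def intro!: add.int_pow_closed[unfolded add_pow_def]\<close>)
  fix f g :: "'c \<Rightarrow>\<^sub>0 int"
  assume fg: "f \<in> carrier (free_Abelian_group S)" "g \<in> carrier (free_Abelian_group S)"
  let ?K = "Poly_Mapping.keys f \<union> Poly_Mapping.keys g"
  have "?F (f + g) = (\<Oplus>p \<in> ?K. [Poly_Mapping.lookup (f + g) p] \<cdot> b p)"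
    using fg keys_add[of f g] by (intro ext) auto
  also have "\<dots> = (\<Oplus>p \<in> ?K. [Poly_Mapping.lookup f p] \<cdot> b p \<oplus> [Poly_Mapping.lookup g p] \<cdot> b p)"
    by (rule finsum_cong')
      (use fg b in \<open>auto simp: lookup_add add.int_pow_mult intro!: add.int_pow_closed\<close>)
  also have "\<dots> = (\<Oplus>p \<in> ?K. [Poly_Mapping.lookup f p] \<cdot> b p)
      \<oplus> (\<Oplus>p \<in> ?K. [Poly_Mapping.lookup g p] \<cdot> b p)"
    by (rule finsum_addf) (use fg b in \<open>auto intro!: add.int_pow_closed\<close>)
  also have "\<dots> = ?F f \<oplus> ?F g"
    using fg by (simp add: ext[of ?K f] ext[of ?K g])
  finally show "?F (f \<otimes>\<^bsub>free_Abelian_group S\<^esub> g) = ?F f \<otimes>\<^bsub>add_monoid G\<^esub> ?F g"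
    by simp
qed

lemma frag_sum_frag_of:
  assumes "b p \<in> carrier G"
  shows "(\<Oplus>q \<in> Poly_Mapping.keys (frag_of p). [Poly_Mapping.lookup (frag_of p) q] \<cdot> b q) = b p"
  using assms add.int_pow_1 by (simp add: finsum_insert)

end


section \<open>Tensor products of abelian groups\<close>

definition bihom ::
  "('m, 's) ring_scheme \<Rightarrow> ('n, 't) ring_scheme \<Rightarrow> ('g, 'u) ring_scheme \<Rightarrow> ('m \<Rightarrow> 'n \<Rightarrow> 'g) \<Rightarrow> bool"
  where "bihom M N G \<beta> \<longleftrightarrow>
    (\<forall>x \<in> carrier M. \<beta> x \<in> add_hom N G) \<and> (\<forall>y \<in> carrier N. (\<lambda>x. \<beta> x y) \<in> add_hom M G)"

lemma bihomI:
  assumes "\<And>x y. \<lbrakk>x \<in> carrier M; y \<in> carrier N\<rbrakk> \<Longrightarrow> \<beta> x y \<in> carrier G"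
    and "\<And>x x' y. \<lbrakk>x \<in> carrier M; x' \<in> carrier M; y \<in> carrier N\<rbrakk> \<Longrightarrow>
      \<beta> (x \<oplus>\<^bsub>M\<^esub> x') y = \<beta> x y \<oplus>\<^bsub>G\<^esub> \<beta> x' y"
    and "\<And>x y y'. \<lbrakk>x \<in> carrier M; y \<in> carrier N; y' \<in> carrier N\<rbrakk> \<Longrightarrow>
      \<beta> x (y \<oplus>\<^bsub>N\<^esub> y') = \<beta> x y \<oplus>\<^bsub>G\<^esub> \<beta> x y'"
  shows "bihom M N G \<beta>"
  using assms by (auto simp: bihom_def intro!: add_homI)

lemma bihomD:
  assumes "bihom M N G \<beta>"
  shows "\<And>x y. \<lbrakk>x \<in> carrier M; y \<in> carrier N\<rbrakk> \<Longrightarrow> \<beta> x y \<in> carrier G"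
    and "\<And>x x' y. \<lbrakk>x \<in> carrier M; x' \<in> carrier M; y \<in> carrier N\<rbrakk> \<Longrightarrow>
      \<beta> (x \<oplus>\<^bsub>M\<^esub> x') y = \<beta> x y \<oplus>\<^bsub>G\<^esub> \<beta> x' y"
    and "\<And>x y y'. \<lbrakk>x \<in> carrier M; y \<in> carrier N; y' \<in> carrier N\<rbrakk> \<Longrightarrow>
      \<beta> x (y \<oplus>\<^bsub>N\<^esub> y') = \<beta> x y \<oplus>\<^bsub>G\<^esub> \<beta> x y'"
  using assms by (auto simp: bihom_def hom_def)

definition balanced ::
  "'r set \<Rightarrow> ('m \<Rightarrow> 'r \<Rightarrow> 'm) \<Rightarrow> ('r \<Rightarrow> 'n \<Rightarrow> 'n) \<Rightarrow>
    ('m, 's) ring_scheme \<Rightarrow> ('n, 't) ring_scheme \<Rightarrow> ('m \<Rightarrow> 'n \<Rightarrow> 'g) \<Rightarrow> bool"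
  where "balanced R \<rho> \<sigma> M N \<beta> \<longleftrightarrow>
    (\<forall>x \<in> carrier M. \<forall>r \<in> R. \<forall>y \<in> carrier N. \<beta> (\<rho> x r) y = \<beta> x (\<sigma> r y))"

text \<open>Only closure of the two actions is asked for, so that tensor products over the scalars
  and over an algebra are both instances.\<close>

locale tensor_product = M: abelian_group M + N: abelian_group N
  for R :: "'r set" and \<rho> :: "'m \<Rightarrow> 'r \<Rightarrow> 'm" and \<sigma> :: "'r \<Rightarrow> 'n \<Rightarrow> 'n"
    and M :: "('m, 's) ring_scheme" and N :: "('n, 't) ring_scheme" +
  assumes right_closed: "\<lbrakk>x \<in> carrier M; r \<in> R\<rbrakk> \<Longrightarrow> \<rho> x r \<in> carrier M"
    and left_closed: "\<lbrakk>r \<in> R; y \<in> carrier N\<rbrakk> \<Longrightarrow> \<sigma> r y \<in> carrier N"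
begin

abbreviation relations where "relations \<equiv> tensor_relations R \<rho> \<sigma> M N"
abbreviation T where "T \<equiv> tensor_group M N relations"
abbreviation t where "t \<equiv> pure_tensor M N relations"
abbreviation F where "F \<equiv> free_Abelian_group (carrier M \<times> carrier N)"

lemma generator_sub_carrier:
  "{frag_of (x \<oplus>\<^bsub>M\<^esub> x', y) - frag_of (x, y) - frag_of (x', y) | x x' y.
         x \<in> carrier M \<and> x' \<in> carrier M \<and> y \<in> carrier N} \<union>
      {frag_of (x, y \<oplus>\<^bsub>N\<^esub> y') - frag_of (x, y) - frag_of (x, y') | x y y'.
         x \<in> carrier M \<and> y \<in> carrier N \<and> y' \<in> carrier N} \<union>
      {frag_of (\<rho> x r, y) - frag_of (x, \<sigma> r y) | x r y.
         x \<in> carrier M \<and> r \<in> R \<and> y \<in> carrier N} \<subseteq> carrier F" (is "?S \<subseteq> _")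
proof -
  have *: "a - b \<in> carrier F" if "a \<in> carrier F" "b \<in> carrier F" for a b
    using that keys_diff[of a b] by auto
  have f: "frag_of (x, y) \<in> carrier F" if "x \<in> carrier M" "y \<in> carrier N" for x y
    using that by simp
  show ?thesis
    by (auto intro!: * f simp: right_closed left_closed simp del: carrier_free_Abelian_group_iff)
qed

lemma subgroup_relations: "subgroup relations F"
  unfolding tensor_relations_def
  by (rule group.generate_is_subgroup[OF group_free_Abelian_group generator_sub_carrier])

lemma normal_relations: "relations \<lhd> F"
  using comm_group.subgroup_imp_normal[OF abelian_free_Abelian_group subgroup_relations] .

lemma carrier_T: "carrier T = carrier (F Mod relations)"
  and zero_T: "\<zero>\<^bsub>T\<^esub> = \<one>\<^bsub>F Mod relations\<^esub>"
  and add_T: "add T = monoid.mult (F Mod relations)"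
  by (simp_all add: tensor_group_def Let_def)

lemma abelian_group_T: "abelian_group T"
proof -
  interpret Q: comm_group "F Mod relations"
    using comm_group.abelian_FactGroup[OF abelian_free_Abelian_group subgroup_relations] .
  show ?thesis
  proof (rule abelian_groupI)
    fix x assume "x \<in> carrier T"
    then show "\<exists>y\<in>carrier T. y \<oplus>\<^bsub>T\<^esub> x = \<zero>\<^bsub>T\<^esub>"
      unfolding carrier_T zero_T add_T
      by (intro bexI[of _ "inv\<^bsub>F Mod relations\<^esub> x"]) (simp_all del: mult_FactGroup one_FactGroup)
  qed (simp_all add: carrier_T zero_T add_T Q.m_ac
      del: mult_FactGroup one_FactGroup)
qed

lemma coset_hom: "(\<lambda>f. relations #>\<^bsub>F\<^esub> f) \<in> hom F (add_monoid T)"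
  using normal.r_coset_hom_Mod[OF normal_relations]
  by (simp add: hom_def carrier_T add_T)

lemma coset_eqI:
  assumes "f \<in> carrier F" "g \<in> carrier F" "f - g \<in> relations"
  shows "relations #>\<^bsub>F\<^esub> f = relations #>\<^bsub>F\<^esub> g"
proof -
  have "f \<in> relations #>\<^bsub>F\<^esub> g"
    using assms unfolding r_coset_def by (auto intro!: bexI[of _ "f - g"])
  then show ?thesis
    using group.repr_independence[OF group_free_Abelian_group _ assms(2) subgroup_relations]
    by blast
qed

lemma F_frag_of: "\<lbrakk>x \<in> carrier M; y \<in> carrier N\<rbrakk> \<Longrightarrow> frag_of (x, y) \<in> carrier F"
  by simp

lemma F_add: "\<lbrakk>f \<in> carrier F; g \<in> carrier F\<rbrakk> \<Longrightarrow> f + g \<in> carrier F"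
  using keys_add[of f g] by auto

lemma coset_add:
  "\<lbrakk>f \<in> carrier F; g \<in> carrier F\<rbrakk> \<Longrightarrow>
    relations #>\<^bsub>F\<^esub> (f + g) = (relations #>\<^bsub>F\<^esub> f) \<oplus>\<^bsub>T\<^esub> (relations #>\<^bsub>F\<^esub> g)"
  using coset_hom by (simp add: hom_def)

lemma t_closed: "\<lbrakk>x \<in> carrier M; y \<in> carrier N\<rbrakk> \<Longrightarrow> t x y \<in> carrier T"
  unfolding pure_tensor_def using coset_hom by (auto simp: hom_def)

lemma bihom_t: "bihom M N T t"
proof (rule bihomI)
  show "t x y \<in> carrier T" if "x \<in> carrier M" "y \<in> carrier N" for x y
    using that by (rule t_closed)
next
  fix x x' y assume *: "x \<in> carrier M" "x' \<in> carrier M" "y \<in> carrier N"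
  have "relations #>\<^bsub>F\<^esub> frag_of (x \<oplus>\<^bsub>M\<^esub> x', y) = relations #>\<^bsub>F\<^esub> (frag_of (x, y) + frag_of (x', y))"
  proof (rule coset_eqI)
    \<comment> \<open>The difference is a generator as soon as its two subtrahends stand in the
      right order.\<close>
    show "frag_of (x \<oplus>\<^bsub>M\<^esub> x', y) - (frag_of (x, y) + frag_of (x', y)) \<in> relations"
      unfolding tensor_relations_def diff_add_eq_diff_diff_swap
      by (rule generate.incl, subst diff_diff_eq, subst add.commute, subst diff_diff_eq[symmetric]) (use * in blast)
  qed (use * F_frag_of F_add in auto)
  then show "t (x \<oplus>\<^bsub>M\<^esub> x') y = t x y \<oplus>\<^bsub>T\<^esub> t x' y"
    using * by (simp add: pure_tensor_def coset_add)
next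
  fix x y y' assume *: "x \<in> carrier M" "y \<in> carrier N" "y' \<in> carrier N"
  have "relations #>\<^bsub>F\<^esub> frag_of (x, y \<oplus>\<^bsub>N\<^esub> y') = relations #>\<^bsub>F\<^esub> (frag_of (x, y) + frag_of (x, y'))"
  proof (rule coset_eqI)
    show "frag_of (x, y \<oplus>\<^bsub>N\<^esub> y') - (frag_of (x, y) + frag_of (x, y')) \<in> relations"
      unfolding tensor_relations_def diff_add_eq_diff_diff_swap
      by (rule generate.incl, subst diff_diff_eq, subst add.commute, subst diff_diff_eq[symmetric]) (use * in blast)
  qed (use * F_frag_of F_add in auto)
  then show "t x (y \<oplus>\<^bsub>N\<^esub> y') = t x y \<oplus>\<^bsub>T\<^esub> t x y'"
    using * by (simp add: pure_tensor_def coset_add)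
qed

lemmas t_add = bihomD(2,3)[OF bihom_t]

lemma t_balanced:
  assumes "x \<in> carrier M" "r \<in> R" "y \<in> carrier N"
  shows "t (\<rho> x r) y = t x (\<sigma> r y)"
  unfolding pure_tensor_def
proof (rule coset_eqI)
  show "frag_of (\<rho> x r, y) - frag_of (x, \<sigma> r y) \<in> relations"
    unfolding tensor_relations_def by (rule generate.incl) (use assms in blast)
qed (use assms right_closed left_closed in auto)

text \<open>Negative coefficients cost no case of their own: as \<open>t\<close> is additive on the
  left, the negative of a pure tensor is the pure tensor of the negated left factor. Every element
  is thus a sum of pure tensors.\<close>

lemma T_induct [consumes 1, case_names pure add]:
  assumes "u \<in> carrier T"
    and pure: "\<And>x y. \<lbrakk>x \<in> carrier M; y \<in> carrier N\<rbrakk> \<Longrightarrow> P (t x y)"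
    and add: "\<And>u v. \<lbrakk>u \<in> carrier T; v \<in> carrier T; P u; P v\<rbrakk> \<Longrightarrow> P (u \<oplus>\<^bsub>T\<^esub> v)"
  shows "P u"
proof -
  interpret T: abelian_group T by (rule abelian_group_T)
  interpret c: group_hom F "add_monoid T" "\<lambda>f. relations #>\<^bsub>F\<^esub> f"
    using coset_hom T.a_group by (simp add: group_hom_def group_hom_axioms_def)
  obtain f where f: "f \<in> carrier F" "u = relations #>\<^bsub>F\<^esub> f"
    using assms(1) by (auto simp: carrier_T carrier_FactGroup)
  have neg: "relations #>\<^bsub>F\<^esub> (- frag_of (x, y)) = t (\<ominus>\<^bsub>M\<^esub> x) y"
    if "x \<in> carrier M" "y \<in> carrier N" for x y
  proof -
    have "relations #>\<^bsub>F\<^esub> (- frag_of (x, y)) = \<ominus>\<^bsub>T\<^esub> t x y"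
      using c.hom_inv[of "frag_of (x, y)"] that by (simp add: a_inv_def pure_tensor_def)
    moreover have "(\<lambda>x. t x y) \<in> add_hom M T"
      using bihom_t that by (simp add: bihom_def)
    ultimately show ?thesis
      using add_hom_neg[OF _ M.abelian_group_axioms abelian_group_T] that by fastforce
  qed
  have zero: "relations #>\<^bsub>F\<^esub> 0 = t \<zero>\<^bsub>M\<^esub> \<zero>\<^bsub>N\<^esub>"
  proof -
    have "(\<lambda>x. t x \<zero>\<^bsub>N\<^esub>) \<in> add_hom M T"
      using bihom_t by (simp add: bihom_def)
    then have "t \<zero>\<^bsub>M\<^esub> \<zero>\<^bsub>N\<^esub> = \<zero>\<^bsub>T\<^esub>"
      using add_hom_zero[OF _ M.abelian_group_axioms abelian_group_T] by fastforce
    then show ?thesis using c.hom_one by simp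
  qed
  have pure': "P (relations #>\<^bsub>F\<^esub> frag_of (x, y))" if "x \<in> carrier M" "y \<in> carrier N" for x y
    using pure[OF that] by (simp add: pure_tensor_def)
  \<comment> \<open>\<open>frag_induction\<close> closes under differences, so the claim is carried
    for \<open>f\<close> and \<open>- f\<close> together; \<open>a - b\<close> then becomes the sum
    of \<open>a\<close> and \<open>- b\<close>.\<close>
  have "f \<in> carrier F \<and> P (relations #>\<^bsub>F\<^esub> f) \<and> P (relations #>\<^bsub>F\<^esub> (- f))"
    using f(1)[unfolded carrier_free_Abelian_group_iff]
  proof (induction f rule: frag_induction)
    case zero
    then show ?case using pure by (simp add: \<open>relations #>\<^bsub>F\<^esub> 0 = _\<close>)
  next
    case (one p)
    then show ?case using pure pure' neg by (cases p) auto
  next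
    case (diff a b)
    have *: "c - d \<in> carrier F \<and> P (relations #>\<^bsub>F\<^esub> (c - d))"
      if "c \<in> carrier F" "- d \<in> carrier F" "P (relations #>\<^bsub>F\<^esub> c)" "P (relations #>\<^bsub>F\<^esub> (- d))" for c d
      using that coset_add[of c "- d"] F_add[of c "- d"] add coset_hom
      by (auto simp: hom_def Pi_iff simp del: carrier_free_Abelian_group_iff)
    show ?case using *[of a b] *[of b a] diff by auto
  qed
  then show ?thesis using f by simp
qed

text \<open>Uniqueness half of the universal property, and the means by which additive maps on
  \<open>T\<close> are compared.\<close>

lemma hom_eqI:
  assumes "f \<in> add_hom T G" "g \<in> add_hom T G" "u \<in> carrier T"
    and "\<And>x y. \<lbrakk>x \<in> carrier M; y \<in> carrier N\<rbrakk> \<Longrightarrow> f (t x y) = g (t x y)"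
  shows "f u = g u"
  using assms(3)
  by (induction u rule: T_induct)
    (simp_all add: assms(4) add_hom_add[OF assms(1)] add_hom_add[OF assms(2)])

section \<open>Existence half of the universal property\<close>

context
  fixes G :: "('g, 'u) ring_scheme" and \<beta> :: "'m \<Rightarrow> 'n \<Rightarrow> 'g"
  assumes G: "abelian_group G" and bi: "bihom M N G \<beta>" and bal: "balanced R \<rho> \<sigma> M N \<beta>"
begin

text \<open>The sum is a homomorphism on \<open>F\<close> that kills every generator of the
  relations, hence is constant on cosets, and \<open>the_elem\<close> returns this constant.\<close>

lemma lift_coset:
  defines "\<phi> \<equiv> \<lambda>f. \<Oplus>\<^bsub>G\<^esub>p \<in> Poly_Mapping.keys f. [Poly_Mapping.lookup f p] \<cdot>\<^bsub>G\<^esub> \<beta> (fst p) (snd p)"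
  assumes f: "f \<in> carrier F"
  shows "tensor_lift G \<beta> (relations #>\<^bsub>F\<^esub> f) = \<phi> f"
proof -
  interpret G: abelian_group G by fact
  have hom: "\<phi> \<in> hom F (add_monoid G)"
    unfolding \<phi>_def by (rule G.frag_sum_hom) (auto simp: bihomD[OF bi])
  interpret h: group_hom F "add_monoid G" \<phi>
    using hom G.a_group by (simp add: group_hom_def group_hom_axioms_def)
  have of: "\<phi> (frag_of (x, y)) = \<beta> x y" if "x \<in> carrier M" "y \<in> carrier N" for x y
    unfolding \<phi>_def using G.frag_sum_frag_of[of "\<lambda>p. \<beta> (fst p) (snd p)" "(x, y)"] that bihomD(1)[OF bi]
    by simp
  have diff: "\<phi> (f - g) = \<phi> f \<ominus>\<^bsub>G\<^esub> \<phi> g" if "f \<in> carrier F" "g \<in> carrier F" for f g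
  proof -
    have "- g \<in> carrier F" "\<phi> (- g) = \<ominus>\<^bsub>G\<^esub> \<phi> g"
      using h.hom_inv[of g] that by (auto simp: a_inv_def)
    then show ?thesis
      using h.hom_mult[of f "- g"] that by (simp add: a_minus_def del: carrier_free_Abelian_group_iff)
  qed
  have F_diff: "f - g \<in> carrier F" if "f \<in> carrier F" "g \<in> carrier F" for f g
    using that keys_diff[of f g] by auto
  \<comment> \<open>This is the value of \<open>\<phi>\<close> on a biadditivity generator once
    \<open>\<beta>\<close> has been expanded.\<close>
  have zero: "a \<oplus>\<^bsub>G\<^esub> b \<ominus>\<^bsub>G\<^esub> a \<ominus>\<^bsub>G\<^esub> b = \<zero>\<^bsub>G\<^esub>" if "a \<in> carrier G" "b \<in> carrier G" for a b
    using that by (simp add: a_minus_def G.a_ac G.r_neg1)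
      (metis G.a_lcomm G.add.inv_closed G.add.m_closed G.r_neg G.r_neg2)
  have "relations \<subseteq> kernel F (add_monoid G) \<phi>"
    unfolding tensor_relations_def
  proof (rule group.generate_subgroup_incl[OF group_free_Abelian_group _ h.subgroup_kernel])
    show "{frag_of (x \<oplus>\<^bsub>M\<^esub> x', y) - frag_of (x, y) - frag_of (x', y) | x x' y.
         x \<in> carrier M \<and> x' \<in> carrier M \<and> y \<in> carrier N} \<union>
      {frag_of (x, y \<oplus>\<^bsub>N\<^esub> y') - frag_of (x, y) - frag_of (x, y') | x y y'.
         x \<in> carrier M \<and> y \<in> carrier N \<and> y' \<in> carrier N} \<union>
      {frag_of (\<rho> x r, y) - frag_of (x, \<sigma> r y) | x r y.
         x \<in> carrier M \<and> r \<in> R \<and> y \<in> carrier N} \<subseteq> kernel F (add_monoid G) \<phi>"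
      using bal
      by (auto simp: kernel_def diff of F_diff F_frag_of zero bihomD[OF bi] balanced_def
          right_closed left_closed G.r_neg a_minus_def[of G "\<beta> x y" for x y]
          simp del: carrier_free_Abelian_group_iff)
  qed
  then have rel: "\<phi> r = \<zero>\<^bsub>G\<^esub>" "r \<in> carrier F" if "r \<in> relations" for r
    using that by (auto simp: kernel_def)
  have const: "\<phi> g = \<phi> f" if g: "g \<in> relations #>\<^bsub>F\<^esub> f" for g
  proof -
    obtain r where "r \<in> relations" "g = r + f"
      using g unfolding r_coset_def by auto
    moreover have "\<phi> (r + f) = \<phi> r \<oplus>\<^bsub>G\<^esub> \<phi> f"
      using h.hom_mult[OF rel(2) f] \<open>r \<in> relations\<close> by simp
    moreover have "\<phi> f \<in> carrier G"
      using h.hom_closed[OF f] by simp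
    ultimately show ?thesis
      by (simp only: rel(1) G.l_zero)
  qed
  have "f \<in> relations #>\<^bsub>F\<^esub> f"
    using group.rcos_self[OF group_free_Abelian_group f subgroup_relations] .
  then have "relations #>\<^bsub>F\<^esub> f \<noteq> {}"
    by blast
  then show ?thesis
    unfolding tensor_lift_def \<phi>_def[symmetric] by (rule the_elem_image_unique[OF _ const])
qed

lemma lift_pure:
  assumes "x \<in> carrier M" "y \<in> carrier N"
  shows "tensor_lift G \<beta> (t x y) = \<beta> x y"
proof -
  interpret G: abelian_group G by (rule G)
  show ?thesis
    using lift_coset[OF F_frag_of[OF assms]] G.frag_sum_frag_of[of "\<lambda>p. \<beta> (fst p) (snd p)" "(x, y)"]
      bihomD(1)[OF bi] assms
    by (simp add: pure_tensor_def)
qed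

lemma lift_hom: "tensor_lift G \<beta> \<in> add_hom T G"
proof (rule add_homI)
  interpret G: abelian_group G by (rule G)
  have hom: "(\<lambda>f. \<Oplus>\<^bsub>G\<^esub>p \<in> Poly_Mapping.keys f. [Poly_Mapping.lookup f p] \<cdot>\<^bsub>G\<^esub> \<beta> (fst p) (snd p))
      \<in> hom F (add_monoid G)"
    by (rule G.frag_sum_hom) (auto simp: bihomD[OF bi])
  have rep: "\<exists>f \<in> carrier F. u = relations #>\<^bsub>F\<^esub> f" if "u \<in> carrier T" for u
    using that by (auto simp: carrier_T carrier_FactGroup simp del: carrier_free_Abelian_group_iff)
  show "tensor_lift G \<beta> u \<in> carrier G" if u: "u \<in> carrier T" for u
  proof -
    obtain f where "f \<in> carrier F" "u = relations #>\<^bsub>F\<^esub> f" using rep[OF u] by blast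
    then show ?thesis using lift_coset hom_in_carrier[OF hom] by simp
  qed
  show "tensor_lift G \<beta> (u \<oplus>\<^bsub>T\<^esub> v) = tensor_lift G \<beta> u \<oplus>\<^bsub>G\<^esub> tensor_lift G \<beta> v"
    if u: "u \<in> carrier T" and v: "v \<in> carrier T" for u v
  proof -
    obtain f where f: "f \<in> carrier F" "u = relations #>\<^bsub>F\<^esub> f" using rep[OF u] by blast
    obtain g where g: "g \<in> carrier F" "v = relations #>\<^bsub>F\<^esub> g" using rep[OF v] by blast
    have "u \<oplus>\<^bsub>T\<^esub> v = relations #>\<^bsub>F\<^esub> (f + g)"
      using f g coset_add by simp
    then show ?thesis
      using lift_coset[OF f(1)] lift_coset[OF g(1)] lift_coset[OF F_add[OF f(1) g(1)]]
        hom_mult[OF hom f(1) g(1)] f(2) g(2) by simp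
  qed
qed

end

end

lemma hom_sum:
  assumes "abelian_group G" "f \<in> add_hom M G" "g \<in> add_hom M G"
  shows "(\<lambda>x. f x \<oplus>\<^bsub>G\<^esub> g x) \<in> add_hom M G"
proof -
  interpret G: abelian_group G by fact
  show ?thesis
    using assms(2,3) by (auto intro!: add_homI simp: add_hom_closed add_hom_add G.a_ac)
qed

text \<open>Products and two-sided actions on tensor products are nested lifts. The inner lift, read
  as a function of the outer pair, is itself biadditive and balanced, because additive maps on the
  inner tensor product may be compared on pure tensors.\<close>

lemma tensor_lift2:
  fixes \<gamma> :: "'m \<Rightarrow> 'n \<Rightarrow> 'm' \<Rightarrow> 'n' \<Rightarrow> 'g"
  assumes tp: "tensor_product R \<rho> \<sigma> M N" and tp': "tensor_product R' \<rho>' \<sigma>' M' N'"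
    and G: "abelian_group G"
    and inner: "\<And>x y. \<lbrakk>x \<in> carrier M; y \<in> carrier N\<rbrakk> \<Longrightarrow>
      bihom M' N' G (\<gamma> x y) \<and> balanced R' \<rho>' \<sigma>' M' N' (\<gamma> x y)"
    and outer: "\<And>x y. \<lbrakk>x \<in> carrier M'; y \<in> carrier N'\<rbrakk> \<Longrightarrow>
      bihom M N G (\<lambda>x' y'. \<gamma> x' y' x y) \<and> balanced R \<rho> \<sigma> M N (\<lambda>x' y'. \<gamma> x' y' x y)"
  defines "H \<equiv> tensor_relations R \<rho> \<sigma> M N" and "H' \<equiv> tensor_relations R' \<rho>' \<sigma>' M' N'"
  defines "\<Phi> \<equiv> \<lambda>u v. tensor_lift G (\<lambda>x y. tensor_lift G (\<gamma> x y) v) u"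
  shows "bihom (tensor_group M N H) (tensor_group M' N' H') G \<Phi>"
    and "\<And>x y x' y'. \<lbrakk>x \<in> carrier M; y \<in> carrier N; x' \<in> carrier M'; y' \<in> carrier N'\<rbrakk> \<Longrightarrow>
      \<Phi> (pure_tensor M N H x y) (pure_tensor M' N' H' x' y') = \<gamma> x y x' y'"
proof -
  interpret X: tensor_product R \<rho> \<sigma> M N by fact
  interpret Y: tensor_product R' \<rho>' \<sigma>' M' N' by fact
  interpret G: abelian_group G by fact
  define I where "I \<equiv> \<lambda>x y. tensor_lift G (\<gamma> x y)"
  have I_hom: "I x y \<in> add_hom Y.T G" if "x \<in> carrier M" "y \<in> carrier N" for x y
    unfolding I_def using Y.lift_hom[OF G] inner[OF that] by blast
  have I_pure: "I x y (Y.t x' y') = \<gamma> x y x' y'"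
    if "x \<in> carrier M" "y \<in> carrier N" "x' \<in> carrier M'" "y' \<in> carrier N'" for x y x' y'
    unfolding I_def using Y.lift_pure[OF G] inner[OF that(1,2)] that(3,4) by blast
  have I_bihom: "bihom M N G (\<lambda>x y. I x y v)" if v: "v \<in> carrier Y.T" for v
  proof (rule bihomI)
    show "I x y v \<in> carrier G" if "x \<in> carrier M" "y \<in> carrier N" for x y
      using add_hom_closed[OF I_hom[OF that] v] .
    show "I (x \<oplus>\<^bsub>M\<^esub> x') y v = I x y v \<oplus>\<^bsub>G\<^esub> I x' y v"
      if *: "x \<in> carrier M" "x' \<in> carrier M" "y \<in> carrier N" for x x' y
    proof (rule Y.hom_eqI[OF _ hom_sum[OF G] v])
      fix a b assume "a \<in> carrier M'" "b \<in> carrier N'"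
      then show "I (x \<oplus>\<^bsub>M\<^esub> x') y (Y.t a b) = I x y (Y.t a b) \<oplus>\<^bsub>G\<^esub> I x' y (Y.t a b)"
        using * bihomD(2)[OF outer[THEN conjunct1], of a b x x' y] by (simp add: I_pure)
    qed (rule I_hom; use * in simp)+
    show "I x (y \<oplus>\<^bsub>N\<^esub> y') v = I x y v \<oplus>\<^bsub>G\<^esub> I x y' v"
      if *: "x \<in> carrier M" "y \<in> carrier N" "y' \<in> carrier N" for x y y'
    proof (rule Y.hom_eqI[OF _ hom_sum[OF G] v])
      fix a b assume "a \<in> carrier M'" "b \<in> carrier N'"
      then show "I x (y \<oplus>\<^bsub>N\<^esub> y') (Y.t a b) = I x y (Y.t a b) \<oplus>\<^bsub>G\<^esub> I x y' (Y.t a b)"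
        using * bihomD(3)[OF outer[THEN conjunct1], of a b x y y'] by (simp add: I_pure)
    qed (rule I_hom; use * in simp)+
  qed
  have I_bal: "balanced R \<rho> \<sigma> M N (\<lambda>x y. I x y v)" if v: "v \<in> carrier Y.T" for v
    unfolding balanced_def
  proof (intro ballI)
    fix x r y assume *: "x \<in> carrier M" "r \<in> R" "y \<in> carrier N"
    show "I (\<rho> x r) y v = I x (\<sigma> r y) v"
    proof (rule Y.hom_eqI[OF _ _ v])
      fix a b assume "a \<in> carrier M'" "b \<in> carrier N'"
      then show "I (\<rho> x r) y (Y.t a b) = I x (\<sigma> r y) (Y.t a b)"
        using * outer[THEN conjunct2, of a b]
        by (simp add: I_pure X.right_closed X.left_closed balanced_def)
    qed (rule I_hom; use * in \<open>simp add: X.right_closed X.left_closed\<close>)+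
  qed
  have \<Phi>_hom: "(\<lambda>u. \<Phi> u v) \<in> add_hom X.T G" if "v \<in> carrier Y.T" for v
    using X.lift_hom[OF G I_bihom[OF that] I_bal[OF that]] unfolding \<Phi>_def I_def .
  have \<Phi>_pure: "\<Phi> (X.t x y) v = I x y v"
    if "x \<in> carrier M" "y \<in> carrier N" "v \<in> carrier Y.T" for x y v
    using X.lift_pure[OF G I_bihom I_bal, of v x y] that unfolding \<Phi>_def I_def by blast
  show "bihom (tensor_group M N H) (tensor_group M' N' H') G \<Phi>"
    unfolding H_def H'_def
  proof (rule bihomI)
    show "\<Phi> u v \<in> carrier G" if "u \<in> carrier X.T" "v \<in> carrier Y.T" for u v
      using add_hom_closed[OF \<Phi>_hom] that by blast
    show "\<Phi> (u \<oplus>\<^bsub>X.T\<^esub> u') v = \<Phi> u v \<oplus>\<^bsub>G\<^esub> \<Phi> u' v"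
      if "u \<in> carrier X.T" "u' \<in> carrier X.T" "v \<in> carrier Y.T" for u u' v
      using add_hom_add[OF \<Phi>_hom] that by blast
    \<comment> \<open>Additivity in \<open>v\<close> is not visible through the outer lift, but both
      sides are additive in \<open>u\<close>, and on a pure \<open>u\<close> the map is the inner
      lift \<open>I\<close>.\<close>
    show "\<Phi> u (v \<oplus>\<^bsub>Y.T\<^esub> v') = \<Phi> u v \<oplus>\<^bsub>G\<^esub> \<Phi> u v'"
      if *: "u \<in> carrier X.T" "v \<in> carrier Y.T" "v' \<in> carrier Y.T" for u v v'
    proof (rule X.hom_eqI[OF _ hom_sum[OF G] *(1)])
      fix x y assume "x \<in> carrier M" "y \<in> carrier N"
      then show "\<Phi> (X.t x y) (v \<oplus>\<^bsub>Y.T\<^esub> v') = \<Phi> (X.t x y) v \<oplus>\<^bsub>G\<^esub> \<Phi> (X.t x y) v'"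
        using * Y.abelian_group_T by (simp add: \<Phi>_pure add_hom_add[OF I_hom] abelian_groupE(1))
    qed (rule \<Phi>_hom; use * Y.abelian_group_T in \<open>simp add: abelian_groupE(1)\<close>)+
  qed
  show "\<Phi> (pure_tensor M N H x y) (pure_tensor M' N' H' x' y') = \<gamma> x y x' y'"
    if "x \<in> carrier M" "y \<in> carrier N" "x' \<in> carrier M'" "y' \<in> carrier N'" for x y x' y'
    using that Y.t_closed unfolding H_def H'_def by (simp add: \<Phi>_pure I_pure)
qed


section \<open>Tensor products of modules\<close>

text \<open>The last assumption lets scaling of the left factor commute with the right action, so
  that it descends to the quotient.\<close>

locale module_tensor_product =
  tensor_product R \<rho> \<sigma> M N + M: module k M + N: module k N
  for k :: "('k, 'q) ring_scheme"
    and R :: "'r set" and \<rho> :: "'m \<Rightarrow> 'r \<Rightarrow> 'm" and \<sigma> :: "'r \<Rightarrow> 'n \<Rightarrow> 'n"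
    and M :: "('k, 'm, 's) module_scheme" and N :: "('k, 'n, 't) module_scheme" +
  assumes smult_right:
    "\<lbrakk>c \<in> carrier k; x \<in> carrier M; r \<in> R\<rbrakk> \<Longrightarrow> c \<odot>\<^bsub>M\<^esub> \<rho> x r = \<rho> (c \<odot>\<^bsub>M\<^esub> x) r"
begin

lemma smult_lift:
  assumes "c \<in> carrier k"
  shows "tensor_lift T (\<lambda>x y. t (c \<odot>\<^bsub>M\<^esub> x) y) \<in> add_hom T T"
    and "\<And>x y. \<lbrakk>x \<in> carrier M; y \<in> carrier N\<rbrakk> \<Longrightarrow>
      tensor_lift T (\<lambda>x y. t (c \<odot>\<^bsub>M\<^esub> x) y) (t x y) = t (c \<odot>\<^bsub>M\<^esub> x) y"
proof -
  have *: "bihom M N T (\<lambda>x y. t (c \<odot>\<^bsub>M\<^esub> x) y)"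
    using assms by (auto intro!: bihomI simp: t_closed t_add M.smult_r_distr)
  have **: "balanced R \<rho> \<sigma> M N (\<lambda>x y. t (c \<odot>\<^bsub>M\<^esub> x) y)"
    using assms by (auto simp: balanced_def smult_right t_balanced)
  show "tensor_lift T (\<lambda>x y. t (c \<odot>\<^bsub>M\<^esub> x) y) \<in> add_hom T T"
    by (rule lift_hom[OF abelian_group_T * **])
  show "\<And>x y. \<lbrakk>x \<in> carrier M; y \<in> carrier N\<rbrakk> \<Longrightarrow>
      tensor_lift T (\<lambda>x y. t (c \<odot>\<^bsub>M\<^esub> x) y) (t x y) = t (c \<odot>\<^bsub>M\<^esub> x) y"
    by (rule lift_pure[OF abelian_group_T * **])
qed

end

text \<open>\<open>alg_tensor\<close>, \<open>bimod_tensor\<close> and \<open>bimod_compose\<close>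
  are different records over a tensor group with the same kind of scalar action. \<open>V\<close>
  stands for any of them, so the module laws are proved once.\<close>

locale tensor_module = module_tensor_product k R \<rho> \<sigma> M N
  for k :: "('k, 'q) ring_scheme"
    and R :: "'r set" and \<rho> :: "'m \<Rightarrow> 'r \<Rightarrow> 'm" and \<sigma> :: "'r \<Rightarrow> 'n \<Rightarrow> 'n"
    and M :: "('k, 'm, 's) module_scheme" and N :: "('k, 'n, 't) module_scheme" +
  fixes V :: "('k, ('m \<times> 'n \<Rightarrow>\<^sub>0 int) set, 'v) module_scheme"
  assumes V_eq: "carrier V = carrier T" "add V = add T" "\<zero>\<^bsub>V\<^esub> = \<zero>\<^bsub>T\<^esub>"
    "module.smult V = (\<lambda>c. tensor_lift T (\<lambda>x y. t (c \<odot>\<^bsub>M\<^esub> x) y))"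
begin

lemma abelian_group_V: "abelian_group V"
  by (rule abelian_group_cong[OF abelian_group_T]) (simp_all add: V_eq)

lemma smult_pure:
  "\<lbrakk>c \<in> carrier k; x \<in> carrier M; y \<in> carrier N\<rbrakk> \<Longrightarrow> c \<odot>\<^bsub>V\<^esub> t x y = t (c \<odot>\<^bsub>M\<^esub> x) y"
  by (simp add: V_eq smult_lift)

lemma smult_add:
  "\<lbrakk>c \<in> carrier k; u \<in> carrier T; v \<in> carrier T\<rbrakk> \<Longrightarrow> c \<odot>\<^bsub>V\<^esub> (u \<oplus>\<^bsub>T\<^esub> v) = (c \<odot>\<^bsub>V\<^esub> u) \<oplus>\<^bsub>T\<^esub> (c \<odot>\<^bsub>V\<^esub> v)"
  using add_hom_add[OF smult_lift(1)] by (simp add: V_eq)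

lemma smult_T_closed: "\<lbrakk>c \<in> carrier k; u \<in> carrier T\<rbrakk> \<Longrightarrow> c \<odot>\<^bsub>V\<^esub> u \<in> carrier T"
  using add_hom_closed[OF smult_lift(1)] by (simp add: V_eq)

lemma module_V: "module k V"
proof -
  interpret T: abelian_group T by (rule abelian_group_T)
  show ?thesis
  proof (rule moduleI)
    show "cring k" by (rule M.R.is_cring)
    show "abelian_group V" by (rule abelian_group_V)
    show "c \<odot>\<^bsub>V\<^esub> u \<in> carrier V" if "c \<in> carrier k" "u \<in> carrier V" for c u
      using that smult_T_closed by (simp add: V_eq(1))
    show "c \<odot>\<^bsub>V\<^esub> (u \<oplus>\<^bsub>V\<^esub> v) = (c \<odot>\<^bsub>V\<^esub> u) \<oplus>\<^bsub>V\<^esub> (c \<odot>\<^bsub>V\<^esub> v)"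
      if "c \<in> carrier k" "u \<in> carrier V" "v \<in> carrier V" for c u v
      using that smult_add by (simp add: V_eq(1,2))
    show "(c \<oplus>\<^bsub>k\<^esub> d) \<odot>\<^bsub>V\<^esub> u = (c \<odot>\<^bsub>V\<^esub> u) \<oplus>\<^bsub>V\<^esub> (d \<odot>\<^bsub>V\<^esub> u)"
      if c: "c \<in> carrier k" "d \<in> carrier k" and u: "u \<in> carrier V" for c d u
      using u unfolding V_eq(1,2)
    proof (induction u rule: T_induct)
      case (pure x y)
      then show ?case using c by (simp add: smult_pure M.smult_l_distr t_add)
    next
      case (add u v)
      then show ?case using c by (simp add: smult_add smult_T_closed T.a_ac)
    qed
    show "(c \<otimes>\<^bsub>k\<^esub> d) \<odot>\<^bsub>V\<^esub> u = c \<odot>\<^bsub>V\<^esub> (d \<odot>\<^bsub>V\<^esub> u)"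
      if c: "c \<in> carrier k" "d \<in> carrier k" and u: "u \<in> carrier V" for c d u
      using u unfolding V_eq(1,2)
    proof (induction u rule: T_induct)
      case (pure x y)
      then show ?case using c by (simp add: smult_pure M.smult_assoc1)
    next
      case (add u v)
      then show ?case using c by (simp add: smult_add smult_T_closed)
    qed
    show "\<one>\<^bsub>k\<^esub> \<odot>\<^bsub>V\<^esub> u = u" if u: "u \<in> carrier V" for u
      using u unfolding V_eq(1)
    proof (induction u rule: T_induct)
      case (pure x y)
      then show ?case by (simp add: smult_pure)
    next
      case (add u v)
      then show ?case by (simp add: smult_add smult_T_closed)
    qed
  qed
qed

end

locale scalar_tensor = M: module k M + N: module k N
  for k :: "('k, 'q) ring_scheme" and M :: "('k, 'm, 's) module_scheme"
    and N :: "('k, 'n, 't) module_scheme"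

sublocale scalar_tensor \<subseteq> module_tensor_product k "carrier k"
    "\<lambda>x c. c \<odot>\<^bsub>M\<^esub> x" "\<lambda>c y. c \<odot>\<^bsub>N\<^esub> y" M N
proof -
  show "module_tensor_product k (carrier k) (\<lambda>x c. c \<odot>\<^bsub>M\<^esub> x) (\<lambda>c y. c \<odot>\<^bsub>N\<^esub> y) M N"
    by unfold_locales (auto simp: M.smult_assoc1[symmetric] M.R.m_comm)
qed


section \<open>Tensor products of algebras\<close>

locale algebra_tensor = A: assoc_algebra k A + B: assoc_algebra k B
  for k :: "'k ring" and A :: "('k, 'a) module" and B :: "('k, 'b) module"

sublocale algebra_tensor \<subseteq> scalar_tensor k A B ..

context algebra_tensor
begin

abbreviation AB where "AB \<equiv> alg_tensor k A B"

lemma AB_simps [simp]: "carrier AB = carrier T" "add AB = add T" "\<zero>\<^bsub>AB\<^esub> = \<zero>\<^bsub>T\<^esub>"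
  and AB_smult: "module.smult AB = (\<lambda>c. tensor_lift T (\<lambda>a b. t (c \<odot>\<^bsub>A\<^esub> a) b))"
  and AB_one: "\<one>\<^bsub>AB\<^esub> = t \<one>\<^bsub>A\<^esub> \<one>\<^bsub>B\<^esub>"
  and AB_mult: "u \<otimes>\<^bsub>AB\<^esub> v = tensor_lift T (\<lambda>a b. tensor_lift T (\<lambda>a' b'. t (a \<otimes>\<^bsub>A\<^esub> a') (b \<otimes>\<^bsub>B\<^esub> b')) v) u"
  by (simp_all add: alg_tensor_def Let_def alg_pure_def scalar_relations_def)

sublocale AB: tensor_module k "carrier k" "\<lambda>x c. c \<odot>\<^bsub>A\<^esub> x" "\<lambda>c y. c \<odot>\<^bsub>B\<^esub> y" A B AB
proof -
  show "tensor_module k (carrier k) (\<lambda>x c. c \<odot>\<^bsub>A\<^esub> x) (\<lambda>c y. c \<odot>\<^bsub>B\<^esub> y) A B AB"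
    by unfold_locales (simp_all add: AB_smult)
qed

lemmas AB_smult_pure = AB.smult_pure

lemma alg_pure_eq: "alg_pure k A B = t"
  by (simp add: alg_pure_def scalar_relations_def)

lemma AB_mult_bihom: "bihom T T T (\<lambda>u v. u \<otimes>\<^bsub>AB\<^esub> v)"
  and AB_mult_pure: "\<lbrakk>a \<in> carrier A; b \<in> carrier B; a' \<in> carrier A; b' \<in> carrier B\<rbrakk> \<Longrightarrow>
    t a b \<otimes>\<^bsub>AB\<^esub> t a' b' = t (a \<otimes>\<^bsub>A\<^esub> a') (b \<otimes>\<^bsub>B\<^esub> b')"
proof -
  have 1: "bihom A B T (\<lambda>a' b'. t (a \<otimes>\<^bsub>A\<^esub> a') (b \<otimes>\<^bsub>B\<^esub> b')) \<and>
      balanced (carrier k) (\<lambda>x c. c \<odot>\<^bsub>A\<^esub> x) (\<lambda>c y. c \<odot>\<^bsub>B\<^esub> y) A B (\<lambda>a' b'. t (a \<otimes>\<^bsub>A\<^esub> a') (b \<otimes>\<^bsub>B\<^esub> b'))"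
    if "a \<in> carrier A" "b \<in> carrier B" for a b
    using that by (auto intro!: bihomI simp: balanced_def t_closed t_add A.A.r_distr B.A.r_distr
        A.smult_mult_right B.smult_mult_right t_balanced)
  have 2: "bihom A B T (\<lambda>a' b'. t (a' \<otimes>\<^bsub>A\<^esub> a) (b' \<otimes>\<^bsub>B\<^esub> b)) \<and>
      balanced (carrier k) (\<lambda>x c. c \<odot>\<^bsub>A\<^esub> x) (\<lambda>c y. c \<odot>\<^bsub>B\<^esub> y) A B (\<lambda>a' b'. t (a' \<otimes>\<^bsub>A\<^esub> a) (b' \<otimes>\<^bsub>B\<^esub> b))"
    if "a \<in> carrier A" "b \<in> carrier B" for a b
    using that by (auto intro!: bihomI simp: balanced_def t_closed t_add A.A.l_distr B.A.l_distr
        A.smult_mult_left B.smult_mult_left t_balanced)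
  note * = tensor_lift2[OF tensor_product_axioms tensor_product_axioms abelian_group_T, OF 1 2]
  show "bihom T T T (\<lambda>u v. u \<otimes>\<^bsub>AB\<^esub> v)"
    unfolding AB_mult using *(1) .
  show "\<lbrakk>a \<in> carrier A; b \<in> carrier B; a' \<in> carrier A; b' \<in> carrier B\<rbrakk> \<Longrightarrow>
    t a b \<otimes>\<^bsub>AB\<^esub> t a' b' = t (a \<otimes>\<^bsub>A\<^esub> a') (b \<otimes>\<^bsub>B\<^esub> b')"
    unfolding AB_mult using *(2) .
qed

lemmas AB_mult_simps = bihomD[OF AB_mult_bihom]

sublocale T: abelian_group T by (rule abelian_group_T)

sublocale AB: module k AB by (rule AB.module_V)

lemmas AB_smult_simps = AB.smult_closed[simplified] AB.smult_r_distr[simplified]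

text \<open>Each law is additive in every argument, so nested inductions reduce it to pure tensors,
  where it holds factor by factor.\<close>

lemma alg_tensor_assoc: "assoc_algebra k AB"
proof -
  have one: "\<one>\<^bsub>AB\<^esub> \<in> carrier T"
    by (simp add: AB_one t_closed)
  have assoc: "(u \<otimes>\<^bsub>AB\<^esub> v) \<otimes>\<^bsub>AB\<^esub> w = u \<otimes>\<^bsub>AB\<^esub> (v \<otimes>\<^bsub>AB\<^esub> w)"
    if u: "u \<in> carrier T" and v: "v \<in> carrier T" and w: "w \<in> carrier T" for u v w
    using u
  proof (induction u rule: T_induct)
    case (pure a b)
    note ab = pure
    show ?case using v
    proof (induction v rule: T_induct)
      case (pure a' b')
      note ab' = pure
      show ?case using w
      proof (induction w rule: T_induct)
        case (pure a'' b'')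
        then show ?case using ab ab' by (simp add: AB_mult_pure A.A.m_assoc B.A.m_assoc)
      qed (use ab ab' in \<open>simp add: AB_mult_simps t_closed\<close>)
    qed (use ab w in \<open>simp add: AB_mult_simps t_closed\<close>)
  qed (use v w in \<open>simp add: AB_mult_simps\<close>)
  have l_one: "\<one>\<^bsub>AB\<^esub> \<otimes>\<^bsub>AB\<^esub> u = u" if "u \<in> carrier T" for u
    using that
  proof (induction u rule: T_induct)
    case (pure a b)
    then show ?case by (simp add: AB_mult_pure AB_one)
  qed (simp add: AB_mult_simps one)
  have r_one: "u \<otimes>\<^bsub>AB\<^esub> \<one>\<^bsub>AB\<^esub> = u" if "u \<in> carrier T" for u
    using that
  proof (induction u rule: T_induct)
    case (pure a b)
    then show ?case by (simp add: AB_mult_pure AB_one)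
  qed (simp add: AB_mult_simps one)
  have ring: "ring AB"
    by (rule ringI)
      (use AB.abelian_group_axioms one assoc l_one r_one in
        \<open>auto simp: AB_mult_simps intro!: monoidI\<close>)
  have smult_left: "(c \<odot>\<^bsub>AB\<^esub> u) \<otimes>\<^bsub>AB\<^esub> v = c \<odot>\<^bsub>AB\<^esub> (u \<otimes>\<^bsub>AB\<^esub> v)"
    if c: "c \<in> carrier k" and u: "u \<in> carrier T" and v: "v \<in> carrier T" for c u v
    using u
  proof (induction u rule: T_induct)
    case (pure a b)
    note ab = pure
    show ?case using v
    proof (induction v rule: T_induct)
      case (pure a' b')
      then show ?case using c ab by (simp add: AB_mult_pure AB_smult_pure A.smult_mult_left)
    qed (use c ab in \<open>simp add: AB_mult_simps AB_smult_simps t_closed\<close>)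
  qed (use c v in \<open>simp add: AB_mult_simps AB_smult_simps\<close>)
  have smult_right: "u \<otimes>\<^bsub>AB\<^esub> (c \<odot>\<^bsub>AB\<^esub> v) = c \<odot>\<^bsub>AB\<^esub> (u \<otimes>\<^bsub>AB\<^esub> v)"
    if c: "c \<in> carrier k" and u: "u \<in> carrier T" and v: "v \<in> carrier T" for c u v
    using u
  proof (induction u rule: T_induct)
    case (pure a b)
    note ab = pure
    show ?case using v
    proof (induction v rule: T_induct)
      case (pure a' b')
      then show ?case using c ab by (simp add: AB_mult_pure AB_smult_pure A.smult_mult_right)
    qed (use c ab in \<open>simp add: AB_mult_simps AB_smult_simps t_closed\<close>)
  qed (use c v in \<open>simp add: AB_mult_simps AB_smult_simps\<close>)
  show ?thesis
    by (intro assoc_algebra.intro assoc_algebra_axioms.intro AB.module_axioms ring)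
      (use smult_left smult_right in auto)
qed

end

lemma restrict_left_simps [simp]:
  "carrier (restrict_left \<phi> M) = carrier M" "add (restrict_left \<phi> M) = add M"
  "\<zero>\<^bsub>restrict_left \<phi> M\<^esub> = \<zero>\<^bsub>M\<^esub>" "module.smult (restrict_left \<phi> M) = module.smult M"
  "lact (restrict_left \<phi> M) = (\<lambda>b x. \<phi> b \<triangleright>\<^bsub>M\<^esub> x)" "ract (restrict_left \<phi> M) = ract M"
  by (simp_all add: restrict_left_def)

lemma regular_bimodule_simps [simp]:
  "carrier (regular_bimodule A) = carrier A" "add (regular_bimodule A) = add A"
  "\<zero>\<^bsub>regular_bimodule A\<^esub> = \<zero>\<^bsub>A\<^esub>"
  "lact (regular_bimodule A) = monoid.mult A" "ract (regular_bimodule A) = monoid.mult A"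
  and regular_bimodule_smult: "module.smult (regular_bimodule A) = module.smult A"
  by (simp_all add: regular_bimodule_def)

lemma base_algebra_simps [simp]:
  "carrier (base_algebra k) = carrier k" "add (base_algebra k) = add k"
  "\<zero>\<^bsub>base_algebra k\<^esub> = \<zero>\<^bsub>k\<^esub>" "\<one>\<^bsub>base_algebra k\<^esub> = \<one>\<^bsub>k\<^esub>"
  "monoid.mult (base_algebra k) = monoid.mult k"
  and base_algebra_smult: "module.smult (base_algebra k) = monoid.mult k"
  by (simp_all add: base_algebra_def)

lemma module_cong:
  assumes "module k M" "carrier N = carrier M" "add N = add M" "\<zero>\<^bsub>N\<^esub> = \<zero>\<^bsub>M\<^esub>"
    "module.smult N = module.smult M"
  shows "module k N"
proof -
  interpret M: module k M by fact
  show ?thesis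
    by (rule moduleI) (use assms abelian_group_cong[OF M.abelian_group_axioms] in
      \<open>simp_all add: M.R.is_cring M.smult_l_distr M.smult_r_distr M.smult_assoc1\<close>)
qed

lemma regular_bimodule_bimodule:
  assumes "assoc_algebra k A"
  shows "bimodule k A A (regular_bimodule A)"
proof -
  interpret A: assoc_algebra k A by fact
  interpret M: module k "regular_bimodule A"
    by (rule module_cong[OF A.module_axioms]) (simp_all add: regular_bimodule_smult)
  show ?thesis
    by unfold_locales
      (simp_all add: regular_bimodule_smult A.A.l_distr A.A.r_distr A.A.m_assoc A.smult_mult_left A.smult_mult_right)
qed

lemma base_algebra_assoc_algebra:
  assumes "cring k"
  shows "assoc_algebra k (base_algebra k)"
proof -
  interpret k: cring k by fact
  have "abelian_group (base_algebra k)"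
    by (rule abelian_group_cong[OF k.abelian_group_axioms]) simp_all
  moreover from this have "module k (base_algebra k)"
    by (intro moduleI) (simp_all add: base_algebra_smult k.is_cring k.l_distr k.r_distr k.m_assoc)
  moreover have "ring (base_algebra k)"
    using calculation(1)
    by (intro ringI monoidI) (simp_all add: k.l_distr k.r_distr k.m_assoc)
  ultimately show ?thesis
    by (intro assoc_algebra.intro assoc_algebra_axioms.intro) (simp_all add: base_algebra_smult k.m_ac)
qed


section \<open>Tensor products and composition of bimodules\<close>

locale bimodule_tensor = M: bimodule k B A M + N: bimodule k B' A' N
  for k :: "'k ring" and B :: "('k, 'b) module" and A :: "('k, 'a) module"
    and M :: "('k, 'b, 'm, 'a) bimod" and B' :: "('k, 'b') module" and A' :: "('k, 'a') module"
    and N :: "('k, 'b', 'n, 'a') bimod"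

sublocale bimodule_tensor \<subseteq> BB: algebra_tensor k B B' ..
sublocale bimodule_tensor \<subseteq> AA: algebra_tensor k A A' ..
sublocale bimodule_tensor \<subseteq> scalar_tensor k M N ..

context bimodule_tensor
begin

abbreviation MN where "MN \<equiv> bimod_tensor k M N"

lemma MN_simps [simp]: "carrier MN = carrier T" "add MN = add T" "\<zero>\<^bsub>MN\<^esub> = \<zero>\<^bsub>T\<^esub>"
  and MN_smult: "module.smult MN = (\<lambda>c. tensor_lift T (\<lambda>x y. t (c \<odot>\<^bsub>M\<^esub> x) y))"
  and MN_lact: "u \<triangleright>\<^bsub>MN\<^esub> w = tensor_lift T (\<lambda>b b'. tensor_lift T (\<lambda>x y. t (b \<triangleright>\<^bsub>M\<^esub> x) (b' \<triangleright>\<^bsub>N\<^esub> y)) w) u"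
  and MN_ract: "w \<triangleleft>\<^bsub>MN\<^esub> v = tensor_lift T (\<lambda>a a'. tensor_lift T (\<lambda>x y. t (x \<triangleleft>\<^bsub>M\<^esub> a) (y \<triangleleft>\<^bsub>N\<^esub> a')) w) v"
  by (simp_all add: bimod_tensor_def Let_def scalar_relations_def)

end

sublocale bimodule_tensor \<subseteq>
  MN: tensor_module k "carrier k" "\<lambda>x c. c \<odot>\<^bsub>M\<^esub> x" "\<lambda>c y. c \<odot>\<^bsub>N\<^esub> y" M N MN
proof -
  show "tensor_module k (carrier k) (\<lambda>x c. c \<odot>\<^bsub>M\<^esub> x) (\<lambda>c y. c \<odot>\<^bsub>N\<^esub> y) M N MN"
    by unfold_locales (simp_all add: MN_smult)
qed

context bimodule_tensor
begin

lemma MN_lact_bihom: "bihom BB.T T T (\<lambda>u w. u \<triangleright>\<^bsub>MN\<^esub> w)"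
  and MN_lact_pure: "\<lbrakk>b \<in> carrier B; b' \<in> carrier B'; x \<in> carrier M; y \<in> carrier N\<rbrakk> \<Longrightarrow>
    BB.t b b' \<triangleright>\<^bsub>MN\<^esub> t x y = t (b \<triangleright>\<^bsub>M\<^esub> x) (b' \<triangleright>\<^bsub>N\<^esub> y)"
proof -
  have 1: "bihom M N T (\<lambda>x y. t (b \<triangleright>\<^bsub>M\<^esub> x) (b' \<triangleright>\<^bsub>N\<^esub> y)) \<and>
      balanced (carrier k) (\<lambda>x c. c \<odot>\<^bsub>M\<^esub> x) (\<lambda>c y. c \<odot>\<^bsub>N\<^esub> y) M N (\<lambda>x y. t (b \<triangleright>\<^bsub>M\<^esub> x) (b' \<triangleright>\<^bsub>N\<^esub> y))"
    if "b \<in> carrier B" "b' \<in> carrier B'" for b b'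
    using that by (auto intro!: bihomI simp: balanced_def t_closed t_add M.lact_closed N.lact_closed
        M.lact_add_right N.lact_add_right M.lact_smult_right N.lact_smult_right t_balanced)
  have 2: "bihom B B' T (\<lambda>b b'. t (b \<triangleright>\<^bsub>M\<^esub> x) (b' \<triangleright>\<^bsub>N\<^esub> y)) \<and>
      balanced (carrier k) (\<lambda>x c. c \<odot>\<^bsub>B\<^esub> x) (\<lambda>c y. c \<odot>\<^bsub>B'\<^esub> y) B B' (\<lambda>b b'. t (b \<triangleright>\<^bsub>M\<^esub> x) (b' \<triangleright>\<^bsub>N\<^esub> y))"
    if "x \<in> carrier M" "y \<in> carrier N" for x y
    using that by (auto intro!: bihomI simp: balanced_def t_closed t_add M.lact_closed N.lact_closed
        M.lact_add_left N.lact_add_left M.lact_smult_left N.lact_smult_left t_balanced)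
  note * = tensor_lift2[OF BB.tensor_product_axioms tensor_product_axioms abelian_group_T, OF 1 2]
  show "bihom BB.T T T (\<lambda>u w. u \<triangleright>\<^bsub>MN\<^esub> w)"
    unfolding MN_lact using *(1) .
  show "\<lbrakk>b \<in> carrier B; b' \<in> carrier B'; x \<in> carrier M; y \<in> carrier N\<rbrakk> \<Longrightarrow>
    BB.t b b' \<triangleright>\<^bsub>MN\<^esub> t x y = t (b \<triangleright>\<^bsub>M\<^esub> x) (b' \<triangleright>\<^bsub>N\<^esub> y)"
    unfolding MN_lact using *(2) .
qed

text \<open>The definition lifts over the algebra element outside and over the module element
  inside; the arguments are swapped here to fit \<open>tensor_lift2\<close>.\<close>

lemma MN_ract_bihom: "bihom AA.T T T (\<lambda>v w. w \<triangleleft>\<^bsub>MN\<^esub> v)"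
  and MN_ract_pure: "\<lbrakk>a \<in> carrier A; a' \<in> carrier A'; x \<in> carrier M; y \<in> carrier N\<rbrakk> \<Longrightarrow>
    t x y \<triangleleft>\<^bsub>MN\<^esub> AA.t a a' = t (x \<triangleleft>\<^bsub>M\<^esub> a) (y \<triangleleft>\<^bsub>N\<^esub> a')"
proof -
  have 1: "bihom M N T (\<lambda>x y. t (x \<triangleleft>\<^bsub>M\<^esub> a) (y \<triangleleft>\<^bsub>N\<^esub> a')) \<and>
      balanced (carrier k) (\<lambda>x c. c \<odot>\<^bsub>M\<^esub> x) (\<lambda>c y. c \<odot>\<^bsub>N\<^esub> y) M N (\<lambda>x y. t (x \<triangleleft>\<^bsub>M\<^esub> a) (y \<triangleleft>\<^bsub>N\<^esub> a'))"
    if "a \<in> carrier A" "a' \<in> carrier A'" for a a'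
    using that by (auto intro!: bihomI simp: balanced_def t_closed t_add M.ract_closed N.ract_closed
        M.ract_add_left N.ract_add_left M.ract_smult_left N.ract_smult_left t_balanced)
  have 2: "bihom A A' T (\<lambda>a a'. t (x \<triangleleft>\<^bsub>M\<^esub> a) (y \<triangleleft>\<^bsub>N\<^esub> a')) \<and>
      balanced (carrier k) (\<lambda>x c. c \<odot>\<^bsub>A\<^esub> x) (\<lambda>c y. c \<odot>\<^bsub>A'\<^esub> y) A A' (\<lambda>a a'. t (x \<triangleleft>\<^bsub>M\<^esub> a) (y \<triangleleft>\<^bsub>N\<^esub> a'))"
    if "x \<in> carrier M" "y \<in> carrier N" for x y
    using that by (auto intro!: bihomI simp: balanced_def t_closed t_add M.ract_closed N.ract_closed
        M.ract_add_right N.ract_add_right M.ract_smult_right N.ract_smult_right t_balanced)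
  note * = tensor_lift2[OF AA.tensor_product_axioms tensor_product_axioms abelian_group_T, OF 1 2]
  show "bihom AA.T T T (\<lambda>v w. w \<triangleleft>\<^bsub>MN\<^esub> v)"
    unfolding MN_ract using *(1) .
  show "\<lbrakk>a \<in> carrier A; a' \<in> carrier A'; x \<in> carrier M; y \<in> carrier N\<rbrakk> \<Longrightarrow>
    t x y \<triangleleft>\<^bsub>MN\<^esub> AA.t a a' = t (x \<triangleleft>\<^bsub>M\<^esub> a) (y \<triangleleft>\<^bsub>N\<^esub> a')"
    unfolding MN_ract using *(2) .
qed

lemmas MN_act_simps = bihomD[OF MN_lact_bihom] bihomD[OF MN_ract_bihom]

sublocale MN: module k MN by (rule MN.module_V)
sublocale T: abelian_group T by (rule abelian_group_T)

lemma bimod_tensor_bimodule: "bimodule k (alg_tensor k B B') (alg_tensor k A A') MN"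
proof -
  have smult: "c \<odot>\<^bsub>MN\<^esub> w \<in> carrier T"
    "c \<odot>\<^bsub>MN\<^esub> (w \<oplus>\<^bsub>T\<^esub> w') = (c \<odot>\<^bsub>MN\<^esub> w) \<oplus>\<^bsub>T\<^esub> (c \<odot>\<^bsub>MN\<^esub> w')"
    if "c \<in> carrier k" "w \<in> carrier T" "w' \<in> carrier T" for c w w'
    using that MN.smult_closed MN.smult_r_distr by simp_all
  note [simp] = MN_act_simps smult t_closed BB.t_closed AA.t_closed
    BB.AB_mult_simps AA.AB_mult_simps BB.AB_smult_simps AA.AB_smult_simps
    M.lact_closed N.lact_closed M.ract_closed N.ract_closed
  have one: "\<one>\<^bsub>BB.AB\<^esub> \<in> carrier BB.T" "\<one>\<^bsub>AA.AB\<^esub> \<in> carrier AA.T"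
    by (simp_all add: BB.AB_one AA.AB_one)
  have lsl: "(c \<odot>\<^bsub>BB.AB\<^esub> u) \<triangleright>\<^bsub>MN\<^esub> w = c \<odot>\<^bsub>MN\<^esub> (u \<triangleright>\<^bsub>MN\<^esub> w)"
    and lsr: "u \<triangleright>\<^bsub>MN\<^esub> (c \<odot>\<^bsub>MN\<^esub> w) = c \<odot>\<^bsub>MN\<^esub> (u \<triangleright>\<^bsub>MN\<^esub> w)"
    if c: "c \<in> carrier k" and u: "u \<in> carrier BB.T" and w: "w \<in> carrier T" for c u w
  proof -
    have "(c \<odot>\<^bsub>BB.AB\<^esub> u) \<triangleright>\<^bsub>MN\<^esub> w = c \<odot>\<^bsub>MN\<^esub> (u \<triangleright>\<^bsub>MN\<^esub> w) \<and> u \<triangleright>\<^bsub>MN\<^esub> (c \<odot>\<^bsub>MN\<^esub> w) = c \<odot>\<^bsub>MN\<^esub> (u \<triangleright>\<^bsub>MN\<^esub> w)"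
      using u
    proof (induction u rule: BB.T_induct)
      case (pure b b')
      note bb' = pure
      show ?case using w
      proof (induction w rule: T_induct)
        case (pure x y)
        then show ?case using c bb'
          by (simp add: MN_lact_pure BB.AB_smult_pure MN.smult_pure M.lact_smult_left M.lact_smult_right)
      qed (use c bb' in simp)
    qed (use c w in simp)
    then show "(c \<odot>\<^bsub>BB.AB\<^esub> u) \<triangleright>\<^bsub>MN\<^esub> w = c \<odot>\<^bsub>MN\<^esub> (u \<triangleright>\<^bsub>MN\<^esub> w)"
      and "u \<triangleright>\<^bsub>MN\<^esub> (c \<odot>\<^bsub>MN\<^esub> w) = c \<odot>\<^bsub>MN\<^esub> (u \<triangleright>\<^bsub>MN\<^esub> w)" by simp_all
  qed
  have rsl: "(c \<odot>\<^bsub>MN\<^esub> w) \<triangleleft>\<^bsub>MN\<^esub> v = c \<odot>\<^bsub>MN\<^esub> (w \<triangleleft>\<^bsub>MN\<^esub> v)"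
    and rsr: "w \<triangleleft>\<^bsub>MN\<^esub> (c \<odot>\<^bsub>AA.AB\<^esub> v) = c \<odot>\<^bsub>MN\<^esub> (w \<triangleleft>\<^bsub>MN\<^esub> v)"
    if c: "c \<in> carrier k" and v: "v \<in> carrier AA.T" and w: "w \<in> carrier T" for c v w
  proof -
    have "(c \<odot>\<^bsub>MN\<^esub> w) \<triangleleft>\<^bsub>MN\<^esub> v = c \<odot>\<^bsub>MN\<^esub> (w \<triangleleft>\<^bsub>MN\<^esub> v) \<and> w \<triangleleft>\<^bsub>MN\<^esub> (c \<odot>\<^bsub>AA.AB\<^esub> v) = c \<odot>\<^bsub>MN\<^esub> (w \<triangleleft>\<^bsub>MN\<^esub> v)"
      using v
    proof (induction v rule: AA.T_induct)
      case (pure a a')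
      note aa' = pure
      show ?case using w
      proof (induction w rule: T_induct)
        case (pure x y)
        then show ?case using c aa'
          by (simp add: MN_ract_pure AA.AB_smult_pure MN.smult_pure M.ract_smult_left M.ract_smult_right)
      qed (use c aa' in simp)
    qed (use c w in simp)
    then show "(c \<odot>\<^bsub>MN\<^esub> w) \<triangleleft>\<^bsub>MN\<^esub> v = c \<odot>\<^bsub>MN\<^esub> (w \<triangleleft>\<^bsub>MN\<^esub> v)"
      and "w \<triangleleft>\<^bsub>MN\<^esub> (c \<odot>\<^bsub>AA.AB\<^esub> v) = c \<odot>\<^bsub>MN\<^esub> (w \<triangleleft>\<^bsub>MN\<^esub> v)" by simp_all
  qed
  have lm: "(u \<otimes>\<^bsub>BB.AB\<^esub> u') \<triangleright>\<^bsub>MN\<^esub> w = u \<triangleright>\<^bsub>MN\<^esub> (u' \<triangleright>\<^bsub>MN\<^esub> w)"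
    if u: "u \<in> carrier BB.T" and u': "u' \<in> carrier BB.T" and w: "w \<in> carrier T" for u u' w
    using w
  proof (induction w rule: T_induct)
    case (pure x y)
    note xy = pure
    show ?case using u
    proof (induction u rule: BB.T_induct)
      case (pure b c)
      note bc = pure
      show ?case using u'
      proof (induction u' rule: BB.T_induct)
        case (pure b' c')
        then show ?case using xy bc
          by (simp add: MN_lact_pure BB.AB_mult_pure M.lact_mult N.lact_mult)
      qed (use xy bc in simp)
    qed (use xy u' in simp)
  qed (use u u' in simp)
  have rm: "w \<triangleleft>\<^bsub>MN\<^esub> (v \<otimes>\<^bsub>AA.AB\<^esub> v') = (w \<triangleleft>\<^bsub>MN\<^esub> v) \<triangleleft>\<^bsub>MN\<^esub> v'"
    if v: "v \<in> carrier AA.T" and v': "v' \<in> carrier AA.T" and w: "w \<in> carrier T" for v v' w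
    using w
  proof (induction w rule: T_induct)
    case (pure x y)
    note xy = pure
    show ?case using v
    proof (induction v rule: AA.T_induct)
      case (pure b c)
      note bc = pure
      show ?case using v'
      proof (induction v' rule: AA.T_induct)
        case (pure b' c')
        then show ?case using xy bc
          by (simp add: MN_ract_pure AA.AB_mult_pure M.ract_mult N.ract_mult)
      qed (use xy bc in simp)
    qed (use xy v' in simp)
  qed (use v v' in simp)
  have lr: "(u \<triangleright>\<^bsub>MN\<^esub> w) \<triangleleft>\<^bsub>MN\<^esub> v = u \<triangleright>\<^bsub>MN\<^esub> (w \<triangleleft>\<^bsub>MN\<^esub> v)"
    if v: "v \<in> carrier AA.T" and u: "u \<in> carrier BB.T" and w: "w \<in> carrier T" for u v w
    using w
  proof (induction w rule: T_induct)
    case (pure x y)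
    note xy = pure
    show ?case using v
    proof (induction v rule: AA.T_induct)
      case (pure b c)
      note bc = pure
      show ?case using u
      proof (induction u rule: BB.T_induct)
        case (pure b' c')
        then show ?case using xy bc
          by (simp add: MN_ract_pure MN_lact_pure M.lact_ract N.lact_ract)
      qed (use xy bc in simp)
    qed (use xy u in simp)
  qed (use u v in simp)
  have lo: "\<one>\<^bsub>BB.AB\<^esub> \<triangleright>\<^bsub>MN\<^esub> w = w" and ro: "w \<triangleleft>\<^bsub>MN\<^esub> \<one>\<^bsub>AA.AB\<^esub> = w" if w: "w \<in> carrier T" for w
  proof -
    have "\<one>\<^bsub>BB.AB\<^esub> \<triangleright>\<^bsub>MN\<^esub> w = w \<and> w \<triangleleft>\<^bsub>MN\<^esub> \<one>\<^bsub>AA.AB\<^esub> = w"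
      using w
    proof (induction w rule: T_induct)
      case (pure x y)
      then show ?case
        by (simp add: BB.AB_one AA.AB_one MN_lact_pure MN_ract_pure
            M.lact_one N.lact_one M.ract_one N.ract_one)
    qed (simp add: one)
    then show "\<one>\<^bsub>BB.AB\<^esub> \<triangleright>\<^bsub>MN\<^esub> w = w" "w \<triangleleft>\<^bsub>MN\<^esub> \<one>\<^bsub>AA.AB\<^esub> = w" by simp_all
  qed
  show ?thesis
    by (intro bimodule.intro bimodule_axioms.intro BB.alg_tensor_assoc AA.alg_tensor_assoc
        MN.module_axioms)
      (use lsl lsr rsl rsr lm rm lr lo ro in simp_all)
qed

end

section \<open>Composition of bimodules over a middle algebra\<close>

locale bimodule_compose = M: bimodule k B R M + N: bimodule k R A N
  for k :: "'k ring" and B :: "('k, 'b) module" and R :: "('k, 'r) module"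
    and A :: "('k, 'a) module" and M :: "('k, 'b, 'm, 'r) bimod" and N :: "('k, 'r, 'n, 'a) bimod"

sublocale bimodule_compose \<subseteq> module_tensor_product k "carrier R" "ract M" "lact N" M N
  by unfold_locales (simp_all add: M.ract_closed N.lact_closed M.ract_smult_left)

context bimodule_compose
begin

abbreviation MN where "MN \<equiv> bimod_compose R M N"

lemma MN_simps [simp]: "carrier MN = carrier T" "add MN = add T" "\<zero>\<^bsub>MN\<^esub> = \<zero>\<^bsub>T\<^esub>"
  and MN_smult: "module.smult MN = (\<lambda>c. tensor_lift T (\<lambda>x y. t (c \<odot>\<^bsub>M\<^esub> x) y))"
  and MN_lact: "lact MN b = tensor_lift T (\<lambda>x y. t (b \<triangleright>\<^bsub>M\<^esub> x) y)"
  and MN_ract: "(\<lambda>w. w \<triangleleft>\<^bsub>MN\<^esub> a) = tensor_lift T (\<lambda>x y. t x (y \<triangleleft>\<^bsub>N\<^esub> a))"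
  by (simp_all add: bimod_compose_def Let_def)

end

sublocale bimodule_compose \<subseteq>
  MN: tensor_module k "carrier R" "ract M" "lact N" M N MN
proof -
  show "tensor_module k (carrier R) (ract M) (lact N) M N MN"
    by unfold_locales (simp_all add: MN_smult)
qed

context bimodule_compose
begin

sublocale MN: module k MN by (rule MN.module_V)

lemma MN_lact_hom: "b \<in> carrier B \<Longrightarrow> lact MN b \<in> add_hom T T"
  and MN_lact_pure: "\<lbrakk>b \<in> carrier B; x \<in> carrier M; y \<in> carrier N\<rbrakk> \<Longrightarrow>
    b \<triangleright>\<^bsub>MN\<^esub> t x y = t (b \<triangleright>\<^bsub>M\<^esub> x) y"
proof -
  have 1: "bihom M N T (\<lambda>x y. t (b \<triangleright>\<^bsub>M\<^esub> x) y)"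
    if "b \<in> carrier B" for b
    using that by (auto intro!: bihomI simp: t_closed t_add M.lact_closed M.lact_add_right)
  have 2: "balanced (carrier R) (ract M) (lact N) M N (\<lambda>x y. t (b \<triangleright>\<^bsub>M\<^esub> x) y)"
    if "b \<in> carrier B" for b
    using that by (auto simp: balanced_def M.lact_ract[symmetric] M.lact_closed t_balanced)
  show "b \<in> carrier B \<Longrightarrow> lact MN b \<in> add_hom T T"
    unfolding MN_lact using lift_hom[OF abelian_group_T 1 2] .
  show "\<lbrakk>b \<in> carrier B; x \<in> carrier M; y \<in> carrier N\<rbrakk> \<Longrightarrow> b \<triangleright>\<^bsub>MN\<^esub> t x y = t (b \<triangleright>\<^bsub>M\<^esub> x) y"
    unfolding MN_lact using lift_pure[OF abelian_group_T 1 2] .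
qed

lemma MN_ract_hom: "a \<in> carrier A \<Longrightarrow> (\<lambda>w. w \<triangleleft>\<^bsub>MN\<^esub> a) \<in> add_hom T T"
  and MN_ract_pure: "\<lbrakk>a \<in> carrier A; x \<in> carrier M; y \<in> carrier N\<rbrakk> \<Longrightarrow>
    t x y \<triangleleft>\<^bsub>MN\<^esub> a = t x (y \<triangleleft>\<^bsub>N\<^esub> a)"
proof -
  have 1: "bihom M N T (\<lambda>x y. t x (y \<triangleleft>\<^bsub>N\<^esub> a))"
    if "a \<in> carrier A" for a
    using that by (auto intro!: bihomI simp: t_closed t_add N.ract_closed N.ract_add_left)
  have 2: "balanced (carrier R) (ract M) (lact N) M N (\<lambda>x y. t x (y \<triangleleft>\<^bsub>N\<^esub> a))"
    if "a \<in> carrier A" for a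
    using that by (auto simp: balanced_def N.lact_ract N.ract_closed t_balanced)
  show "a \<in> carrier A \<Longrightarrow> (\<lambda>w. w \<triangleleft>\<^bsub>MN\<^esub> a) \<in> add_hom T T"
    unfolding MN_ract using lift_hom[OF abelian_group_T 1 2] .
  show "\<lbrakk>a \<in> carrier A; x \<in> carrier M; y \<in> carrier N\<rbrakk> \<Longrightarrow> t x y \<triangleleft>\<^bsub>MN\<^esub> a = t x (y \<triangleleft>\<^bsub>N\<^esub> a)"
    using lift_pure[OF abelian_group_T 1 2, of a x y] by (simp add: MN_ract[THEN fun_cong])
qed

text \<open>The relations balance elements of \<open>R\<close>, not scalars. A scalar
  \<open>c\<close> therefore crosses the tensor sign as \<open>c\<close> times the unit of
  \<open>R\<close>, on which both bimodules agree with their own scaling.\<close>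

lemma t_smult:
  assumes "c \<in> carrier k" "x \<in> carrier M" "y \<in> carrier N"
  shows "t (c \<odot>\<^bsub>M\<^esub> x) y = c \<odot>\<^bsub>MN\<^esub> t x y" "t x (c \<odot>\<^bsub>N\<^esub> y) = c \<odot>\<^bsub>MN\<^esub> t x y"
proof -
  show *: "t (c \<odot>\<^bsub>M\<^esub> x) y = c \<odot>\<^bsub>MN\<^esub> t x y"
    using assms by (simp add: MN.smult_pure)
  have "t (x \<triangleleft>\<^bsub>M\<^esub> (c \<odot>\<^bsub>R\<^esub> \<one>\<^bsub>R\<^esub>)) y = t x ((c \<odot>\<^bsub>R\<^esub> \<one>\<^bsub>R\<^esub>) \<triangleright>\<^bsub>N\<^esub> y)"
    using assms by (intro t_balanced) (simp_all add: M.A.smult_closed)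
  then show "t x (c \<odot>\<^bsub>N\<^esub> y) = c \<odot>\<^bsub>MN\<^esub> t x y"
    using assms * by (simp add: M.ract_smult_right M.ract_one N.lact_smult_left N.lact_one)
qed

sublocale T: abelian_group T by (rule abelian_group_T)

lemma MN_lact_simps:
  "\<lbrakk>b \<in> carrier B; w \<in> carrier T\<rbrakk> \<Longrightarrow> b \<triangleright>\<^bsub>MN\<^esub> w \<in> carrier T"
  "\<lbrakk>b \<in> carrier B; w \<in> carrier T; w' \<in> carrier T\<rbrakk> \<Longrightarrow>
    b \<triangleright>\<^bsub>MN\<^esub> (w \<oplus>\<^bsub>T\<^esub> w') = (b \<triangleright>\<^bsub>MN\<^esub> w) \<oplus>\<^bsub>T\<^esub> (b \<triangleright>\<^bsub>MN\<^esub> w')"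
  using add_hom_closed[OF MN_lact_hom] add_hom_add[OF MN_lact_hom] by blast+

lemma MN_ract_simps:
  "\<lbrakk>a \<in> carrier A; w \<in> carrier T\<rbrakk> \<Longrightarrow> w \<triangleleft>\<^bsub>MN\<^esub> a \<in> carrier T"
  "\<lbrakk>a \<in> carrier A; w \<in> carrier T; w' \<in> carrier T\<rbrakk> \<Longrightarrow>
    (w \<oplus>\<^bsub>T\<^esub> w') \<triangleleft>\<^bsub>MN\<^esub> a = (w \<triangleleft>\<^bsub>MN\<^esub> a) \<oplus>\<^bsub>T\<^esub> (w' \<triangleleft>\<^bsub>MN\<^esub> a)"
  using add_hom_closed[OF MN_ract_hom] add_hom_add[OF MN_ract_hom] by blast+

lemma bimod_compose_bimodule: "bimodule k B A MN"
proof -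
  note [simp] = MN_lact_simps MN_ract_simps MN_lact_pure MN_ract_pure MN.smult_pure
    t_closed t_add t_smult(2)[symmetric] M.lact_closed N.ract_closed T.a_ac
    MN.smult_closed[simplified] MN.smult_r_distr[simplified]
  \<comment> \<open>The algebra elements stay fixed and both sides of each law are additive in
    \<open>w\<close>, so one induction on \<open>w\<close> serves all of them.\<close>
  have "\<lbrakk>b \<in> carrier B; b' \<in> carrier B\<rbrakk> \<Longrightarrow>
      (b \<oplus>\<^bsub>B\<^esub> b') \<triangleright>\<^bsub>MN\<^esub> w = (b \<triangleright>\<^bsub>MN\<^esub> w) \<oplus>\<^bsub>T\<^esub> (b' \<triangleright>\<^bsub>MN\<^esub> w) \<and>
      (b \<otimes>\<^bsub>B\<^esub> b') \<triangleright>\<^bsub>MN\<^esub> w = b \<triangleright>\<^bsub>MN\<^esub> (b' \<triangleright>\<^bsub>MN\<^esub> w)"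
    and "\<lbrakk>c \<in> carrier k; b \<in> carrier B\<rbrakk> \<Longrightarrow>
      (c \<odot>\<^bsub>B\<^esub> b) \<triangleright>\<^bsub>MN\<^esub> w = c \<odot>\<^bsub>MN\<^esub> (b \<triangleright>\<^bsub>MN\<^esub> w) \<and>
      b \<triangleright>\<^bsub>MN\<^esub> (c \<odot>\<^bsub>MN\<^esub> w) = c \<odot>\<^bsub>MN\<^esub> (b \<triangleright>\<^bsub>MN\<^esub> w)"
    and "\<lbrakk>a \<in> carrier A; a' \<in> carrier A\<rbrakk> \<Longrightarrow>
      w \<triangleleft>\<^bsub>MN\<^esub> (a \<oplus>\<^bsub>A\<^esub> a') = (w \<triangleleft>\<^bsub>MN\<^esub> a) \<oplus>\<^bsub>T\<^esub> (w \<triangleleft>\<^bsub>MN\<^esub> a') \<and>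
      w \<triangleleft>\<^bsub>MN\<^esub> (a \<otimes>\<^bsub>A\<^esub> a') = (w \<triangleleft>\<^bsub>MN\<^esub> a) \<triangleleft>\<^bsub>MN\<^esub> a'"
    and "\<lbrakk>c \<in> carrier k; a \<in> carrier A\<rbrakk> \<Longrightarrow>
      w \<triangleleft>\<^bsub>MN\<^esub> (c \<odot>\<^bsub>A\<^esub> a) = c \<odot>\<^bsub>MN\<^esub> (w \<triangleleft>\<^bsub>MN\<^esub> a) \<and>
      (c \<odot>\<^bsub>MN\<^esub> w) \<triangleleft>\<^bsub>MN\<^esub> a = c \<odot>\<^bsub>MN\<^esub> (w \<triangleleft>\<^bsub>MN\<^esub> a)"
    and "\<lbrakk>a \<in> carrier A; b \<in> carrier B\<rbrakk> \<Longrightarrow> (b \<triangleright>\<^bsub>MN\<^esub> w) \<triangleleft>\<^bsub>MN\<^esub> a = b \<triangleright>\<^bsub>MN\<^esub> (w \<triangleleft>\<^bsub>MN\<^esub> a)"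
    and "\<one>\<^bsub>B\<^esub> \<triangleright>\<^bsub>MN\<^esub> w = w \<and> w \<triangleleft>\<^bsub>MN\<^esub> \<one>\<^bsub>A\<^esub> = w"
    if w: "w \<in> carrier T" for w b b' c a a'
    using w
  proof (induction w rule: T_induct)
    case (pure x y)
    {
      case 1
      then show ?case using pure by (simp add: M.lact_add_left M.lact_mult)
    next
      case 2
      then show ?case using pure by (simp add: M.lact_smult_left M.lact_smult_right)
    next
      case 3
      then show ?case using pure by (simp add: N.ract_add_right N.ract_mult)
    next
      case 4
      then show ?case using pure by (simp add: N.ract_smult_left[symmetric] N.ract_smult_right t_smult(1)[symmetric] del: MN.smult_pure)
    next
      case 5
      then show ?case using pure by simp
    next
      case 6
      then show ?case using pure by (simp add: M.lact_one N.ract_one)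
    }
  qed simp_all
  note * = this
  show ?thesis
    by (intro bimodule.intro bimodule_axioms.intro M.B.assoc_algebra_axioms
        N.A.assoc_algebra_axioms MN.module_axioms) (simp_all add: *)
qed

end

section \<open>Algebra homomorphisms and restriction along them\<close>

definition algebra_hom ::
  "('k, 'r) ring_scheme \<Rightarrow> ('k, 'a, 's) module_scheme \<Rightarrow> ('k, 'b, 't) module_scheme \<Rightarrow> ('a \<Rightarrow> 'b) \<Rightarrow> bool"
  where "algebra_hom k A B \<phi> \<longleftrightarrow> \<phi> \<in> add_hom A B \<and> \<phi> \<one>\<^bsub>A\<^esub> = \<one>\<^bsub>B\<^esub> \<and>
    (\<forall>c \<in> carrier k. \<forall>x \<in> carrier A. \<phi> (c \<odot>\<^bsub>A\<^esub> x) = c \<odot>\<^bsub>B\<^esub> \<phi> x) \<and>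
    (\<forall>x \<in> carrier A. \<forall>y \<in> carrier A. \<phi> (x \<otimes>\<^bsub>A\<^esub> y) = \<phi> x \<otimes>\<^bsub>B\<^esub> \<phi> y)"

text \<open>Applied to the associator and to the two embeddings of \<open>A\<close> into
  \<open>k \<otimes> A\<close> and \<open>A \<otimes> k\<close>.\<close>

lemma restrict_left_bimodule:
  assumes "bimodule k B A M" "assoc_algebra k C" "algebra_hom k C B \<phi>"
  shows "bimodule k C A (restrict_left \<phi> M)"
proof -
  interpret M: bimodule k B A M by fact
  interpret C: assoc_algebra k C by fact
  interpret V: module k "restrict_left \<phi> M"
    by (rule module_cong[OF M.M.module_axioms]) simp_all
  have \<phi>: "\<phi> \<in> add_hom C B" "\<phi> \<one>\<^bsub>C\<^esub> = \<one>\<^bsub>B\<^esub>"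
    "\<And>c x. \<lbrakk>c \<in> carrier k; x \<in> carrier C\<rbrakk> \<Longrightarrow> \<phi> (c \<odot>\<^bsub>C\<^esub> x) = c \<odot>\<^bsub>B\<^esub> \<phi> x"
    "\<And>x y. \<lbrakk>x \<in> carrier C; y \<in> carrier C\<rbrakk> \<Longrightarrow> \<phi> (x \<otimes>\<^bsub>C\<^esub> y) = \<phi> x \<otimes>\<^bsub>B\<^esub> \<phi> y"
    using assms(3) by (auto simp: algebra_hom_def)
  show ?thesis
    by (intro bimodule.intro bimodule_axioms.intro C.assoc_algebra_axioms
        M.A.assoc_algebra_axioms V.module_axioms)
      (simp_all add: \<phi>(2-) add_hom_closed[OF \<phi>(1)] add_hom_add[OF \<phi>(1)]
        M.lact_closed M.lact_add_left M.lact_add_right M.lact_smult_left M.lact_smult_right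
        M.lact_mult M.lact_one M.ract_closed M.ract_add_left M.ract_add_right M.ract_smult_left
        M.ract_smult_right M.ract_mult M.ract_one M.lact_ract)
qed

locale algebra_tensor3 = A: assoc_algebra k A + B: assoc_algebra k B + C: assoc_algebra k C
  for k :: "'k ring" and A :: "('k, 'a) module" and B :: "('k, 'b) module"
    and C :: "('k, 'c) module"

sublocale algebra_tensor3 \<subseteq> AB: algebra_tensor k A B ..
sublocale algebra_tensor3 \<subseteq> BC: algebra_tensor k B C ..
sublocale algebra_tensor3 \<subseteq> L: algebra_tensor k "alg_tensor k A B" C
  by (intro algebra_tensor.intro AB.alg_tensor_assoc C.assoc_algebra_axioms)
sublocale algebra_tensor3 \<subseteq> R: algebra_tensor k A "alg_tensor k B C"
  by (intro algebra_tensor.intro BC.alg_tensor_assoc A.assoc_algebra_axioms)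

context algebra_tensor3
begin

lemma alg_assoc_eq:
  "alg_assoc k A B C =
    tensor_lift R.AB (\<lambda>u c. tensor_lift R.AB (\<lambda>a b. R.t a (BC.t b c)) u)"
  unfolding alg_assoc_def Let_def R.alg_pure_eq BC.alg_pure_eq ..

text \<open>The inner lift is taken for a fixed \<open>c\<close>. That the outer map is balanced is
  seen on pure tensors: a scalar on \<open>a\<close> passes to \<open>BC.t b c\<close> as a whole,
  and within it from \<open>b\<close> to \<open>c\<close>.\<close>

lemma alg_assoc_hom: "alg_assoc k A B C \<in> add_hom L.T R.AB"
  and alg_assoc_pure: "\<lbrakk>a \<in> carrier A; b \<in> carrier B; c \<in> carrier C\<rbrakk> \<Longrightarrow>
    alg_assoc k A B C (L.t (AB.t a b) c) = R.t a (BC.t b c)"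
proof -
  define \<beta> where "\<beta> u c = tensor_lift R.AB (\<lambda>a b. R.t a (BC.t b c)) u" for u c
  have 1: "bihom A B R.AB (\<lambda>a b. R.t a (BC.t b c))"
    "balanced (carrier k) (\<lambda>x c. c \<odot>\<^bsub>A\<^esub> x) (\<lambda>c y. c \<odot>\<^bsub>B\<^esub> y) A B (\<lambda>a b. R.t a (BC.t b c))"
    if "c \<in> carrier C" for c
    using that R.t_balanced BC.t_closed
    by (auto intro!: bihomI simp: balanced_def R.t_closed R.t_add[simplified] BC.t_add BC.AB_smult_pure)
  have \<beta>_hom: "(\<lambda>u. \<beta> u c) \<in> add_hom AB.T R.AB" if "c \<in> carrier C" for c
    unfolding \<beta>_def using AB.lift_hom[OF R.AB.abelian_group_axioms 1[OF that]] .
  have \<beta>_pure: "\<beta> (AB.t a b) c = R.t a (BC.t b c)"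
    if "a \<in> carrier A" "b \<in> carrier B" "c \<in> carrier C" for a b c
    unfolding \<beta>_def using AB.lift_pure[OF R.AB.abelian_group_axioms 1[OF that(3)] that(1,2)] .
  have 2: "bihom AB.AB C R.AB \<beta>"
  proof (rule bihomI)
    show "\<beta> u c \<in> carrier R.AB" if "u \<in> carrier AB.AB" "c \<in> carrier C" for u c
      using that add_hom_closed[OF \<beta>_hom] by simp
    show "\<beta> (u \<oplus>\<^bsub>AB.AB\<^esub> u') c = \<beta> u c \<oplus>\<^bsub>R.AB\<^esub> \<beta> u' c"
      if "u \<in> carrier AB.AB" "u' \<in> carrier AB.AB" "c \<in> carrier C" for u u' c
      using that add_hom_add[OF \<beta>_hom] by simp
    show "\<beta> u (c \<oplus>\<^bsub>C\<^esub> c') = \<beta> u c \<oplus>\<^bsub>R.AB\<^esub> \<beta> u c'"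
      if u: "u \<in> carrier AB.AB" and c: "c \<in> carrier C" "c' \<in> carrier C" for u c c'
    proof (rule AB.hom_eqI[OF \<beta>_hom hom_sum[OF R.AB.abelian_group_axioms \<beta>_hom \<beta>_hom]])
      fix a b assume "a \<in> carrier A" "b \<in> carrier B"
      then show "\<beta> (AB.t a b) (c \<oplus>\<^bsub>C\<^esub> c') = \<beta> (AB.t a b) c \<oplus>\<^bsub>R.AB\<^esub> \<beta> (AB.t a b) c'"
        using c by (simp add: \<beta>_pure BC.t_add R.t_add[simplified] BC.t_closed)
    qed (use u c in simp_all)
  qed
  have 3: "balanced (carrier k) (\<lambda>x c. c \<odot>\<^bsub>AB.AB\<^esub> x) (\<lambda>c y. c \<odot>\<^bsub>C\<^esub> y) AB.AB C \<beta>"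
    unfolding balanced_def
  proof (intro ballI)
    fix u r c assume *: "u \<in> carrier AB.AB" "r \<in> carrier k" "c \<in> carrier C"
    have "(\<lambda>u. r \<odot>\<^bsub>AB.AB\<^esub> u) \<in> add_hom AB.T AB.T"
      by (rule add_homI) (use * in \<open>simp_all add: AB.AB_smult_simps\<close>)
    note hom = add_hom_compose[OF this \<beta>_hom]
    show "\<beta> (r \<odot>\<^bsub>AB.AB\<^esub> u) c = \<beta> u (r \<odot>\<^bsub>C\<^esub> c)"
    proof (rule AB.hom_eqI[OF hom \<beta>_hom])
      fix a b assume "a \<in> carrier A" "b \<in> carrier B"
      then show "\<beta> (r \<odot>\<^bsub>AB.AB\<^esub> AB.t a b) c = \<beta> (AB.t a b) (r \<odot>\<^bsub>C\<^esub> c)"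
        using * R.t_balanced[of a r "BC.t b c"]
        by (simp add: \<beta>_pure AB.AB_smult_pure BC.AB_smult_pure BC.t_balanced[symmetric] BC.t_closed)
    qed (use * in simp_all)
  qed
  show "alg_assoc k A B C \<in> add_hom L.T R.AB"
    unfolding alg_assoc_eq \<beta>_def[symmetric] by (rule L.lift_hom[OF R.AB.abelian_group_axioms 2 3])
  show "\<lbrakk>a \<in> carrier A; b \<in> carrier B; c \<in> carrier C\<rbrakk> \<Longrightarrow>
      alg_assoc k A B C (L.t (AB.t a b) c) = R.t a (BC.t b c)"
    unfolding alg_assoc_eq \<beta>_def[symmetric]
    by (subst L.lift_pure[OF R.AB.abelian_group_axioms 2 3]) (simp_all add: \<beta>_pure AB.t_closed)
qed

lemma L_induct [consumes 1, case_names pure add]: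
  assumes "u \<in> carrier L.T"
    and pure: "\<And>a b c. \<lbrakk>a \<in> carrier A; b \<in> carrier B; c \<in> carrier C\<rbrakk> \<Longrightarrow> P (L.t (AB.t a b) c)"
    and add: "\<And>u v. \<lbrakk>u \<in> carrier L.T; v \<in> carrier L.T; P u; P v\<rbrakk> \<Longrightarrow> P (u \<oplus>\<^bsub>L.T\<^esub> v)"
  shows "P u"
  using assms(1)
proof (induction u rule: L.T_induct)
  case (pure w c)
  then have "w \<in> carrier AB.T" "c \<in> carrier C" by simp_all
  then show ?case
  proof (induction w rule: AB.T_induct)
    case (add u v)
    then show ?case using L.t_add(1)[of u v c] assms(3) L.t_closed by simp
  qed (use assms(2) in simp)
qed (use assms(3) in simp)

lemma alg_assoc_algebra_hom: "algebra_hom k L.AB R.AB (alg_assoc k A B C)"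
proof -
  note [simp] = add_hom_closed[OF alg_assoc_hom, simplified] add_hom_add[OF alg_assoc_hom, simplified]
    AB.t_closed BC.t_closed L.t_closed R.t_closed
    AB.AB_smult_pure L.AB_smult_pure R.AB_smult_pure
    AB.AB_mult_pure L.AB_mult_pure R.AB_mult_pure BC.AB_mult_pure
    L.AB_mult_simps R.AB_mult_simps L.AB_smult_simps R.AB_smult_simps
  have one: "alg_assoc k A B C \<one>\<^bsub>L.AB\<^esub> = \<one>\<^bsub>R.AB\<^esub>"
    by (simp add: L.AB_one R.AB_one AB.AB_one BC.AB_one alg_assoc_pure)
  have smult: "alg_assoc k A B C (r \<odot>\<^bsub>L.AB\<^esub> u) = r \<odot>\<^bsub>R.AB\<^esub> alg_assoc k A B C u"
    if r: "r \<in> carrier k" and u: "u \<in> carrier L.T" for r u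
    using u by (induction u rule: L_induct) (use r in \<open>simp_all add: alg_assoc_pure\<close>)
  have mult: "alg_assoc k A B C (u \<otimes>\<^bsub>L.AB\<^esub> v) = alg_assoc k A B C u \<otimes>\<^bsub>R.AB\<^esub> alg_assoc k A B C v"
    if u: "u \<in> carrier L.T" and v: "v \<in> carrier L.T" for u v
    using u
  proof (induction u rule: L_induct)
    case (pure a b c)
    note abc = pure
    show ?case using v
      by (induction v rule: L_induct) (use abc in \<open>simp_all add: alg_assoc_pure\<close>)
  qed (use v in simp)
  show ?thesis
    unfolding algebra_hom_def
    by (intro conjI ballI add_homI) (use one smult mult in simp_all)
qed

end

context algebra_tensor
begin

text \<open>With \<open>base_algebra k\<close> as left factor this identifies an algebra with its
  tensor product with \<open>k\<close>. Scaling is defined on the left factor, so the scalar first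
  has to cross the tensor sign.\<close>

lemma pure_right_algebra_hom:
  "algebra_hom k B AB (\<lambda>b. t \<one>\<^bsub>A\<^esub> b)"
proof -
  have "t \<one>\<^bsub>A\<^esub> (c \<odot>\<^bsub>B\<^esub> b) = c \<odot>\<^bsub>AB\<^esub> t \<one>\<^bsub>A\<^esub> b" if "c \<in> carrier k" "b \<in> carrier B" for b c
    using t_balanced[of "\<one>\<^bsub>A\<^esub>" c b] that by (simp add: AB_smult_pure)
  then show ?thesis
    unfolding algebra_hom_def
    by (intro conjI ballI add_homI) (simp_all add: AB_one AB_mult_pure t_closed t_add)
qed

lemma pure_left_algebra_hom: "algebra_hom k A AB (\<lambda>a. t a \<one>\<^bsub>B\<^esub>)"
  unfolding algebra_hom_def
  by (intro conjI ballI add_homI) (simp_all add: AB_one AB_mult_pure AB_smult_pure t_closed t_add)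

end

section \<open>Bases over the complex numbers\<close>

lemma complex_ring_simps [simp]:
  "c \<in> carrier complex_ring" "add complex_ring = (+)" "\<zero>\<^bsub>complex_ring\<^esub> = 0"
  "\<one>\<^bsub>complex_ring\<^esub> = 1" "monoid.mult complex_ring = (*)"
  by (simp_all add: ring_of_type_algebra_def)

lemma free_space_simps [simp]:
  "carrier free_space = UNIV" "add free_space = (+)" "\<zero>\<^bsub>free_space\<^esub> = 0"
  "module.smult free_space = scale"
  by (simp_all add: free_space_def)

lemma lookup_scale [simp]: "Poly_Mapping.lookup (scale c x) i = c * Poly_Mapping.lookup x i"
  by (simp add: scale_def map.rep_eq when_def)

lemma scale_simps [simp]:
  "scale c (x + y) = scale c x + scale c y" "scale (c + d) x = scale c x + scale d x"
  "scale c (scale d x) = scale (c * d) x" "scale 1 x = x" "scale 0 x = 0" "scale c 0 = 0"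
  "scale c (Poly_Mapping.single i d) = Poly_Mapping.single i (c * d)"
  by (auto intro!: poly_mapping_eqI simp: lookup_add lookup_single when_def algebra_simps)

lemma scale_sum: "scale c (sum f S) = (\<Sum>i\<in>S. scale c (f i))"
  by (induction S rule: infinite_finite_induct) simp_all

lemma lin_ext_superset:
  assumes "finite K" "Poly_Mapping.keys x \<subseteq> K"
  shows "lin_ext f x = (\<Sum>p\<in>K. scale (Poly_Mapping.lookup x p) (f p))"
  unfolding lin_ext_def
  by (rule sum.mono_neutral_left) (use assms in \<open>auto simp: in_keys_iff\<close>)

lemma lin_ext_add [simp]: "lin_ext f (x + y) = lin_ext f x + lin_ext f y"
proof -
  let ?K = "Poly_Mapping.keys x \<union> Poly_Mapping.keys y"
  show ?thesis
    using keys_add[of x y]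
    by (simp add: lin_ext_superset[of ?K] lookup_add sum.distrib)
qed

lemma lin_ext_scale [simp]: "lin_ext f (scale c x) = scale c (lin_ext f x)"
proof -
  have "Poly_Mapping.keys (scale c x) \<subseteq> Poly_Mapping.keys x"
    by (auto simp: in_keys_iff)
  then show ?thesis
    by (simp add: lin_ext_superset[of "Poly_Mapping.keys x"] scale_sum)
qed

lemma lin_ext_single [simp]: "lin_ext f (Poly_Mapping.single p c) = scale c (f p)"
  using lin_ext_scale[of f c "Poly_Mapping.single p 1"] by simp

lemma lin_ext_add_fun [simp]: "lin_ext (\<lambda>p. f p + g p) x = lin_ext f x + lin_ext g x"
  by (simp add: lin_ext_def sum.distrib)

lemma lin_ext_scale_fun [simp]: "lin_ext (\<lambda>p. scale c (f p)) x = scale c (lin_ext f x)"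
  by (simp add: lin_ext_def scale_sum mult.commute)

lemma module_free:
  assumes "carrier V = UNIV" "add V = (+)" "\<zero>\<^bsub>V\<^esub> = 0" "module.smult V = scale"
  shows "module complex_ring V"
proof (rule moduleI)
  show "cring complex_ring" by (rule cring_from_type_algebra)
  show "abelian_group V"
    by (rule abelian_groupI)
      (use assms in \<open>auto simp: ac_simps intro: exI[of _ "- x" for x]\<close>)
qed (simp_all add: assms)

lemma abelian_group_free_space: "abelian_group free_space"
  by (rule module.axioms(2)[OF module_free]) simp_all

section \<open>Linear maps, spanning families and bases\<close>

definition linear_maps ::
  "(complex, 'm, 's) module_scheme \<Rightarrow> (complex, 'n, 't) module_scheme \<Rightarrow> ('m \<Rightarrow> 'n) set"
  where "linear_maps M N =
    {f \<in> add_hom M N. \<forall>c. \<forall>x \<in> carrier M. f (c \<odot>\<^bsub>M\<^esub> x) = c \<odot>\<^bsub>N\<^esub> f x}"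

lemma linear_mapsD:
  assumes "f \<in> linear_maps M N"
  shows "x \<in> carrier M \<Longrightarrow> f x \<in> carrier N"
    and "\<lbrakk>x \<in> carrier M; y \<in> carrier M\<rbrakk> \<Longrightarrow> f (x \<oplus>\<^bsub>M\<^esub> y) = f x \<oplus>\<^bsub>N\<^esub> f y"
    and "x \<in> carrier M \<Longrightarrow> f (c \<odot>\<^bsub>M\<^esub> x) = c \<odot>\<^bsub>N\<^esub> f x"
  using assms by (auto simp: linear_maps_def hom_def)

lemma linear_mapsI:
  assumes "\<And>x. x \<in> carrier M \<Longrightarrow> f x \<in> carrier N"
    and "\<And>x y. \<lbrakk>x \<in> carrier M; y \<in> carrier M\<rbrakk> \<Longrightarrow> f (x \<oplus>\<^bsub>M\<^esub> y) = f x \<oplus>\<^bsub>N\<^esub> f y"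
    and "\<And>c x. x \<in> carrier M \<Longrightarrow> f (c \<odot>\<^bsub>M\<^esub> x) = c \<odot>\<^bsub>N\<^esub> f x"
  shows "f \<in> linear_maps M N"
  unfolding linear_maps_def using assms by (auto intro!: add_homI)

text \<open>An inductive set instead of finite sums, because its induction rule is what is used: an
  additive statement is checked on multiples of family members. Zero enters as a multiple by
  0.\<close>

inductive_set span_of :: "(complex, 'm, 's) module_scheme \<Rightarrow> ('i \<Rightarrow> 'm) \<Rightarrow> 'm set"
  for M and b where
    multiple: "c \<odot>\<^bsub>M\<^esub> b i \<in> span_of M b"
  | add: "\<lbrakk>x \<in> span_of M b; y \<in> span_of M b\<rbrakk> \<Longrightarrow> x \<oplus>\<^bsub>M\<^esub> y \<in> span_of M b"

definition spans :: "(complex, 'm, 's) module_scheme \<Rightarrow> ('i \<Rightarrow> 'm) \<Rightarrow> bool"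
  where "spans M b \<longleftrightarrow> range b \<subseteq> carrier M \<and> carrier M \<subseteq> span_of M b"

lemma spans_closed: "spans M b \<Longrightarrow> b i \<in> carrier M"
  by (auto simp: spans_def)

lemma spans_induct [consumes 3, case_names multiple add]:
  assumes "spans M b" "module complex_ring M" "x \<in> carrier M"
    and multiple: "\<And>c i. P (c \<odot>\<^bsub>M\<^esub> b i)"
    and add: "\<And>x y. \<lbrakk>x \<in> carrier M; y \<in> carrier M; P x; P y\<rbrakk> \<Longrightarrow> P (x \<oplus>\<^bsub>M\<^esub> y)"
  shows "P x"
proof -
  interpret M: module complex_ring M by fact
  have "x \<in> span_of M b" using assms by (auto simp: spans_def)
  then have "x \<in> carrier M \<and> P x"
    using assms(1) by (induction) (auto simp: spans_closed intro: multiple add)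
  then show ?thesis ..
qed

lemma linear_maps_eqI:
  assumes "spans M b" "module complex_ring M" "f \<in> linear_maps M N" "g \<in> linear_maps M N"
    and "\<And>i. f (b i) = g (b i)" "x \<in> carrier M"
  shows "f x = g x"
  using assms(1,2,6)
  by (induction x rule: spans_induct)
    (simp_all add: linear_mapsD[OF assms(3)] linear_mapsD[OF assms(4)] assms(5) spans_closed[OF assms(1)])

lemma spans_single:
  assumes "carrier V = UNIV" "add V = (+)" "\<zero>\<^bsub>V\<^esub> = 0" "module.smult V = scale"
  shows "spans V (\<lambda>i. Poly_Mapping.single i 1)"
proof -
  have "x \<in> span_of V (\<lambda>i. Poly_Mapping.single i 1)" for x
  proof (induction x rule: update_induct)
    case const
    then show ?case using span_of.multiple[of V 0 "\<lambda>i. Poly_Mapping.single i 1"] assms by simp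
  next
    case (update f a b)
    have "Poly_Mapping.update a b f = f + Poly_Mapping.single a b"
      using update(1)
      by (auto intro!: poly_mapping_eqI simp: lookup_update lookup_add lookup_single in_keys_iff when_def)
    then show ?case
      using span_of.add[OF update(3) span_of.multiple[of V b _ a]] assms by simp
  qed
  then show ?thesis using assms by (auto simp: spans_def)
qed

text \<open>The counterpart of \<open>lin_ext\<close> with values in an arbitrary module; additivity
  again rests on a common finite superset of the supports.\<close>

lemma linear_ext_exists:
  fixes M :: "(complex, 'm, 's) module_scheme" and b :: "'i \<Rightarrow> 'm"
  assumes "module complex_ring M" and b: "\<And>i. b i \<in> carrier M"
  obtains g where "g \<in> linear_maps free_space M" "\<And>i. g (Poly_Mapping.single i 1) = b i"
proof -
  interpret M: module complex_ring M by fact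
  define g where "g x = (\<Oplus>\<^bsub>M\<^esub>i \<in> Poly_Mapping.keys x. Poly_Mapping.lookup x i \<odot>\<^bsub>M\<^esub> b i)" for x
  have closed: "c \<odot>\<^bsub>M\<^esub> b i \<in> carrier M" for c i
    using b by simp
  have ext: "g x = (\<Oplus>\<^bsub>M\<^esub>i \<in> K. Poly_Mapping.lookup x i \<odot>\<^bsub>M\<^esub> b i)"
    if "finite K" "Poly_Mapping.keys x \<subseteq> K" for x K
    unfolding g_def
    by (rule M.M.add.finprod_mono_neutral_cong_left)
      (use that closed M.smult_l_null[OF b] in \<open>auto simp: in_keys_iff\<close>)
  have "g \<in> linear_maps free_space M"
  proof (rule linear_mapsI)
    show "g x \<in> carrier M" for x
      unfolding g_def using closed by (auto intro: M.M.finsum_closed)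
    fix x y :: "'i \<Rightarrow>\<^sub>0 complex"
    let ?K = "Poly_Mapping.keys x \<union> Poly_Mapping.keys y"
    have "g (x + y) = (\<Oplus>\<^bsub>M\<^esub>i \<in> ?K. Poly_Mapping.lookup (x + y) i \<odot>\<^bsub>M\<^esub> b i)"
      using keys_add[of x y] by (intro ext) auto
    also have "\<dots> = (\<Oplus>\<^bsub>M\<^esub>i \<in> ?K. Poly_Mapping.lookup x i \<odot>\<^bsub>M\<^esub> b i \<oplus>\<^bsub>M\<^esub> Poly_Mapping.lookup y i \<odot>\<^bsub>M\<^esub> b i)"
      using b M.smult_l_distr by (intro M.M.finsum_cong') (auto simp: lookup_add)
    also have "\<dots> = g x \<oplus>\<^bsub>M\<^esub> g y"
      using closed by (subst M.M.finsum_addf) (auto simp: ext[of ?K])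
    finally show "g (x \<oplus>\<^bsub>free_space\<^esub> y) = g x \<oplus>\<^bsub>M\<^esub> g y" by simp
  next
    fix c and x :: "'i \<Rightarrow>\<^sub>0 complex"
    have sub: "Poly_Mapping.keys (scale c x) \<subseteq> Poly_Mapping.keys x"
      by (auto simp: in_keys_iff)
    have "g (scale c x) = (\<Oplus>\<^bsub>M\<^esub>i \<in> Poly_Mapping.keys x. c \<odot>\<^bsub>M\<^esub> (Poly_Mapping.lookup x i \<odot>\<^bsub>M\<^esub> b i))"
      using b M.smult_assoc1
      by (subst ext[OF _ sub]) (auto intro!: M.M.finsum_cong')
    also have "\<dots> = c \<odot>\<^bsub>M\<^esub> g x"
      unfolding g_def using closed by (subst M.finsum_smult_ldistr) auto
    finally show "g (c \<odot>\<^bsub>free_space\<^esub> x) = c \<odot>\<^bsub>M\<^esub> g x" by simp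
  qed
  moreover have "g (Poly_Mapping.single i 1) = b i" for i
    unfolding g_def using b M.smult_one[OF b] by simp
  ultimately show thesis using that by blast
qed

text \<open>Independence is expressed by a coordinate map, since on a quotient a linear map can be
  produced by \<open>tensor_lift\<close>, whereas linear relations between cosets are hard to
  analyse.\<close>

definition is_basis :: "(complex, 'm, 's) module_scheme \<Rightarrow> ('i \<Rightarrow> 'm) \<Rightarrow> bool"
  where "is_basis M b \<longleftrightarrow> spans M b \<and>
    (\<exists>f \<in> linear_maps M free_space. \<forall>i. f (b i) = Poly_Mapping.single i 1)"

lemma is_basis_spans: "is_basis M b \<Longrightarrow> spans M b"
  by (simp add: is_basis_def)

lemma is_basis_single:
  assumes "carrier V = UNIV" "add V = (+)" "\<zero>\<^bsub>V\<^esub> = 0" "module.smult V = scale"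
  shows "is_basis V (\<lambda>i. Poly_Mapping.single i 1)"
  unfolding is_basis_def using spans_single[OF assms] assms
  by (auto intro!: bexI[of _ "\<lambda>x. x"] linear_mapsI)

text \<open>The new coordinates are the old ones with indices pulled back along \<open>\<pi>\<close>
  and divided by \<open>\<mu>\<close>, which is the map \<open>h\<close> below.\<close>

lemma is_basis_rescale:
  assumes b: "is_basis M b" and M: "module complex_ring M" and \<pi>: "bij \<pi>" and \<mu>: "\<And>i. \<mu> i \<noteq> 0"
  shows "is_basis M (\<lambda>i. \<mu> i \<odot>\<^bsub>M\<^esub> b (\<pi> i))"
proof -
  interpret M: module complex_ring M by fact
  have closed: "b i \<in> carrier M" for i
    using spans_closed[OF is_basis_spans[OF b]] .
  have "x \<in> span_of M (\<lambda>i. \<mu> i \<odot>\<^bsub>M\<^esub> b (\<pi> i))" if "x \<in> carrier M" for x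
    using is_basis_spans[OF b] M that
  proof (induction x rule: spans_induct)
    case (multiple c j)
    let ?i = "inv_into UNIV \<pi> j"
    have "\<pi> ?i = j" using \<pi> by (simp add: bij_is_surj surj_f_inv_f)
    then have "c \<odot>\<^bsub>M\<^esub> b j = (c / \<mu> ?i) \<odot>\<^bsub>M\<^esub> (\<mu> ?i \<odot>\<^bsub>M\<^esub> b (\<pi> ?i))"
      using M.smult_assoc1[of "c / \<mu> ?i" "\<mu> ?i" "b j"] closed \<mu>[of ?i] by simp
    then show ?case
      using span_of.multiple[of M "c / \<mu> ?i" "\<lambda>i. \<mu> i \<odot>\<^bsub>M\<^esub> b (\<pi> i)" ?i] by simp
  qed (rule span_of.add)
  then have "spans M (\<lambda>i. \<mu> i \<odot>\<^bsub>M\<^esub> b (\<pi> i))"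
    using closed by (auto simp: spans_def)
  moreover obtain f where f: "f \<in> linear_maps M free_space" "\<And>i. f (b i) = Poly_Mapping.single i 1"
    using b by (auto simp: is_basis_def)
  define h where "h j = Poly_Mapping.single (inv_into UNIV \<pi> j) (1 / \<mu> (inv_into UNIV \<pi> j))" for j
  have "(\<lambda>x. lin_ext h (f x)) \<in> linear_maps M free_space"
    using linear_mapsD[OF f(1)] by (intro linear_mapsI) simp_all
  moreover have "lin_ext h (f (\<mu> i \<odot>\<^bsub>M\<^esub> b (\<pi> i))) = Poly_Mapping.single i 1" for i
    using \<pi> \<mu>[of i] closed by (simp add: linear_mapsD[OF f(1)] f(2) h_def bij_is_inj)
  ultimately show ?thesis
    unfolding is_basis_def by (intro conjI bexI[of _ "\<lambda>x. lin_ext h (f x)"]) simp_all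
qed

text \<open>Coordinates with respect to one basis followed by linear extension to the other; the two
  maps so obtained are mutually inverse because they are so on the bases.\<close>

lemma bases_linear_iso:
  assumes M: "module complex_ring M" "is_basis M b" and N: "module complex_ring N" "is_basis N b'"
  obtains \<psi> where "\<psi> \<in> linear_maps M N" "bij_betw \<psi> (carrier M) (carrier N)" "\<And>i. \<psi> (b i) = b' i"
proof -
  obtain f where f: "f \<in> linear_maps M free_space" "\<And>i. f (b i) = Poly_Mapping.single i 1"
    using M by (auto simp: is_basis_def)
  obtain f' where f': "f' \<in> linear_maps N free_space" "\<And>i. f' (b' i) = Poly_Mapping.single i 1"
    using N by (auto simp: is_basis_def)
  obtain g where g: "g \<in> linear_maps free_space M" "\<And>i. g (Poly_Mapping.single i 1) = b i"
    using linear_ext_exists[OF M(1), of b] spans_closed[OF is_basis_spans[OF M(2)]] by blast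
  obtain g' where g': "g' \<in> linear_maps free_space N" "\<And>i. g' (Poly_Mapping.single i 1) = b' i"
    using linear_ext_exists[OF N(1), of b'] spans_closed[OF is_basis_spans[OF N(2)]] by blast
  have comp: "(\<lambda>x. q (p x)) \<in> linear_maps P Q" if "p \<in> linear_maps P S" "q \<in> linear_maps S Q"
    for p q and P :: "(complex, 'x, 'y) module_scheme" and S :: "(complex, 'u, 'v) module_scheme"
      and Q :: "(complex, 'z, 'w) module_scheme"
    using linear_mapsD[OF that(1)] linear_mapsD[OF that(2)] by (auto intro!: linear_mapsI)
  have id: "(\<lambda>x. x) \<in> linear_maps P P" for P :: "(complex, 'x, 'y) module_scheme"
    by (auto intro!: linear_mapsI)
  define \<psi> where "\<psi> = (\<lambda>x. g' (f x))"
  define \<psi>' where "\<psi>' = (\<lambda>x. g (f' x))"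
  have \<psi>: "\<psi> \<in> linear_maps M N" and \<psi>': "\<psi>' \<in> linear_maps N M"
    unfolding \<psi>_def \<psi>'_def using comp[OF f(1) g'(1)] comp[OF f'(1) g(1)] by simp_all
  have b: "\<psi> (b i) = b' i" "\<psi>' (b' i) = b i" for i
    by (simp_all add: \<psi>_def \<psi>'_def f f' g g')
  have "\<psi>' (\<psi> x) = x" if "x \<in> carrier M" for x
    by (rule linear_maps_eqI[OF is_basis_spans[OF M(2)] M(1) comp[OF \<psi> \<psi>'] id _ that]) (simp add: b)
  moreover have "\<psi> (\<psi>' x) = x" if "x \<in> carrier N" for x
    by (rule linear_maps_eqI[OF is_basis_spans[OF N(2)] N(1) comp[OF \<psi>' \<psi>] id _ that]) (simp add: b)
  ultimately have "bij_betw \<psi> (carrier M) (carrier N)"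
    using linear_mapsD(1)[OF \<psi>] linear_mapsD(1)[OF \<psi>'] by (intro bij_betw_byWitness[of _ \<psi>']) auto
  then show thesis using that \<psi> b by blast
qed

text \<open>Since the same \<open>c\<close> and \<open>j\<close> serve on both sides, the linear map
  matching the bases commutes with the actions of \<open>\<beta> w\<close> and
  \<open>\<alpha> w\<close> on basis vectors. Bilinearity of the actions extends this to all
  elements.\<close>

theorem bimodule_isomorphic_bases:
  assumes M: "bimodule complex_ring B A M" "is_basis M b"
    and N: "bimodule complex_ring B A N" "is_basis N b'"
    and \<beta>: "spans B \<beta>" and \<alpha>: "spans A \<alpha>"
    and left: "\<And>w i. \<exists>c j. \<beta> w \<triangleright>\<^bsub>M\<^esub> b i = c \<odot>\<^bsub>M\<^esub> b j \<and> \<beta> w \<triangleright>\<^bsub>N\<^esub> b' i = c \<odot>\<^bsub>N\<^esub> b' j"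
    and right: "\<And>w i. \<exists>c j. b i \<triangleleft>\<^bsub>M\<^esub> \<alpha> w = c \<odot>\<^bsub>M\<^esub> b j \<and> b' i \<triangleleft>\<^bsub>N\<^esub> \<alpha> w = c \<odot>\<^bsub>N\<^esub> b' j"
  shows "bimodule_isomorphic complex_ring B A M N"
proof -
  interpret M: bimodule complex_ring B A M by fact
  interpret N: bimodule complex_ring B A N by fact
  obtain \<psi> where \<psi>: "\<psi> \<in> linear_maps M N" "bij_betw \<psi> (carrier M) (carrier N)" "\<And>i. \<psi> (b i) = b' i"
    using bases_linear_iso[OF M.M.module_axioms M(2) N.M.module_axioms N(2)] by blast
  note \<psi>_simps = linear_mapsD[OF \<psi>(1)]
  note bc = spans_closed[OF is_basis_spans[OF M(2)]] spans_closed[OF is_basis_spans[OF N(2)]]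
    spans_closed[OF \<alpha>] spans_closed[OF \<beta>]
  have "\<psi> (u \<triangleright>\<^bsub>M\<^esub> x) = u \<triangleright>\<^bsub>N\<^esub> \<psi> x" if u: "u \<in> carrier B" and x: "x \<in> carrier M" for u x
    using \<beta> M.B.module_axioms u
  proof (induction u rule: spans_induct)
    case (multiple c w)
    show ?case
      using is_basis_spans[OF M(2)] M.M.module_axioms x
    proof (induction x rule: spans_induct)
      case (multiple d i)
      obtain e j where "\<beta> w \<triangleright>\<^bsub>M\<^esub> b i = e \<odot>\<^bsub>M\<^esub> b j" "\<beta> w \<triangleright>\<^bsub>N\<^esub> b' i = e \<odot>\<^bsub>N\<^esub> b' j"
        using left by blast
      then show ?case
        by (simp add: bc M.lact_smult_left N.lact_smult_left M.lact_smult_right N.lact_smult_right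
            \<psi>_simps \<psi>(3))
    qed (simp add: bc M.lact_add_right N.lact_add_right \<psi>_simps M.lact_closed)
  qed (simp add: M.lact_add_left N.lact_add_left x \<psi>_simps M.lact_closed)
  moreover have "\<psi> (x \<triangleleft>\<^bsub>M\<^esub> u) = \<psi> x \<triangleleft>\<^bsub>N\<^esub> u" if u: "u \<in> carrier A" and x: "x \<in> carrier M" for u x
    using \<alpha> M.A.module_axioms u
  proof (induction u rule: spans_induct)
    case (multiple c w)
    show ?case
      using is_basis_spans[OF M(2)] M.M.module_axioms x
    proof (induction x rule: spans_induct)
      case (multiple d i)
      obtain e j where "b i \<triangleleft>\<^bsub>M\<^esub> \<alpha> w = e \<odot>\<^bsub>M\<^esub> b j" "b' i \<triangleleft>\<^bsub>N\<^esub> \<alpha> w = e \<odot>\<^bsub>N\<^esub> b' j"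
        using right by blast
      then show ?case
        by (simp add: bc M.ract_smult_left N.ract_smult_left M.ract_smult_right N.ract_smult_right
            \<psi>_simps \<psi>(3))
    qed (simp add: bc M.ract_add_left N.ract_add_left \<psi>_simps M.ract_closed)
  qed (simp add: M.ract_add_right N.ract_add_right x \<psi>_simps M.ract_closed)
  moreover have "\<psi> \<in> iso (add_monoid M) (add_monoid N)"
    using \<psi>(1,2) by (auto simp: iso_def linear_maps_def)
  ultimately show ?thesis
    unfolding bimodule_isomorphic_def using \<psi>_simps(3) by (intro bexI[of _ \<psi>]) auto
qed

section \<open>Spanning families and bases of tensor products over the complex numbers\<close>

locale complex_tensor_module = tensor_module complex_ring R \<rho> \<sigma> M N V
  for R :: "'r set" and \<rho> :: "'m \<Rightarrow> 'r \<Rightarrow> 'm" and \<sigma> :: "'r \<Rightarrow> 'n \<Rightarrow> 'n"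
    and M :: "(complex, 'm, 's) module_scheme" and N :: "(complex, 'n, 't) module_scheme"
    and V :: "(complex, ('m \<times> 'n \<Rightarrow>\<^sub>0 int) set, 'v) module_scheme" +
  assumes t_smult_right: "\<lbrakk>x \<in> carrier M; y \<in> carrier N\<rbrakk> \<Longrightarrow> t x (c \<odot>\<^bsub>N\<^esub> y) = c \<odot>\<^bsub>V\<^esub> t x y"
begin

lemma tensor_lift_linear:
  assumes bi: "bihom M N free_space \<gamma>" and bal: "balanced R \<rho> \<sigma> M N \<gamma>"
    and smult: "\<And>c x y. \<lbrakk>x \<in> carrier M; y \<in> carrier N\<rbrakk> \<Longrightarrow> \<gamma> (c \<odot>\<^bsub>M\<^esub> x) y = scale c (\<gamma> x y)"
  shows "tensor_lift free_space \<gamma> \<in> linear_maps V free_space"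
proof (rule linear_mapsI)
  note hom = lift_hom[OF abelian_group_free_space bi bal]
  note pure = lift_pure[OF abelian_group_free_space bi bal]
  fix c x assume "x \<in> carrier V"
  then have "x \<in> carrier T" by (simp add: V_eq)
  then show "tensor_lift free_space \<gamma> (c \<odot>\<^bsub>V\<^esub> x) = c \<odot>\<^bsub>free_space\<^esub> tensor_lift free_space \<gamma> x"
  proof (induction x rule: T_induct)
    case (pure x y)
    then show ?case by (simp add: smult_pure lift_pure[OF abelian_group_free_space bi bal] smult)
  next
    case (add u v)
    then show ?case by (simp add: add_hom_add[OF hom] smult_add smult_T_closed)
  qed
qed (use add_hom_add[OF lift_hom[OF abelian_group_free_space bi bal]] in \<open>simp_all add: V_eq\<close>)

text \<open>\<open>S\<close> asks merely that tensors of family members lie in the span of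
  \<open>d\<close>, which leaves room for \<open>d\<close> to be a smaller family of normal
  forms.\<close>

lemma span_of_pure:
  assumes b: "spans M b" and b': "spans N b'"
    and S: "\<And>c i j. c \<odot>\<^bsub>V\<^esub> t (b i) (b' j) \<in> span_of V d" and u: "u \<in> carrier V"
  shows "u \<in> span_of V d"
  using u unfolding V_eq(1)
proof (induction u rule: T_induct)
  case (pure x y)
  note y = pure(2)
  from b M.module_axioms pure(1) show ?case
  proof (induction x rule: spans_induct)
    case (multiple c i)
    note bi = spans_closed[OF b, of i]
    from b' N.module_axioms y show ?case
    proof (induction y rule: spans_induct)
      case (multiple e j)
      have "t (c \<odot>\<^bsub>M\<^esub> b i) (e \<odot>\<^bsub>N\<^esub> b' j) = (e * c) \<odot>\<^bsub>V\<^esub> t (b i) (b' j)"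
        using bi spans_closed[OF b', of j] M.smult_assoc1[of e c "b i"]
        by (simp add: t_smult_right smult_pure)
      then show ?case using S by simp
    next
      case (add x y)
      then show ?case using bi span_of.add[OF add(3,4)] by (simp add: t_add V_eq(2))
    qed
  next
    case (add x x')
    then show ?case using y span_of.add[OF add(3,4)] by (simp add: t_add V_eq(2))
  qed
next
  case (add u v)
  then show ?case using span_of.add[OF add(3,4)] by (simp add: V_eq(2))
qed

end

locale complex_tensor =
  tensor_module complex_ring "carrier complex_ring" "\<lambda>x c. c \<odot>\<^bsub>M\<^esub> x" "\<lambda>c y. c \<odot>\<^bsub>N\<^esub> y" M N V
  for M :: "(complex, 'm, 's) module_scheme" and N :: "(complex, 'n, 't) module_scheme"
    and V :: "(complex, ('m \<times> 'n \<Rightarrow>\<^sub>0 int) set, 'v) module_scheme"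

sublocale complex_tensor \<subseteq> complex_tensor_module
  "carrier complex_ring" "\<lambda>x c. c \<odot>\<^bsub>M\<^esub> x" "\<lambda>c y. c \<odot>\<^bsub>N\<^esub> y" M N V
proof unfold_locales
  fix x y c assume "x \<in> carrier M" "y \<in> carrier N"
  then show "t x (c \<odot>\<^bsub>N\<^esub> y) = c \<odot>\<^bsub>V\<^esub> t x y"
    using t_balanced[of x c y] by (simp add: smult_pure)
qed

context complex_tensor
begin

lemma spans_tensor:
  assumes b: "spans M b" and b': "spans N b'"
  shows "spans V (\<lambda>(i, j). t (b i) (b' j))"
proof -
  have "c \<odot>\<^bsub>V\<^esub> t (b i) (b' j) \<in> span_of V (\<lambda>(i, j). t (b i) (b' j))" for c i j
    using span_of.multiple[of V c "\<lambda>(i, j). t (b i) (b' j)" "(i, j)"] by simp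
  from span_of_pure[OF assms this] show ?thesis
    unfolding spans_def using spans_closed[OF b] spans_closed[OF b'] by (auto simp: V_eq(1) t_closed)
qed

lemma is_basis_tensor:
  assumes b: "is_basis M b" and b': "is_basis N b'"
  shows "is_basis V (\<lambda>(i, j). t (b i) (b' j))"
proof -
  obtain f where f: "f \<in> linear_maps M free_space" "\<And>i. f (b i) = Poly_Mapping.single i 1"
    using b by (auto simp: is_basis_def)
  obtain f' where f': "f' \<in> linear_maps N free_space" "\<And>i. f' (b' i) = Poly_Mapping.single i 1"
    using b' by (auto simp: is_basis_def)
  \<comment> \<open>The coordinates of a pure tensor are the products of the coordinates of its
    factors.\<close>
  define \<gamma> where "\<gamma> x y = lin_ext (\<lambda>i. lin_ext (\<lambda>j. Poly_Mapping.single (i, j) 1) (f' y)) (f x)" for x y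
  have bi: "bihom M N free_space \<gamma>"
    by (rule bihomI) (simp_all add: \<gamma>_def linear_mapsD[OF f(1)] linear_mapsD[OF f'(1)])
  have bal: "balanced (carrier complex_ring) (\<lambda>x c. c \<odot>\<^bsub>M\<^esub> x) (\<lambda>c y. c \<odot>\<^bsub>N\<^esub> y) M N \<gamma>"
    by (simp add: balanced_def \<gamma>_def linear_mapsD[OF f(1)] linear_mapsD[OF f'(1)])
  have lin: "tensor_lift free_space \<gamma> \<in> linear_maps V free_space"
    by (rule tensor_lift_linear[OF bi bal]) (simp add: \<gamma>_def linear_mapsD[OF f(1)])
  have "tensor_lift free_space \<gamma> (t (b i) (b' j)) = Poly_Mapping.single (i, j) 1" for i j
    using spans_closed[OF is_basis_spans[OF b]] spans_closed[OF is_basis_spans[OF b']]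
    by (simp add: lift_pure[OF abelian_group_free_space bi bal] \<gamma>_def f(2) f'(2))
  then show ?thesis
    unfolding is_basis_def using lin spans_tensor[OF is_basis_spans[OF b] is_basis_spans[OF b']]
    by (auto intro!: bexI[OF _ lin])
qed

end

text \<open>The pure tensor \<open>m p \<otimes> n q\<close> is
  \<open>\<phi> p q\<close> times the normal form indexed by \<open>v p q\<close>, because \<open>r (h p q)\<close> can be moved across
  the tensor sign.\<close>

locale monomial_compose = bimodule_compose complex_ring B R A M N
  for B :: "(complex, 'b) module" and R :: "(complex, 'r) module" and A :: "(complex, 'a) module"
    and M :: "(complex, 'b, 'm, 'r) bimod" and N :: "(complex, 'r, 'n, 'a) bimod" +
  fixes m :: "'p \<Rightarrow> 'm" and n :: "'q \<Rightarrow> 'n" and r :: "'w \<Rightarrow> 'r"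
    and mr :: "'p \<Rightarrow> 'w \<Rightarrow> 'p" and cm :: "'p \<Rightarrow> 'w \<Rightarrow> complex"
    and rn :: "'w \<Rightarrow> 'q \<Rightarrow> 'q" and cn :: "'w \<Rightarrow> 'q \<Rightarrow> complex"
    and v :: "'p \<Rightarrow> 'q \<Rightarrow> 'v" and \<phi> :: "'p \<Rightarrow> 'q \<Rightarrow> complex"
    and sm :: "'v \<Rightarrow> 'p" and sn :: "'v \<Rightarrow> 'q" and h :: "'p \<Rightarrow> 'q \<Rightarrow> 'w"
  assumes m: "is_basis M m" and n: "is_basis N n" and r: "spans R r"
    and m_r: "m p \<triangleleft>\<^bsub>M\<^esub> r w = cm p w \<odot>\<^bsub>M\<^esub> m (mr p w)"
    and r_n: "r w \<triangleright>\<^bsub>N\<^esub> n q = cn w q \<odot>\<^bsub>N\<^esub> n (rn w q)"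
    and v_balanced: "v (mr p w) q = v p (rn w q)"
    and \<phi>_balanced: "cm p w * \<phi> (mr p w) q = cn w q * \<phi> p (rn w q)"
    and v_section: "v (sm u) (sn u) = u"
    and \<phi>_section: "\<phi> (sm u) (sn u) = 1"
    and cm_nonzero: "cm p w \<noteq> 0"
    and mr_h: "mr (sm (v p q)) (h p q) = p"
    and rn_h: "rn (h p q) q = sn (v p q)"
begin

abbreviation base where "base u \<equiv> t (m (sm u)) (n (sn u))"

lemma m_closed: "m p \<in> carrier M" and n_closed: "n q \<in> carrier N" and r_closed: "r w \<in> carrier R"
  using spans_closed[OF is_basis_spans[OF m]] spans_closed[OF is_basis_spans[OF n]]
    spans_closed[OF r] by auto

text \<open>The relation for \<open>r (h p q)\<close> joins both tensors: by \<open>mr_h\<close> it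
  turns the normal left factor into a multiple of \<open>m p\<close>, and by \<open>rn_h\<close> it
  turns \<open>n q\<close> into a multiple of the normal right factor. Cancelling the nonzero
  \<open>cm\<close> leaves the phase.\<close>

lemma pure_base: "t (m p) (n q) = \<phi> p q \<odot>\<^bsub>MN\<^esub> base (v p q)"
proof -
  let ?u = "v p q" and ?w = "h p q"
  \<comment> \<open>\<open>\<phi>_balanced\<close> at the normal left factor, where the right-hand
    phase is 1 by \<open>\<phi>_section\<close>.\<close>
  have \<phi>: "cm (sm ?u) ?w * \<phi> p q = cn ?w q"
    using \<phi>_balanced[of "sm ?u" ?w q] by (simp add: mr_h rn_h \<phi>_section)
  have base: "base ?u \<in> carrier MN"
    using m_closed n_closed t_closed by simp
  have "cm (sm ?u) ?w \<odot>\<^bsub>MN\<^esub> t (m p) (n q) = t (m (sm ?u) \<triangleleft>\<^bsub>M\<^esub> r ?w) (n q)"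
    using m_closed n_closed by (simp add: m_r mr_h t_smult)
  also have "\<dots> = t (m (sm ?u)) (r ?w \<triangleright>\<^bsub>N\<^esub> n q)"
    using m_closed n_closed r_closed by (simp add: t_balanced)
  also have "\<dots> = cn ?w q \<odot>\<^bsub>MN\<^esub> base ?u"
    using m_closed n_closed by (simp add: r_n rn_h t_smult)
  also have "\<dots> = cm (sm ?u) ?w \<odot>\<^bsub>MN\<^esub> (\<phi> p q \<odot>\<^bsub>MN\<^esub> base ?u)"
    using MN.smult_assoc1[of "cm (sm ?u) ?w" "\<phi> p q" "base ?u"] base \<phi> by simp
  finally have *: "cm (sm ?u) ?w \<odot>\<^bsub>MN\<^esub> t (m p) (n q) = cm (sm ?u) ?w \<odot>\<^bsub>MN\<^esub> (\<phi> p q \<odot>\<^bsub>MN\<^esub> base ?u)" .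
  have cancel: "(1 / cm (sm ?u) ?w) \<odot>\<^bsub>MN\<^esub> (cm (sm ?u) ?w \<odot>\<^bsub>MN\<^esub> y) = y" if "y \<in> carrier MN" for y
    using that MN.smult_assoc1[of "1 / cm (sm ?u) ?w" "cm (sm ?u) ?w" y] MN.smult_one[of y] cm_nonzero
    by simp
  show ?thesis
    using arg_cong[OF *, of "\<lambda>y. (1 / cm (sm ?u) ?w) \<odot>\<^bsub>MN\<^esub> y"]
      cancel[of "t (m p) (n q)"] cancel[of "\<phi> p q \<odot>\<^bsub>MN\<^esub> base ?u"]
      MN.smult_closed[of "\<phi> p q" "base ?u"] base t_closed[OF m_closed n_closed] by simp
qed

text \<open>In general \<open>m p\<close> is no longer a normal left factor;
  \<open>pure_base\<close> renormalises the tensor at the cost of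
  \<open>\<phi> p (sn u)\<close>.\<close>

lemma lact_base:
  assumes "b \<in> carrier B" "b \<triangleright>\<^bsub>M\<^esub> m (sm u) = c \<odot>\<^bsub>M\<^esub> m p"
  shows "b \<triangleright>\<^bsub>MN\<^esub> base u = (c * \<phi> p (sn u)) \<odot>\<^bsub>MN\<^esub> base (v p (sn u))"
proof -
  have "b \<triangleright>\<^bsub>MN\<^esub> base u = c \<odot>\<^bsub>MN\<^esub> t (m p) (n (sn u))"
    using assms by (simp add: MN_lact_pure m_closed n_closed t_smult)
  also have "\<dots> = (c * \<phi> p (sn u)) \<odot>\<^bsub>MN\<^esub> base (v p (sn u))"
    using MN.smult_assoc1[of c "\<phi> p (sn u)" "base (v p (sn u))"] t_closed m_closed n_closed
    by (simp add: pure_base[of p])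
  finally show ?thesis .
qed

lemma ract_base:
  assumes "a \<in> carrier A" "n (sn u) \<triangleleft>\<^bsub>N\<^esub> a = c \<odot>\<^bsub>N\<^esub> n q"
  shows "base u \<triangleleft>\<^bsub>MN\<^esub> a = (c * \<phi> (sm u) q) \<odot>\<^bsub>MN\<^esub> base (v (sm u) q)"
proof -
  have "base u \<triangleleft>\<^bsub>MN\<^esub> a = c \<odot>\<^bsub>MN\<^esub> t (m (sm u)) (n q)"
    using assms by (simp add: MN_ract_pure m_closed n_closed t_smult)
  also have "\<dots> = (c * \<phi> (sm u) q) \<odot>\<^bsub>MN\<^esub> base (v (sm u) q)"
    using MN.smult_assoc1[of c "\<phi> (sm u) q" "base (v (sm u) q)"] t_closed m_closed n_closed
    by (simp add: pure_base[of _ q])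
  finally show ?thesis .
qed

lemma is_basis_base: "is_basis MN base"
proof -
  interpret C: complex_tensor_module "carrier R" "ract M" "lact N" M N MN
    by unfold_locales (simp add: t_smult)
  obtain f where f: "f \<in> linear_maps M free_space" "\<And>i. f (m i) = Poly_Mapping.single i 1"
    using m by (auto simp: is_basis_def)
  obtain f' where f': "f' \<in> linear_maps N free_space" "\<And>i. f' (n i) = Poly_Mapping.single i 1"
    using n by (auto simp: is_basis_def)
  \<comment> \<open>The candidate coordinate map is read off from the right-hand side of
    \<open>pure_base\<close>.\<close>
  define \<gamma> where
    "\<gamma> x y = lin_ext (\<lambda>p. lin_ext (\<lambda>q. Poly_Mapping.single (v p q) (\<phi> p q)) (f' y)) (f x)" for x y
  note lin = linear_mapsD[OF f(1)] linear_mapsD[OF f'(1)]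
  have bi: "bihom M N free_space \<gamma>"
    by (rule bihomI) (simp_all add: \<gamma>_def lin)
  have bal: "balanced (carrier R) (ract M) (lact N) M N \<gamma>"
    unfolding balanced_def
  proof (intro ballI)
    fix x w y assume x: "x \<in> carrier M" and w: "w \<in> carrier R" and y: "y \<in> carrier N"
    \<comment> \<open>Both sides are linear in \<open>w\<close>, \<open>x\<close> and
      \<open>y\<close>, so it suffices to test \<open>r\<close>, \<open>m\<close> and
      \<open>n\<close>, where \<open>v_balanced\<close> and \<open>\<phi>_balanced\<close>
      apply.\<close>
    from r M.A.module_axioms w show "\<gamma> (x \<triangleleft>\<^bsub>M\<^esub> w) y = \<gamma> x (w \<triangleright>\<^bsub>N\<^esub> y)"
    proof (induction w rule: spans_induct)
      case (multiple c w)
      from is_basis_spans[OF m] M.M.module_axioms x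
      have "\<gamma> (x \<triangleleft>\<^bsub>M\<^esub> r w) y = \<gamma> x (r w \<triangleright>\<^bsub>N\<^esub> y)"
      proof (induction x rule: spans_induct)
        case (multiple d p)
        from is_basis_spans[OF n] N.M.module_axioms y show ?case
        proof (induction y rule: spans_induct)
          case (multiple e q)
          then show ?case
            using \<phi>_balanced[of p w q]
            by (simp add: \<gamma>_def lin f(2) f'(2) m_closed n_closed r_closed M.ract_smult_left
                N.lact_smult_right m_r r_n v_balanced ac_simps)
        qed (simp add: bihomD[OF bi] m_closed r_closed M.ract_closed N.lact_add_right N.lact_closed)
      qed (simp add: bihomD[OF bi] y r_closed M.ract_closed N.lact_closed M.ract_add_left)
      then show ?case
        by (simp add: \<gamma>_def lin x y r_closed M.ract_smult_right N.lact_smult_left M.ract_closed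
            N.lact_closed)
    qed (simp add: x y bihomD[OF bi] M.ract_add_right N.lact_add_left M.ract_closed N.lact_closed)
  qed
  have lin': "tensor_lift free_space \<gamma> \<in> linear_maps MN free_space"
    by (rule C.tensor_lift_linear[OF bi bal]) (simp add: \<gamma>_def lin)
  have "tensor_lift free_space \<gamma> (base u) = Poly_Mapping.single u 1" for u
    by (simp add: lift_pure[OF abelian_group_free_space bi bal] m_closed n_closed \<gamma>_def f(2) f'(2)
        v_section \<phi>_section)
  moreover have "spans MN base"
  proof -
    have "c \<odot>\<^bsub>MN\<^esub> t (m p) (n q) \<in> span_of MN base" for c p q
      using MN.smult_assoc1[of c "\<phi> p q" "base (v p q)"] t_closed m_closed n_closed
        span_of.multiple[of MN "c * \<phi> p q" base "v p q"]
      by (simp add: pure_base[of p q])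
    from C.span_of_pure[OF is_basis_spans[OF m] is_basis_spans[OF n] this]
    show ?thesis
      unfolding spans_def using t_closed m_closed n_closed by auto
  qed
  ultimately show ?thesis
    unfolding is_basis_def using lin' by blast
qed

end

text \<open>Scaling is a case of its own, so that for multilinear identities all cases but
  \<open>basis\<close> close by linearity alone.\<close>

lemma vec_induct [case_names basis scale add]:
  assumes "\<And>i. P (Poly_Mapping.single i 1)" "\<And>c x. P x \<Longrightarrow> P (scale c x)"
    and "\<And>x y. \<lbrakk>P x; P y\<rbrakk> \<Longrightarrow> P (x + y)"
  shows "P x"
proof -
  have "spans free_space (\<lambda>i. Poly_Mapping.single i 1)"
    by (rule spans_single) simp_all
  moreover have "module complex_ring free_space"
    by (rule module_free) simp_all
  moreover have "x \<in> carrier free_space" by simp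
  ultimately show ?thesis
  proof (induction x rule: spans_induct)
    case (multiple c i)
    show ?case using assms(1,2) by (simp del: scale_simps)
  qed (use assms(3) in simp)
qed

lemma span_of_cong:
  assumes "add N = add M" "module.smult N = module.smult M"
  shows "span_of N b = span_of M b"
proof (intro equalityI subsetI)
  show "x \<in> span_of M b" if "x \<in> span_of N b" for x
    using that by induction (simp_all add: assms span_of.intros)
  show "x \<in> span_of N b" if "x \<in> span_of M b" for x
    using that
  proof induction
    case (multiple c i)
    then show ?case using span_of.multiple[of N c b i] by (simp add: assms)
  next
    case (add x y)
    then show ?case using span_of.add[of x N b y] by (simp add: assms)
  qed
qed

text \<open>\<open>regular_bimodule\<close> and \<open>restrict_left\<close> keep the linear
  structure and change only the actions, which a basis does not see.\<close>

lemma is_basis_cong: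
  assumes "carrier N = carrier M" "add N = add M" "module.smult N = module.smult M"
  shows "is_basis N b \<longleftrightarrow> is_basis M b"
  using assms by (simp add: is_basis_def spans_def linear_maps_def hom_def span_of_cong[OF assms(2,3)])

lemma (in complex_tensor) t_scale:
  assumes "x \<in> carrier M" "y \<in> carrier N"
  shows "t (c \<odot>\<^bsub>M\<^esub> x) (d \<odot>\<^bsub>N\<^esub> y) = (c * d) \<odot>\<^bsub>V\<^esub> t x y"
  using assms M.smult_assoc1[of d c x] by (simp add: t_smult_right smult_pure mult.commute)

locale complex_algebra_tensor = algebra_tensor complex_ring A B
  for A :: "(complex, 'a) module" and B :: "(complex, 'b) module"

sublocale complex_algebra_tensor \<subseteq> complex_tensor A B AB ..

locale complex_bimodule_tensor = bimodule_tensor complex_ring B A M B' A' N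
  for B :: "(complex, 'b) module" and A :: "(complex, 'a) module"
    and M :: "(complex, 'b, 'm, 'a) bimod" and B' :: "(complex, 'b') module"
    and A' :: "(complex, 'a') module" and N :: "(complex, 'b', 'n, 'a') bimod"

sublocale complex_bimodule_tensor \<subseteq> complex_tensor M N MN ..


section \<open>The rotation algebra\<close>

locale rotation = fixes \<theta> :: real
begin

text \<open>Phases are kept as integer exponents, so that comparing them becomes ring arithmetic
  over the integers.\<close>

definition ph :: "int \<Rightarrow> complex" where "ph n = cis (\<theta> * of_int n)"

lemma ph_simps [simp]: "ph a * ph b = ph (a + b)" "ph 0 = 1" "ph a \<noteq> 0"
  by (simp_all add: ph_def cis_mult algebra_simps)

lemma ph_cong: "a = b \<Longrightarrow> ph a = ph b"
  by simp

lemma single_ph_eqI: "\<lbrakk>p = q; a = b\<rbrakk> \<Longrightarrow> Poly_Mapping.single p (ph a) = Poly_Mapping.single q (ph b)"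
  by simp

abbreviation A where "A \<equiv> rotation_algebra \<theta>"
abbreviation \<Delta> where "\<Delta> \<equiv> rotation_coproduct \<theta>"
abbreviation \<epsilon> where "\<epsilon> \<equiv> rotation_counit \<theta>"
abbreviation av where "av \<equiv> \<lambda>p :: int \<times> int. Poly_Mapping.single p (1 :: complex)"
abbreviation dv where "dv \<equiv> \<lambda>s :: int \<times> int \<times> int. Poly_Mapping.single s (1 :: complex)"
abbreviation ev where "ev \<equiv> \<lambda>l :: int. Poly_Mapping.single l (1 :: complex)"

text \<open>The pair patterns of the definition become projections, so that the rules also apply to
  basis vectors with an unsplit index.\<close>

lemma A_simps [simp]: "carrier A = UNIV" "add A = (+)" "\<zero>\<^bsub>A\<^esub> = 0"
  and A_smult: "module.smult A = scale"
  and A_one: "\<one>\<^bsub>A\<^esub> = av (0, 0)"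
  and A_mult: "x \<otimes>\<^bsub>A\<^esub> y = lin_ext (\<lambda>p. lin_ext (\<lambda>q.
    Poly_Mapping.single (fst p + fst q, snd p + snd q) (ph (fst p * snd q))) y) x"
  by (simp_all add: rotation_algebra_def case_prod_unfold ph_def)

lemma A_module: "module complex_ring A"
  by (rule module_free) (simp_all add: A_smult)

lemma A_assoc_algebra: "assoc_algebra complex_ring A"
proof -
  interpret A: module complex_ring A by (rule A_module)
  have add: "(x + y) \<otimes>\<^bsub>A\<^esub> z = x \<otimes>\<^bsub>A\<^esub> z + y \<otimes>\<^bsub>A\<^esub> z" "z \<otimes>\<^bsub>A\<^esub> (x + y) = z \<otimes>\<^bsub>A\<^esub> x + z \<otimes>\<^bsub>A\<^esub> y"
    "scale c x \<otimes>\<^bsub>A\<^esub> z = scale c (x \<otimes>\<^bsub>A\<^esub> z)" "x \<otimes>\<^bsub>A\<^esub> scale c z = scale c (x \<otimes>\<^bsub>A\<^esub> z)" for x y z c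
    by (simp_all add: A_mult)
  have assoc: "(x \<otimes>\<^bsub>A\<^esub> y) \<otimes>\<^bsub>A\<^esub> z = x \<otimes>\<^bsub>A\<^esub> (y \<otimes>\<^bsub>A\<^esub> z)" for x y z
  proof (induction x rule: vec_induct)
    case (basis p)
    show ?case
    proof (induction y rule: vec_induct)
      case (basis q)
      show ?case
      proof (induction z rule: vec_induct)
        case (basis r)
        show ?case by (simp add: A_mult algebra_simps)
      qed (simp_all add: add del: scale_simps)
    qed (simp_all add: add del: scale_simps)
  qed (simp_all add: add del: scale_simps)
  have one: "\<one>\<^bsub>A\<^esub> \<otimes>\<^bsub>A\<^esub> x = x" "x \<otimes>\<^bsub>A\<^esub> \<one>\<^bsub>A\<^esub> = x" for x
    by (induction x rule: vec_induct; simp add: A_mult A_one)+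
  have "ring A"
    by (intro ringI monoidI A.abelian_group_axioms) (simp_all add: assoc one add)
  then show ?thesis
    by (intro assoc_algebra.intro assoc_algebra_axioms.intro A_module) (simp_all add: A_smult add)
qed

sublocale A: assoc_algebra complex_ring A by (rule A_assoc_algebra)
sublocale AA: complex_algebra_tensor A A ..

lemma av_mult: "av p \<otimes>\<^bsub>A\<^esub> av q = ph (fst p * snd q) \<odot>\<^bsub>A\<^esub> av (fst p + fst q, snd p + snd q)"
  by (simp add: A_mult A_smult)

section \<open>The coproduct bimodule\<close>

definition dact where
  "dact x y d = lin_ext (\<lambda>p. lin_ext (\<lambda>q. lin_ext (\<lambda>s.
    Poly_Mapping.single (fst s + fst p, fst (snd s) + fst q, snd (snd s) - snd p - snd q)
      (ph (- ((fst s + fst p) * snd p + (fst (snd s) + fst q) * snd q)))) d) y) x"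

lemma \<Delta>_simps [simp]: "carrier \<Delta> = UNIV" "add \<Delta> = (+)" "\<zero>\<^bsub>\<Delta>\<^esub> = 0"
  and \<Delta>_smult: "module.smult \<Delta> = scale"
  and \<Delta>_lact: "u \<triangleright>\<^bsub>\<Delta>\<^esub> d = tensor_lift free_space (\<lambda>x y. dact x y d) u"
  and \<Delta>_ract: "d \<triangleleft>\<^bsub>\<Delta>\<^esub> x = lin_ext (\<lambda>s. lin_ext (\<lambda>p.
    Poly_Mapping.single (fst s + fst p, fst (snd s) + fst p, snd (snd s) - snd p)
      (ph (fst p * (snd (snd s) - snd p)))) x) d"
  by (simp_all add: rotation_coproduct_def case_prod_unfold ph_def dact_def algebra_simps)

lemma dact_linear:
  "dact (x + x') y d = dact x y d + dact x' y d" "dact x (y + y') d = dact x y d + dact x y' d"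
  "dact x y (d + d') = dact x y d + dact x y d'" "dact (scale c x) y d = scale c (dact x y d)"
  "dact x (scale c y) d = scale c (dact x y d)" "dact x y (scale c d) = scale c (dact x y d)"
  "dact (c \<odot>\<^bsub>A\<^esub> x) y d = scale c (dact x y d)"
  by (simp_all add: dact_def A_smult)

lemma \<Delta>_lact_hom: "(\<lambda>u. u \<triangleright>\<^bsub>\<Delta>\<^esub> d) \<in> add_hom AA.T free_space"
  and \<Delta>_lact_pure: "AA.t x y \<triangleright>\<^bsub>\<Delta>\<^esub> d = dact x y d"
proof -
  have 1: "bihom A A free_space (\<lambda>x y. dact x y d)"
    by (rule bihomI) (simp_all add: dact_linear)
  have 2: "balanced (carrier complex_ring) (\<lambda>x c. c \<odot>\<^bsub>A\<^esub> x) (\<lambda>c y. c \<odot>\<^bsub>A\<^esub> y) A A (\<lambda>x y. dact x y d)"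
    by (simp add: balanced_def A_smult dact_linear)
  show "(\<lambda>u. u \<triangleright>\<^bsub>\<Delta>\<^esub> d) \<in> add_hom AA.T free_space"
    unfolding \<Delta>_lact by (rule AA.lift_hom[OF abelian_group_free_space 1 2])
  show "AA.t x y \<triangleright>\<^bsub>\<Delta>\<^esub> d = dact x y d"
    unfolding \<Delta>_lact by (rule AA.lift_pure[OF abelian_group_free_space 1 2]) simp_all
qed

lemma \<Delta>_lact_add:
  "\<lbrakk>u \<in> carrier AA.T; v \<in> carrier AA.T\<rbrakk> \<Longrightarrow> (u \<oplus>\<^bsub>AA.T\<^esub> v) \<triangleright>\<^bsub>\<Delta>\<^esub> d = u \<triangleright>\<^bsub>\<Delta>\<^esub> d + v \<triangleright>\<^bsub>\<Delta>\<^esub> d"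
  using add_hom_add[OF \<Delta>_lact_hom] by simp

lemma \<Delta>_bimodule: "bimodule complex_ring AA.AB A \<Delta>"
proof -
  have M: "module complex_ring \<Delta>"
    by (rule module_free) (simp_all add: \<Delta>_smult)
  have r: "(d + d') \<triangleleft>\<^bsub>\<Delta>\<^esub> x = d \<triangleleft>\<^bsub>\<Delta>\<^esub> x + d' \<triangleleft>\<^bsub>\<Delta>\<^esub> x" "d \<triangleleft>\<^bsub>\<Delta>\<^esub> (x + x') = d \<triangleleft>\<^bsub>\<Delta>\<^esub> x + d \<triangleleft>\<^bsub>\<Delta>\<^esub> x'"
    "scale c d \<triangleleft>\<^bsub>\<Delta>\<^esub> x = scale c (d \<triangleleft>\<^bsub>\<Delta>\<^esub> x)" "d \<triangleleft>\<^bsub>\<Delta>\<^esub> scale c x = scale c (d \<triangleleft>\<^bsub>\<Delta>\<^esub> x)" for d d' x x' c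
    by (simp_all add: \<Delta>_ract)
  have m: "(x + y) \<otimes>\<^bsub>A\<^esub> z = x \<otimes>\<^bsub>A\<^esub> z + y \<otimes>\<^bsub>A\<^esub> z" "z \<otimes>\<^bsub>A\<^esub> (x + y) = z \<otimes>\<^bsub>A\<^esub> x + z \<otimes>\<^bsub>A\<^esub> y"
    "scale c x \<otimes>\<^bsub>A\<^esub> z = scale c (x \<otimes>\<^bsub>A\<^esub> z)" "x \<otimes>\<^bsub>A\<^esub> scale c z = scale c (x \<otimes>\<^bsub>A\<^esub> z)" for x y z c
    by (simp_all add: A_mult)
  have l: "u \<triangleright>\<^bsub>\<Delta>\<^esub> (d + d') = u \<triangleright>\<^bsub>\<Delta>\<^esub> d + u \<triangleright>\<^bsub>\<Delta>\<^esub> d'" "u \<triangleright>\<^bsub>\<Delta>\<^esub> scale c d = scale c (u \<triangleright>\<^bsub>\<Delta>\<^esub> d)"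
    "(c \<odot>\<^bsub>AA.AB\<^esub> u) \<triangleright>\<^bsub>\<Delta>\<^esub> d = scale c (u \<triangleright>\<^bsub>\<Delta>\<^esub> d)"
    if "u \<in> carrier AA.T" for u c d d'
    using that
    by (induction u rule: AA.T_induct)
      (simp_all add: \<Delta>_lact_pure \<Delta>_lact_add dact_linear AA.AB_smult_pure AA.AB_smult_simps)
  have lm: "(u \<otimes>\<^bsub>AA.AB\<^esub> u') \<triangleright>\<^bsub>\<Delta>\<^esub> d = u \<triangleright>\<^bsub>\<Delta>\<^esub> (u' \<triangleright>\<^bsub>\<Delta>\<^esub> d)"
    if u: "u \<in> carrier AA.T" and u': "u' \<in> carrier AA.T" for u u' d
    using u
  proof (induction u rule: AA.T_induct)
    case (pure x y)
    show ?case using u'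
    proof (induction u' rule: AA.T_induct)
      case (pure x' y')
      have "dact (x \<otimes>\<^bsub>A\<^esub> x') (y \<otimes>\<^bsub>A\<^esub> y') d = dact x y (dact x' y' d)"
      proof (induction x rule: vec_induct)
        case (basis p)
        show ?case
        proof (induction y rule: vec_induct)
          case (basis q)
          show ?case
          proof (induction x' rule: vec_induct)
            case (basis p')
            show ?case
            proof (induction y' rule: vec_induct)
              case (basis q')
              show ?case
              proof (induction d rule: vec_induct)
                case (basis s)
                \<comment> \<open>In each slot, with shifts \<open>m\<close>, \<open>m'\<close> and
                  drops \<open>j\<close>, \<open>j'\<close>, the product contributes
                  \<open>m j' - (n + m' + m)(j + j')\<close> and the successive actions
                  \<open>- (n + m') j' - (n + m' + m) j\<close>, which is the same exponent.\<close>
                show ?case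
                  by (simp add: dact_def A_mult) (rule single_ph_eqI; simp add: algebra_simps)
              qed (simp_all add: dact_linear del: scale_simps)
            qed (simp_all add: dact_linear m del: scale_simps)
          qed (simp_all add: dact_linear m del: scale_simps)
        qed (simp_all add: dact_linear m del: scale_simps)
      qed (simp_all add: dact_linear m del: scale_simps)
      then show ?case by (simp add: \<Delta>_lact_pure AA.AB_mult_pure)
    next
      case (add u v)
      then show ?case
        by (simp add: \<Delta>_lact_add AA.AB_mult_simps AA.t_closed l)
    qed
  next
    case (add u v)
    then show ?case using u' by (simp add: \<Delta>_lact_add AA.AB_mult_simps)
  qed
  have lr: "(u \<triangleright>\<^bsub>\<Delta>\<^esub> d) \<triangleleft>\<^bsub>\<Delta>\<^esub> z = u \<triangleright>\<^bsub>\<Delta>\<^esub> (d \<triangleleft>\<^bsub>\<Delta>\<^esub> z)" if u: "u \<in> carrier AA.T" for u d z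
    using u
  proof (induction u rule: AA.T_induct)
    case (pure x y)
    have "dact x y d \<triangleleft>\<^bsub>\<Delta>\<^esub> z = dact x y (d \<triangleleft>\<^bsub>\<Delta>\<^esub> z)"
    proof (induction x rule: vec_induct)
      case (basis p)
      show ?case
      proof (induction y rule: vec_induct)
        case (basis q)
        show ?case
        proof (induction d rule: vec_induct)
          case (basis s)
          show ?case
          proof (induction z rule: vec_induct)
            case (basis w)
            \<comment> \<open>The left action lowers the third index by \<open>snd p + snd q\<close>
              and so changes the phase of the right action; the right action shifts the first two
              indices by \<open>fst w\<close> and changes the phase of the left action by the same
              amount.\<close>
            show ?case by (simp add: dact_def \<Delta>_ract algebra_simps)
          qed (simp_all add: dact_linear r del: scale_simps)
        qed (simp_all add: dact_linear r del: scale_simps)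
      qed (simp_all add: dact_linear r del: scale_simps)
    qed (simp_all add: dact_linear r del: scale_simps)
    then show ?case by (simp add: \<Delta>_lact_pure)
  qed (simp add: \<Delta>_lact_add r)
  have rm: "d \<triangleleft>\<^bsub>\<Delta>\<^esub> (x \<otimes>\<^bsub>A\<^esub> y) = (d \<triangleleft>\<^bsub>\<Delta>\<^esub> x) \<triangleleft>\<^bsub>\<Delta>\<^esub> y" for d x y
  proof (induction x rule: vec_induct)
    case (basis p)
    show ?case
    proof (induction y rule: vec_induct)
      case (basis q)
      show ?case
      proof (induction d rule: vec_induct)
        case (basis s)
        \<comment> \<open>The exponent identity is
          \<open>m j' + (m + m')(l - j - j') = m (l - j) + m' (l - j - j')\<close>.\<close>
        show ?case by (simp add: \<Delta>_ract A_mult algebra_simps)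
      qed (simp_all add: r del: scale_simps)
    qed (simp_all add: r m del: scale_simps)
  qed (simp_all add: r m del: scale_simps)
  have one: "d \<triangleleft>\<^bsub>\<Delta>\<^esub> \<one>\<^bsub>A\<^esub> = d" "dact \<one>\<^bsub>A\<^esub> \<one>\<^bsub>A\<^esub> d = d" for d
    by (induction d rule: vec_induct; simp add: \<Delta>_ract dact_def A_one)+
  have r': "d \<triangleleft>\<^bsub>\<Delta>\<^esub> (c \<odot>\<^bsub>A\<^esub> x) = scale c (d \<triangleleft>\<^bsub>\<Delta>\<^esub> x)" for c d x
    by (simp add: A_smult r)
  show ?thesis
    by (intro bimodule.intro bimodule_axioms.intro AA.alg_tensor_assoc A.assoc_algebra_axioms M)
      (simp_all add: \<Delta>_smult l r r' lm lr rm one \<Delta>_lact_add AA.AB_one \<Delta>_lact_pure)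
qed

lemma dv_lact: "AA.t (av p) (av q) \<triangleright>\<^bsub>\<Delta>\<^esub> dv s =
    ph (- ((fst s + fst p) * snd p + (fst (snd s) + fst q) * snd q)) \<odot>\<^bsub>\<Delta>\<^esub>
      dv (fst s + fst p, fst (snd s) + fst q, snd (snd s) - snd p - snd q)"
  by (simp add: \<Delta>_lact_pure dact_def \<Delta>_smult)

lemma dv_ract: "dv s \<triangleleft>\<^bsub>\<Delta>\<^esub> av p = ph (fst p * (snd (snd s) - snd p)) \<odot>\<^bsub>\<Delta>\<^esub>
    dv (fst s + fst p, fst (snd s) + fst p, snd (snd s) - snd p)"
  by (simp add: \<Delta>_ract \<Delta>_smult)

section \<open>The counit module\<close>

lemma \<epsilon>_simps [simp]: "carrier \<epsilon> = UNIV" "add \<epsilon> = (+)" "\<zero>\<^bsub>\<epsilon>\<^esub> = 0"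
  and \<epsilon>_smult: "module.smult \<epsilon> = scale"
  and \<epsilon>_lact: "lact \<epsilon> = scale"
  and \<epsilon>_ract: "e \<triangleleft>\<^bsub>\<epsilon>\<^esub> x =
    lin_ext (\<lambda>l. lin_ext (\<lambda>p. Poly_Mapping.single (l - snd p) (ph (fst p * (l - snd p)))) x) e"
  by (simp_all add: rotation_counit_def case_prod_unfold ph_def)

lemma \<epsilon>_bimodule: "bimodule complex_ring (base_algebra complex_ring) A \<epsilon>"
proof -
  have M: "module complex_ring \<epsilon>"
    by (rule module_free) (simp_all add: \<epsilon>_smult)
  have r: "(d + d') \<triangleleft>\<^bsub>\<epsilon>\<^esub> x = d \<triangleleft>\<^bsub>\<epsilon>\<^esub> x + d' \<triangleleft>\<^bsub>\<epsilon>\<^esub> x" "d \<triangleleft>\<^bsub>\<epsilon>\<^esub> (x + x') = d \<triangleleft>\<^bsub>\<epsilon>\<^esub> x + d \<triangleleft>\<^bsub>\<epsilon>\<^esub> x'"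
    "scale c d \<triangleleft>\<^bsub>\<epsilon>\<^esub> x = scale c (d \<triangleleft>\<^bsub>\<epsilon>\<^esub> x)" "d \<triangleleft>\<^bsub>\<epsilon>\<^esub> scale c x = scale c (d \<triangleleft>\<^bsub>\<epsilon>\<^esub> x)" for d d' x x' c
    by (simp_all add: \<epsilon>_ract)
  have m: "(x + y) \<otimes>\<^bsub>A\<^esub> z = x \<otimes>\<^bsub>A\<^esub> z + y \<otimes>\<^bsub>A\<^esub> z" "z \<otimes>\<^bsub>A\<^esub> (x + y) = z \<otimes>\<^bsub>A\<^esub> x + z \<otimes>\<^bsub>A\<^esub> y"
    "scale c x \<otimes>\<^bsub>A\<^esub> z = scale c (x \<otimes>\<^bsub>A\<^esub> z)" "x \<otimes>\<^bsub>A\<^esub> scale c z = scale c (x \<otimes>\<^bsub>A\<^esub> z)" for x y z c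
    by (simp_all add: A_mult)
  have rm: "d \<triangleleft>\<^bsub>\<epsilon>\<^esub> (x \<otimes>\<^bsub>A\<^esub> y) = (d \<triangleleft>\<^bsub>\<epsilon>\<^esub> x) \<triangleleft>\<^bsub>\<epsilon>\<^esub> y" for d x y
  proof (induction x rule: vec_induct)
    case (basis p)
    show ?case
    proof (induction y rule: vec_induct)
      case (basis q)
      show ?case
      proof (induction d rule: vec_induct)
        case (basis s)
        show ?case by (simp add: \<epsilon>_ract A_mult algebra_simps)
      qed (simp_all add: r del: scale_simps)
    qed (simp_all add: r m del: scale_simps)
  qed (simp_all add: r m del: scale_simps)
  have one: "d \<triangleleft>\<^bsub>\<epsilon>\<^esub> \<one>\<^bsub>A\<^esub> = d" for d
    by (induction d rule: vec_induct; simp add: \<epsilon>_ract A_one)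
  show ?thesis
    by (intro bimodule.intro bimodule_axioms.intro base_algebra_assoc_algebra
        cring_from_type_algebra A.assoc_algebra_axioms M)
      (simp_all add: base_algebra_smult \<epsilon>_smult A_smult \<epsilon>_lact r rm one mult.commute)
qed

lemma ev_ract: "ev l \<triangleleft>\<^bsub>\<epsilon>\<^esub> av p = ph (fst p * (l - snd p)) \<odot>\<^bsub>\<epsilon>\<^esub> ev (l - snd p)"
  by (simp add: \<epsilon>_ract \<epsilon>_smult)

abbreviation regA where "regA \<equiv> regular_bimodule A"
abbreviation kA where "kA \<equiv> base_algebra complex_ring"

lemma regA_bimodule: "bimodule complex_ring A A regA"
  by (rule regular_bimodule_bimodule[OF A_assoc_algebra])

lemma av_basis: "is_basis A av"
  by (rule is_basis_single) (simp_all add: A_smult)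

lemma regA_av_basis: "is_basis regA av"
  using av_basis by (subst is_basis_cong[of _ A]) (simp_all add: regular_bimodule_smult)

lemma dv_basis: "is_basis \<Delta> dv"
  by (rule is_basis_single) (simp_all add: \<Delta>_smult)

lemma ev_basis: "is_basis \<epsilon> ev"
  by (rule is_basis_single) (simp_all add: \<epsilon>_smult)

lemma av_mult_reg:
  "av p \<otimes>\<^bsub>A\<^esub> av q = ph (fst p * snd q) \<odot>\<^bsub>regA\<^esub> av (fst p + fst q, snd p + snd q)"
  by (simp add: av_mult regular_bimodule_smult)

abbreviation aav where "aav \<equiv> \<lambda>(p, q). AA.t (av p) (av q)"

lemma aav_spans: "spans AA.AB aav"
  by (rule AA.spans_tensor) (rule is_basis_spans[OF av_basis])+

section \<open>The tensor bimodules and the normal forms of the four composites\<close>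

interpretation RD: complex_bimodule_tensor A A regA AA.AB A \<Delta>
  by (intro complex_bimodule_tensor.intro bimodule_tensor.intro regA_bimodule \<Delta>_bimodule)
interpretation DR: complex_bimodule_tensor AA.AB A \<Delta> A A regA
  by (intro complex_bimodule_tensor.intro bimodule_tensor.intro regA_bimodule \<Delta>_bimodule)
interpretation ER: complex_bimodule_tensor kA A \<epsilon> A A regA
  by (intro complex_bimodule_tensor.intro bimodule_tensor.intro regA_bimodule \<epsilon>_bimodule)
interpretation RE: complex_bimodule_tensor A A regA kA A \<epsilon>
  by (intro complex_bimodule_tensor.intro bimodule_tensor.intro regA_bimodule \<epsilon>_bimodule)

text \<open>The element crossing the tensor sign is \<open>a(x, y) \<otimes> a(n2, - l)\<close>. It
  carries the normal left factor to the given one with exponent \<open>n2 l\<close>, and acts on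
  \<open>d(m1, m2, k)\<close> with exponent \<open>(m2 + n2) l - (m1 + x) y\<close>; the difference
  is the exponent of \<open>\<phi>\<close>. The right action on \<open>d\<close> preserves
  \<open>n1 - n2\<close>, which survives as \<open>v2 - v3\<close>.\<close>

interpretation CL: monomial_compose "alg_tensor complex_ring A AA.AB" AA.AB A RD.MN \<Delta>
  "\<lambda>(p, s). RD.t (av p) (dv s)" dv aav
  "\<lambda>((x, y), (n\<^sub>1, n\<^sub>2, l)) ((a, b), (c, d)). ((x + a, y + b), (n\<^sub>1 + c, n\<^sub>2 + c, l - d))"
  "\<lambda>((x, y), (n\<^sub>1, n\<^sub>2, l)) ((a, b), (c, d)). ph (x * b + c * (l - d))"
  "\<lambda>((a, b), (c, d)) (m\<^sub>1, m\<^sub>2, k). (m\<^sub>1 + a, m\<^sub>2 + c, k - b - d)"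
  "\<lambda>((a, b), (c, d)) (m\<^sub>1, m\<^sub>2, k). ph (- ((m\<^sub>1 + a) * b + (m\<^sub>2 + c) * d))"
  "\<lambda>((x, y), (n\<^sub>1, n\<^sub>2, l)) (m\<^sub>1, m\<^sub>2, k). (m\<^sub>1 + x, m\<^sub>2 + n\<^sub>1, m\<^sub>2 + n\<^sub>2, k + l - y)"
  "\<lambda>((x, y), (n\<^sub>1, n\<^sub>2, l)) (m\<^sub>1, m\<^sub>2, k). ph (m\<^sub>2 * l - (m\<^sub>1 + x) * y)"
  "\<lambda>(v\<^sub>1, v\<^sub>2, v\<^sub>3, l). ((0, 0), (v\<^sub>2 - v\<^sub>3, 0, 0))"
  "\<lambda>(v\<^sub>1, v\<^sub>2, v\<^sub>3, l). (v\<^sub>1, v\<^sub>3, l)"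
  "\<lambda>((x, y), (n\<^sub>1, n\<^sub>2, l)) (m\<^sub>1, m\<^sub>2, k). ((x, y), (n\<^sub>2, - l))"
proof (intro monomial_compose.intro monomial_compose_axioms.intro bimodule_compose.intro
    RD.bimod_tensor_bimodule \<Delta>_bimodule dv_basis aav_spans
    RD.is_basis_tensor[OF regA_av_basis dv_basis])
qed (simp_all only: split_paired_all case_prod_conv,
    simp_all add: RD.MN_ract_pure RD.t_scale av_mult_reg dv_ract dv_lact algebra_simps)

text \<open>The mirror image: \<open>\<Delta>\<close> now feeds the first slot of the second factor,
  so \<open>n1 - n2\<close> survives as \<open>v1 - v2\<close> and
  \<open>a(n2, - l) \<otimes> a(x, y)\<close> is moved across.\<close>

interpretation CR: monomial_compose "alg_tensor complex_ring AA.AB A" AA.AB A DR.MN \<Delta>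
  "\<lambda>(s, p). DR.t (dv s) (av p)" dv aav
  "\<lambda>((n\<^sub>1, n\<^sub>2, l), (x, y)) ((a, b), (c, d)). ((n\<^sub>1 + a, n\<^sub>2 + a, l - b), (x + c, y + d))"
  "\<lambda>((n\<^sub>1, n\<^sub>2, l), (x, y)) ((a, b), (c, d)). ph (a * (l - b) + x * d)"
  "\<lambda>((a, b), (c, d)) (m\<^sub>1, m\<^sub>2, k). (m\<^sub>1 + a, m\<^sub>2 + c, k - b - d)"
  "\<lambda>((a, b), (c, d)) (m\<^sub>1, m\<^sub>2, k). ph (- ((m\<^sub>1 + a) * b + (m\<^sub>2 + c) * d))"
  "\<lambda>((n\<^sub>1, n\<^sub>2, l), (x, y)) (m\<^sub>1, m\<^sub>2, k). (m\<^sub>1 + n\<^sub>1, m\<^sub>1 + n\<^sub>2, m\<^sub>2 + x, k + l - y)"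
  "\<lambda>((n\<^sub>1, n\<^sub>2, l), (x, y)) (m\<^sub>1, m\<^sub>2, k). ph (m\<^sub>1 * l - (m\<^sub>2 + x) * y)"
  "\<lambda>(v\<^sub>1, v\<^sub>2, v\<^sub>3, l). ((v\<^sub>1 - v\<^sub>2, 0, 0), (0, 0))"
  "\<lambda>(v\<^sub>1, v\<^sub>2, v\<^sub>3, l). (v\<^sub>2, v\<^sub>3, l)"
  "\<lambda>((n\<^sub>1, n\<^sub>2, l), (x, y)) (m\<^sub>1, m\<^sub>2, k). ((n\<^sub>2, - l), (x, y))"
proof (intro monomial_compose.intro monomial_compose_axioms.intro bimodule_compose.intro
    DR.bimod_tensor_bimodule \<Delta>_bimodule dv_basis aav_spans
    DR.is_basis_tensor[OF dv_basis regA_av_basis])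
qed (simp_all only: split_paired_all case_prod_conv,
    simp_all add: DR.MN_ract_pure DR.t_scale av_mult_reg dv_ract dv_lact algebra_simps)

text \<open>The first component of the crossing element is \<open>a(- m1, - e)\<close>: its drop is
  forced by \<open>e\<close>, while its shift is free and is chosen to clear \<open>m1\<close>. It
  carries \<open>e(0)\<close> to \<open>e(e)\<close> with exponent \<open>- m1 e\<close>, the source
  of the summand \<open>m1 * e\<close> in \<open>\<phi>\<close>.\<close>

interpretation CE: monomial_compose "alg_tensor complex_ring kA A" AA.AB A ER.MN \<Delta>
  "\<lambda>(e, p). ER.t (ev e) (av p)" dv aav
  "\<lambda>(e, (x, y)) ((a, b), (c, d)). (e - b, (x + c, y + d))"
  "\<lambda>(e, (x, y)) ((a, b), (c, d)). ph (a * (e - b) + x * d)"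
  "\<lambda>((a, b), (c, d)) (m\<^sub>1, m\<^sub>2, k). (m\<^sub>1 + a, m\<^sub>2 + c, k - b - d)"
  "\<lambda>((a, b), (c, d)) (m\<^sub>1, m\<^sub>2, k). ph (- ((m\<^sub>1 + a) * b + (m\<^sub>2 + c) * d))"
  "\<lambda>(e, (x, y)) (m\<^sub>1, m\<^sub>2, k). (m\<^sub>2 + x, k + e - y)"
  "\<lambda>(e, (x, y)) (m\<^sub>1, m\<^sub>2, k). ph (m\<^sub>1 * e - (m\<^sub>2 + x) * y)"
  "\<lambda>(n, l). (0, (0, 0))"
  "\<lambda>(n, l). (0, n, l)"
  "\<lambda>(e, (x, y)) (m\<^sub>1, m\<^sub>2, k). ((- m\<^sub>1, - e), (x, y))"
proof (intro monomial_compose.intro monomial_compose_axioms.intro bimodule_compose.intro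
    ER.bimod_tensor_bimodule \<Delta>_bimodule dv_basis aav_spans
    ER.is_basis_tensor[OF ev_basis regA_av_basis])
qed (simp_all only: split_paired_all case_prod_conv,
    simp_all add: ER.MN_ract_pure ER.t_scale av_mult_reg ev_ract dv_lact algebra_simps)

text \<open>The counit now stands in the second slot, so the free shift clears
  \<open>m2\<close>.\<close>

interpretation CE': monomial_compose "alg_tensor complex_ring A kA" AA.AB A RE.MN \<Delta>
  "\<lambda>(p, e). RE.t (av p) (ev e)" dv aav
  "\<lambda>((x, y), e) ((a, b), (c, d)). ((x + a, y + b), e - d)"
  "\<lambda>((x, y), e) ((a, b), (c, d)). ph (x * b + c * (e - d))"
  "\<lambda>((a, b), (c, d)) (m\<^sub>1, m\<^sub>2, k). (m\<^sub>1 + a, m\<^sub>2 + c, k - b - d)"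
  "\<lambda>((a, b), (c, d)) (m\<^sub>1, m\<^sub>2, k). ph (- ((m\<^sub>1 + a) * b + (m\<^sub>2 + c) * d))"
  "\<lambda>((x, y), e) (m\<^sub>1, m\<^sub>2, k). (m\<^sub>1 + x, k + e - y)"
  "\<lambda>((x, y), e) (m\<^sub>1, m\<^sub>2, k). ph (m\<^sub>2 * e - (m\<^sub>1 + x) * y)"
  "\<lambda>(n, l). ((0, 0), 0)"
  "\<lambda>(n, l). (n, 0, l)"
  "\<lambda>((x, y), e) (m\<^sub>1, m\<^sub>2, k). ((x, y), (- m\<^sub>2, - e))"
proof (intro monomial_compose.intro monomial_compose_axioms.intro bimodule_compose.intro
    RE.bimod_tensor_bimodule \<Delta>_bimodule dv_basis aav_spans
    RE.is_basis_tensor[OF regA_av_basis ev_basis])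
qed (simp_all only: split_paired_all case_prod_conv,
    simp_all add: RE.MN_ract_pure RE.t_scale av_mult_reg ev_ract dv_lact algebra_simps)

section \<open>The counit isomorphisms\<close>

lemma regA_twisted_basis:
  assumes "bij \<pi>" shows "is_basis regA (\<lambda>u. ph (f u) \<odot>\<^bsub>regA\<^esub> av (\<pi> u))"
  using assms
  by (intro is_basis_rescale[OF regA_av_basis])
    (simp_all add: module_cong[OF A_module] regular_bimodule_smult)

lemma bij_flip: "bij (\<lambda>(n, l). (n, - l) :: int \<times> int)"
  by (rule o_bij[where g = "\<lambda>(n, l). (n, - l)"]) auto

lemma regA_bimodule_acts:
  "av p \<triangleright>\<^bsub>regA\<^esub> (ph c \<odot>\<^bsub>regA\<^esub> av q) =
    ph (c + fst p * snd q) \<odot>\<^bsub>regA\<^esub> av (fst p + fst q, snd p + snd q)"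
  "(ph c \<odot>\<^bsub>regA\<^esub> av q) \<triangleleft>\<^bsub>regA\<^esub> av p =
    ph (c + fst q * snd p) \<odot>\<^bsub>regA\<^esub> av (fst q + fst p, snd q + snd p)"
  by (simp_all add: regular_bimodule_smult A_smult A_mult)

text \<open>The phase is forced by sending \<open>CE.base (0, 0)\<close> to the unit:
  \<open>a(n, - l)\<close> carries \<open>CE.base (0, 0)\<close> to \<open>CE.base (n, l)\<close>
  with exponent \<open>n l\<close>, so the latter must go to \<open>a(n, - l)\<close> with exponent
  \<open>- n l\<close>.\<close>

lemma counit_left: "bimodule_isomorphic complex_ring A A
  (restrict_left (\<lambda>a. alg_pure complex_ring kA A \<one>\<^bsub>complex_ring\<^esub> a) CE.MN) regA"
proof (rule bimodule_isomorphic_bases[where b = CE.base and \<beta> = av and \<alpha> = av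
      and b' = "\<lambda>u. ph (- (fst u * snd u)) \<odot>\<^bsub>regA\<^esub> av ((\<lambda>(n, l). (n, - l)) u)"])
  show "bimodule complex_ring A A
      (restrict_left (\<lambda>a. alg_pure complex_ring kA A \<one>\<^bsub>complex_ring\<^esub> a) CE.MN)"
    using ER.BB.pure_right_algebra_hom
    by (intro restrict_left_bimodule[OF CE.bimod_compose_bimodule A_assoc_algebra])
      (simp add: ER.BB.alg_pure_eq)
  show "is_basis (restrict_left (\<lambda>a. alg_pure complex_ring kA A \<one>\<^bsub>complex_ring\<^esub> a) CE.MN) CE.base"
    by (rule is_basis_cong[THEN iffD2, OF _ _ _ CE.is_basis_base]) simp_all
  fix w u :: "int \<times> int"
  obtain a b n l where [simp]: "w = (a, b)" "u = (n, l)"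
    by (cases w, cases u) auto
  let ?b = "\<lambda>u. ph (- (fst u * snd u)) \<odot>\<^bsub>regA\<^esub> av ((\<lambda>(n, l). (n, - l)) u)"
  \<comment> \<open>\<open>ER.BB.t 1 (av w)\<close> is \<open>av w\<close> seen in
    \<open>k \<otimes> A\<close>. The second component of the normal left factor is the unit, so no
    phase arises.\<close>
  have "ER.BB.t 1 (av w) \<triangleright>\<^bsub>ER.MN\<^esub> ER.t (ev 0) (av (0, 0)) = 1 \<odot>\<^bsub>ER.MN\<^esub> ER.t (ev 0) (av (a, b))"
    using ER.MN.smult_one[of "ER.t (ev 0) (av (a, b))"] ER.t_closed
    by (simp add: ER.MN_lact_pure \<epsilon>_lact A_mult)
  then have "ER.BB.t 1 (av w) \<triangleright>\<^bsub>CE.MN\<^esub> CE.base u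
      = ph (- ((n + a) * b)) \<odot>\<^bsub>CE.MN\<^esub> CE.base (n + a, l - b)"
    using CE.lact_base[of "ER.BB.t 1 (av w)" u 1 "(0, (a, b))"] ER.BB.t_closed by simp
  moreover have "av w \<triangleright>\<^bsub>regA\<^esub> ?b u = ph (- ((n + a) * b)) \<odot>\<^bsub>regA\<^esub> ?b (n + a, l - b)"
    by (simp only: regA_bimodule_acts) (auto simp: regular_bimodule_smult A_smult algebra_simps intro!: single_ph_eqI)
  ultimately show "\<exists>c j. av w \<triangleright>\<^bsub>restrict_left (\<lambda>a. alg_pure complex_ring kA A \<one>\<^bsub>complex_ring\<^esub> a) CE.MN\<^esub> CE.base u
      = c \<odot>\<^bsub>restrict_left (\<lambda>a. alg_pure complex_ring kA A \<one>\<^bsub>complex_ring\<^esub> a) CE.MN\<^esub> CE.base j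
      \<and> av w \<triangleright>\<^bsub>regA\<^esub> ?b u = c \<odot>\<^bsub>regA\<^esub> ?b j"
    by (intro exI[of _ "ph (- ((n + a) * b))"] exI[of _ "(n + a, l - b)"])
      (simp add: ER.BB.alg_pure_eq)
  \<comment> \<open>The right action moves the first index of \<open>d(0, n, l)\<close> to
    \<open>a\<close>. Clearing it again is free of phase, because the left factor is
    \<open>e(0) \<otimes> a(0, 0)\<close>.\<close>
  have "CE.base u \<triangleleft>\<^bsub>CE.MN\<^esub> av w = ph (a * (l - b)) \<odot>\<^bsub>CE.MN\<^esub> CE.base (n + a, l - b)"
    using CE.ract_base[of "av w" u "ph (a * (l - b))" "(a, n + a, l - b)"] dv_ract[of "(0, n, l)" w]
    by simp
  moreover have "?b u \<triangleleft>\<^bsub>regA\<^esub> av w = ph (a * (l - b)) \<odot>\<^bsub>regA\<^esub> ?b (n + a, l - b)"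
    by (simp only: regA_bimodule_acts) (auto simp: regular_bimodule_smult A_smult algebra_simps intro!: single_ph_eqI)
  ultimately show "\<exists>c j. CE.base u \<triangleleft>\<^bsub>restrict_left (\<lambda>a. alg_pure complex_ring kA A \<one>\<^bsub>complex_ring\<^esub> a) CE.MN\<^esub> av w
      = c \<odot>\<^bsub>restrict_left (\<lambda>a. alg_pure complex_ring kA A \<one>\<^bsub>complex_ring\<^esub> a) CE.MN\<^esub> CE.base j
      \<and> ?b u \<triangleleft>\<^bsub>regA\<^esub> av w = c \<odot>\<^bsub>regA\<^esub> ?b j"
    by (intro exI[of _ "ph (a * (l - b))"] exI[of _ "(n + a, l - b)"]) simp
qed (intro regA_bimodule regA_twisted_basis bij_flip is_basis_spans av_basis)+

text \<open>The phase of the matching is the same as on the other side; only the cleared index of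
  \<open>d\<close> is now the second one.\<close>

lemma counit_right: "bimodule_isomorphic complex_ring A A
  (restrict_left (\<lambda>a. alg_pure complex_ring A kA a \<one>\<^bsub>complex_ring\<^esub>) CE'.MN) regA"
proof (rule bimodule_isomorphic_bases[where b = CE'.base and \<beta> = av and \<alpha> = av
      and b' = "\<lambda>u. ph (- (fst u * snd u)) \<odot>\<^bsub>regA\<^esub> av ((\<lambda>(n, l). (n, - l)) u)"])
  show "bimodule complex_ring A A
      (restrict_left (\<lambda>a. alg_pure complex_ring A kA a \<one>\<^bsub>complex_ring\<^esub>) CE'.MN)"
    using RE.BB.pure_left_algebra_hom
    by (intro restrict_left_bimodule[OF CE'.bimod_compose_bimodule A_assoc_algebra])
      (simp add: RE.BB.alg_pure_eq)
  show "is_basis (restrict_left (\<lambda>a. alg_pure complex_ring A kA a \<one>\<^bsub>complex_ring\<^esub>) CE'.MN) CE'.base"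
    by (rule is_basis_cong[THEN iffD2, OF _ _ _ CE'.is_basis_base]) simp_all
  fix w u :: "int \<times> int"
  obtain a b n l where [simp]: "w = (a, b)" "u = (n, l)"
    by (cases w, cases u) auto
  let ?b = "\<lambda>u. ph (- (fst u * snd u)) \<odot>\<^bsub>regA\<^esub> av ((\<lambda>(n, l). (n, - l)) u)"
  have "RE.BB.t (av w) 1 \<triangleright>\<^bsub>RE.MN\<^esub> RE.t (av (0, 0)) (ev 0) = 1 \<odot>\<^bsub>RE.MN\<^esub> RE.t (av (a, b)) (ev 0)"
    using RE.MN.smult_one[of "RE.t (av (a, b)) (ev 0)"] RE.t_closed
    by (simp add: RE.MN_lact_pure \<epsilon>_lact A_mult)
  then have "RE.BB.t (av w) 1 \<triangleright>\<^bsub>CE'.MN\<^esub> CE'.base u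
      = ph (- ((n + a) * b)) \<odot>\<^bsub>CE'.MN\<^esub> CE'.base (n + a, l - b)"
    using CE'.lact_base[of "RE.BB.t (av w) 1" u 1 "((a, b), 0)"] RE.BB.t_closed by simp
  moreover have "av w \<triangleright>\<^bsub>regA\<^esub> ?b u = ph (- ((n + a) * b)) \<odot>\<^bsub>regA\<^esub> ?b (n + a, l - b)"
    by (simp only: regA_bimodule_acts) (auto simp: regular_bimodule_smult A_smult algebra_simps intro!: single_ph_eqI)
  ultimately show "\<exists>c j. av w \<triangleright>\<^bsub>restrict_left (\<lambda>a. alg_pure complex_ring A kA a \<one>\<^bsub>complex_ring\<^esub>) CE'.MN\<^esub> CE'.base u
      = c \<odot>\<^bsub>restrict_left (\<lambda>a. alg_pure complex_ring A kA a \<one>\<^bsub>complex_ring\<^esub>) CE'.MN\<^esub> CE'.base j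
      \<and> av w \<triangleright>\<^bsub>regA\<^esub> ?b u = c \<odot>\<^bsub>regA\<^esub> ?b j"
    by (intro exI[of _ "ph (- ((n + a) * b))"] exI[of _ "(n + a, l - b)"])
      (simp add: RE.BB.alg_pure_eq)
  have "CE'.base u \<triangleleft>\<^bsub>CE'.MN\<^esub> av w = ph (a * (l - b)) \<odot>\<^bsub>CE'.MN\<^esub> CE'.base (n + a, l - b)"
    using CE'.ract_base[of "av w" u "ph (a * (l - b))" "(n + a, a, l - b)"] dv_ract[of "(n, 0, l)" w]
    by simp
  moreover have "?b u \<triangleleft>\<^bsub>regA\<^esub> av w = ph (a * (l - b)) \<odot>\<^bsub>regA\<^esub> ?b (n + a, l - b)"
    by (simp only: regA_bimodule_acts) (auto simp: regular_bimodule_smult A_smult algebra_simps intro!: single_ph_eqI)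
  ultimately show "\<exists>c j. CE'.base u \<triangleleft>\<^bsub>restrict_left (\<lambda>a. alg_pure complex_ring A kA a \<one>\<^bsub>complex_ring\<^esub>) CE'.MN\<^esub> av w
      = c \<odot>\<^bsub>restrict_left (\<lambda>a. alg_pure complex_ring A kA a \<one>\<^bsub>complex_ring\<^esub>) CE'.MN\<^esub> CE'.base j
      \<and> ?b u \<triangleleft>\<^bsub>regA\<^esub> av w = c \<odot>\<^bsub>regA\<^esub> ?b j"
    by (intro exI[of _ "ph (a * (l - b))"] exI[of _ "(n + a, l - b)"]) simp
qed (intro regA_bimodule regA_twisted_basis bij_flip is_basis_spans av_basis)+

section \<open>The coassociativity isomorphism\<close>

interpretation A3: algebra_tensor3 complex_ring A A A ..
interpretation A3': complex_algebra_tensor AA.AB A ..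

abbreviation phase3 :: "(int \<times> int) \<Rightarrow> (int \<times> int) \<Rightarrow> (int \<times> int) \<Rightarrow> int \<times> int \<times> int \<times> int \<Rightarrow> complex"
  where "phase3 \<equiv> \<lambda>(a\<^sub>1, b\<^sub>1) (a\<^sub>2, b\<^sub>2) (a\<^sub>3, b\<^sub>3) (v\<^sub>1, v\<^sub>2, v\<^sub>3, l).
    ph (- ((v\<^sub>1 + a\<^sub>1) * b\<^sub>1 + (v\<^sub>2 + a\<^sub>2) * b\<^sub>2 + (v\<^sub>3 + a\<^sub>3) * b\<^sub>3))"

abbreviation shift3 :: "(int \<times> int) \<Rightarrow> (int \<times> int) \<Rightarrow> (int \<times> int) \<Rightarrow> int \<times> int \<times> int \<times> int
    \<Rightarrow> int \<times> int \<times> int \<times> int"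
  where "shift3 \<equiv> \<lambda>(a\<^sub>1, b\<^sub>1) (a\<^sub>2, b\<^sub>2) (a\<^sub>3, b\<^sub>3) (v\<^sub>1, v\<^sub>2, v\<^sub>3, l).
    (v\<^sub>1 + a\<^sub>1, v\<^sub>2 + a\<^sub>2, v\<^sub>3 + a\<^sub>3, l - b\<^sub>1 - b\<^sub>2 - b\<^sub>3)"

text \<open>The two composites have different normal forms, but their indices were chosen so that
  the left action becomes one expression treating the three slots alike. This lemma and its
  counterpart for \<open>CR\<close> make that explicit.\<close>

lemma CL_lact: "RD.BB.t (av p) (AA.t (av q) (av r)) \<triangleright>\<^bsub>CL.MN\<^esub> CL.base u
    = phase3 p q r u \<odot>\<^bsub>CL.MN\<^esub> CL.base (shift3 p q r u)"
proof -
  obtain a1 b1 a2 b2 a3 b3 v1 v2 v3 l where [simp]: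
    "p = (a1, b1)" "q = (a2, b2)" "r = (a3, b3)" "u = (v1, v2, v3, l)"
    by (cases p, cases q, cases r, cases u) auto
  let ?c = "ph (- ((v2 - v3 + a2) * b2 + a3 * b3))"
  have "RD.BB.t (av p) (AA.t (av q) (av r)) \<triangleright>\<^bsub>RD.MN\<^esub> RD.t (av (0, 0)) (dv (v2 - v3, 0, 0))
      = ?c \<odot>\<^bsub>RD.MN\<^esub> RD.t (av (a1, b1)) (dv (v2 - v3 + a2, a3, - b2 - b3))"
    by (simp add: RD.MN_lact_pure AA.t_closed dv_lact av_mult_reg RD.t_scale)
  then have "RD.BB.t (av p) (AA.t (av q) (av r)) \<triangleright>\<^bsub>CL.MN\<^esub> CL.base u
      = (?c * ph (v3 * (- b2 - b3) - (v1 + a1) * b1)) \<odot>\<^bsub>CL.MN\<^esub>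
        CL.base (v1 + a1, v3 + (v2 - v3 + a2), v3 + a3, l + (- b2 - b3) - b1)"
    using CL.lact_base[of "RD.BB.t (av p) (AA.t (av q) (av r))" u ?c
        "((a1, b1), (v2 - v3 + a2, a3, - b2 - b3))"] RD.BB.t_closed AA.t_closed
    by simp
  \<comment> \<open>The renormalising exponent \<open>v3 * (- b2 - b3)\<close> turns
    \<open>v2 - v3 + a2\<close> into \<open>v2 + a2\<close> and \<open>a3\<close> into
    \<open>v3 + a3\<close>.\<close>
  moreover have "?c * ph (v3 * (- b2 - b3) - (v1 + a1) * b1) = phase3 p q r u"
    by (auto intro!: ph_cong simp: algebra_simps)
  moreover have "(v1 + a1, v3 + (v2 - v3 + a2), v3 + a3, l + (- b2 - b3) - b1) = shift3 p q r u"
    by simp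
  ultimately show ?thesis by (simp only:)
qed

lemma CR_lact: "DR.BB.t (AA.t (av p) (av q)) (av r) \<triangleright>\<^bsub>CR.MN\<^esub> CR.base u
    = phase3 p q r u \<odot>\<^bsub>CR.MN\<^esub> CR.base (shift3 p q r u)"
proof -
  obtain a1 b1 a2 b2 a3 b3 v1 v2 v3 l where [simp]:
    "p = (a1, b1)" "q = (a2, b2)" "r = (a3, b3)" "u = (v1, v2, v3, l)"
    by (cases p, cases q, cases r, cases u) auto
  let ?c = "ph (- ((v1 - v2 + a1) * b1 + a2 * b2))"
  have "DR.BB.t (AA.t (av p) (av q)) (av r) \<triangleright>\<^bsub>DR.MN\<^esub> DR.t (dv (v1 - v2, 0, 0)) (av (0, 0))
      = ?c \<odot>\<^bsub>DR.MN\<^esub> DR.t (dv (v1 - v2 + a1, a2, - b1 - b2)) (av (a3, b3))"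
    by (simp add: DR.MN_lact_pure AA.t_closed dv_lact av_mult_reg DR.t_scale)
  then have "DR.BB.t (AA.t (av p) (av q)) (av r) \<triangleright>\<^bsub>CR.MN\<^esub> CR.base u
      = (?c * ph (v2 * (- b1 - b2) - (v3 + a3) * b3)) \<odot>\<^bsub>CR.MN\<^esub>
        CR.base (v2 + (v1 - v2 + a1), v2 + a2, v3 + a3, l + (- b1 - b2) - b3)"
    using CR.lact_base[of "DR.BB.t (AA.t (av p) (av q)) (av r)" u ?c
        "((v1 - v2 + a1, a2, - b1 - b2), (a3, b3))"] DR.BB.t_closed AA.t_closed
    by simp
  \<comment> \<open>Here \<open>v2 * (- b1 - b2)\<close> completes the first two slots.\<close>
  moreover have "?c * ph (v2 * (- b1 - b2) - (v3 + a3) * b3) = phase3 p q r u"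
    by (auto intro!: ph_cong simp: algebra_simps)
  moreover have "(v2 + (v1 - v2 + a1), v2 + a2, v3 + a3, l + (- b1 - b2) - b3) = shift3 p q r u"
    by simp
  ultimately show ?thesis by (simp only:)
qed

lemma coassociativity: "bimodule_isomorphic complex_ring (alg_tensor complex_ring AA.AB A) A
  (restrict_left (alg_assoc complex_ring A A A) CL.MN) CR.MN"
proof (rule bimodule_isomorphic_bases[where b = CL.base and b' = CR.base and \<alpha> = av
      and \<beta> = "\<lambda>(w, r). DR.BB.t (aav w) (av r)"])
  show "bimodule complex_ring (alg_tensor complex_ring AA.AB A) A
      (restrict_left (alg_assoc complex_ring A A A) CL.MN)"
    by (rule restrict_left_bimodule[OF CL.bimod_compose_bimodule DR.BB.alg_tensor_assoc
        A3.alg_assoc_algebra_hom])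
  show "is_basis (restrict_left (alg_assoc complex_ring A A A) CL.MN) CL.base"
    by (rule is_basis_cong[THEN iffD2, OF _ _ _ CL.is_basis_base]) simp_all
  show "spans (alg_tensor complex_ring AA.AB A) (\<lambda>(w, r). DR.BB.t (aav w) (av r))"
    by (rule A3'.spans_tensor[OF aav_spans is_basis_spans[OF av_basis]])
next
  fix w :: "((int \<times> int) \<times> (int \<times> int)) \<times> (int \<times> int)" and u :: "int \<times> int \<times> int \<times> int"
  obtain p q r where [simp]: "w = ((p, q), r)"
    by (cases w) auto
  have "alg_assoc complex_ring A A A (DR.BB.t (AA.t (av p) (av q)) (av r))
      = RD.BB.t (av p) (AA.t (av q) (av r))"
    by (rule A3.alg_assoc_pure) simp_all
  then show "\<exists>c j. (case w of (w, r) \<Rightarrow> DR.BB.t (aav w) (av r))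
        \<triangleright>\<^bsub>restrict_left (alg_assoc complex_ring A A A) CL.MN\<^esub> CL.base u
      = c \<odot>\<^bsub>restrict_left (alg_assoc complex_ring A A A) CL.MN\<^esub> CL.base j
      \<and> (case w of (w, r) \<Rightarrow> DR.BB.t (aav w) (av r)) \<triangleright>\<^bsub>CR.MN\<^esub> CR.base u = c \<odot>\<^bsub>CR.MN\<^esub> CR.base j"
    using CL_lact[of p q r u] CR_lact[of p q r u]
    by (intro exI[of _ "phase3 p q r u"] exI[of _ "shift3 p q r u"]) simp
next
  fix w :: "int \<times> int" and u :: "int \<times> int \<times> int \<times> int"
  obtain a b v1 v2 v3 l where [simp]: "w = (a, b)" "u = (v1, v2, v3, l)"
    by (cases w, cases u) auto
  \<comment> \<open>The right action reaches only the last factor, \<open>d(v1, v3, l)\<close> for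
    \<open>CL\<close> and \<open>d(v2, v3, l)\<close> for \<open>CR\<close>. The missing index moves
    along because the left factor stores only the difference \<open>v2 - v3\<close> or
    \<open>v1 - v2\<close>, and renormalising adds no phase.\<close>
  have "CL.base u \<triangleleft>\<^bsub>CL.MN\<^esub> av w
      = ph (a * (l - b)) \<odot>\<^bsub>CL.MN\<^esub> CL.base (v1 + a, v2 + a, v3 + a, l - b)"
    using CL.ract_base[of "av w" u "ph (a * (l - b))" "(v1 + a, v3 + a, l - b)"]
      dv_ract[of "(v1, v3, l)" w] by (simp add: algebra_simps)
  moreover have "CR.base u \<triangleleft>\<^bsub>CR.MN\<^esub> av w
      = ph (a * (l - b)) \<odot>\<^bsub>CR.MN\<^esub> CR.base (v1 + a, v2 + a, v3 + a, l - b)"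
    using CR.ract_base[of "av w" u "ph (a * (l - b))" "(v2 + a, v3 + a, l - b)"]
      dv_ract[of "(v2, v3, l)" w] by (simp add: algebra_simps)
  ultimately show "\<exists>c j. CL.base u \<triangleleft>\<^bsub>restrict_left (alg_assoc complex_ring A A A) CL.MN\<^esub> av w
      = c \<odot>\<^bsub>restrict_left (alg_assoc complex_ring A A A) CL.MN\<^esub> CL.base j
      \<and> CR.base u \<triangleleft>\<^bsub>CR.MN\<^esub> av w = c \<odot>\<^bsub>CR.MN\<^esub> CR.base j"
    by (intro exI[of _ "ph (a * (l - b))"] exI[of _ "(v1 + a, v2 + a, v3 + a, l - b)"]) simp
qed (intro CR.bimod_compose_bimodule CR.is_basis_base is_basis_spans[OF av_basis])+

theorem sesquiunital: "sesquiunital_sesquialgebra complex_ring A \<Delta> \<epsilon>"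
  by (intro sesquiunital_sesquialgebra.intro sesquiunital_sesquialgebra_axioms.intro
      A_assoc_algebra \<Delta>_bimodule \<epsilon>_bimodule coassociativity counit_left counit_right)

end

theorem proposition1:
  fixes \<theta> :: real
  assumes "\<theta> / (2 * pi) \<notin> \<rat>"
  shows "sesquiunital_sesquialgebra complex_ring
    (rotation_algebra \<theta>) (rotation_coproduct \<theta>) (rotation_counit \<theta>)"
  by (rule rotation.sesquiunital)

end
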